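(* The degrees of the algebras of joint invariants and covariants of $n$ linear forms are as follows. (i) For every integer $n\ge 3$, $$\deg(\mathcal{I}_{n})=\frac{N_{n-2}(1)}{2^{2n-3}}=\frac{\binom{2n-4}{n-2}}{(n-1)\,2^{2n-3}}.$$ (ii) For every integer $n\ge 1$, $$\deg(\mathcal{C}_{n})=\frac{\binom{2n-2}{n-1}}{2^{2n-2}}.$$
   Context: Let $V_1$ be the (two-dimensional) complex vector space of linear binary forms with the natural action of $SL_2=SL_2(\mathbb{C})$, and let $nV_1=V_1\oplus\cdots\oplus V_1$ ($n$ copies). $SL_2$ acts on $\mathbb{C}^2$ by the standard representation, and hence on the algebras of polynomial functions $\mathbb{C}[nV_1]$ and $\mathbb{C}[nV_1\oplus\mathbb{C}^2]$. The algebra of joint invariants of $n$ linear forms is $\mathcal{I}_n=\mathbb{C}[nV_1]^{SL_2}$, and the algebra of joint covariants of $n$ linear forms is $\mathcal{C}_n=\mathbb{C}[nV_1\oplus\mathbb{C}^2]^{SL_2}$ (the subalgebras of $SL_2$-invariant polynomial functions). Both algebras are graded by the degree in the coefficients of the forms: $(\mathcal{I}_n)_j$ (respectively $(\mathcal{C}_n)_j$) is the space of elements that are homogeneous of degree $j$ in the coordinates of $nV_1$; for $\mathcal{C}_n$ the degree in the coordinates of $\mathbb{C}^2$ is not counted. These spaces are finite-dimensional. For a finitely generated graded complex algebra $R=R_0\oplus R_1\oplus\cdots$ with $R_0=\mathbb{C}$, its Poincaré series is $\mathcal{P}(R,z)=\sum_{j\ge0}\dim R_j\,z^j$ (a rational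 function of $z$). If $r$ is the transcendence degree over $\mathbb{C}$ of the quotient field of $R$, the degree of the algebra $R$ is the number $\deg(R):=\lim_{z\to1}(1-z)^r\,\mathcal{P}(R,z)$. The Narayana polynomials are $N_m(z)=\sum_{k=1}^{m}\frac1k\binom{m-1}{k-1}\binom{m}{k-1}z^{k-1}$ for $m\ge1$. *)

theory Defs
  imports
    "HOL-Analysis.Analysis"
    "HOL-Computational_Algebra.Computational_Algebra"
    "HOL-Library.Poly_Mapping"
begin

type_synonym 'v cpoly = "('v \<Rightarrow>\<^sub>0 nat) \<Rightarrow>\<^sub>0 complex"

definition cpoly_vars :: "'v cpoly \<Rightarrow> 'v set" where
  "cpoly_vars p = (\<Union>m\<in>Poly_Mapping.keys p. Poly_Mapping.keys m)"

definition cpoly_const :: "complex \<Rightarrow> 'v cpoly" where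
  "cpoly_const c = Poly_Mapping.single 0 c"

(* The value of p at the point v of a commutative algebra with structure map h. *)
definition cpoly_eval :: "(complex \<Rightarrow> 'a::comm_ring_1) \<Rightarrow> ('v \<Rightarrow> 'a) \<Rightarrow> 'v cpoly \<Rightarrow> 'a" where
  "cpoly_eval h v p =
     (\<Sum>m\<in>Poly_Mapping.keys p. h (Poly_Mapping.lookup p m) *
        (\<Prod>x\<in>Poly_Mapping.keys m. v x ^ Poly_Mapping.lookup m x))"

global_interpretation cpoly: vector_space "\<lambda>c (p :: nat cpoly). cpoly_const c * p"
  defines cpoly_dim = cpoly.dim
  by unfold_locales
     (simp_all add: cpoly_const_def algebra_simps single_add mult_single
        flip: mult.assoc single_one)


text \<open>
  A family \<open>w\<close> of vectors stands for the point \<open>(w 1, \<dots>, w n, w 0)\<close> of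
  \<open>nV\<^sub>1 \<oplus> \<complex>\<^sup>2\<close>: for \<open>i \<ge> 1\<close>, \<open>w i\<close> is the coefficient vector
  \<open>(a, b)\<close> of the linear form \<open>a x + b y\<close>, and \<open>w 0\<close> is the point of \<open>\<complex>\<^sup>2\<close>.
  The polynomial variables \<open>2 i\<close> and \<open>2 i + 1\<close> are the two coordinates of \<open>w i\<close>.
\<close>

definition coords :: "(nat \<Rightarrow> complex^2) \<Rightarrow> nat \<Rightarrow> complex" where
  "coords w k = (if even k then w (k div 2) $ 1 else w (k div 2) $ 2)"

definition SL2 :: "(complex^2^2) set" where
  "SL2 = {g. det g = 1}"

(* On forms this is (g l)(x) = l(g^{-1} x), in coefficients the row vector times g^{-1}. *)
definition SL2_act :: "complex^2^2 \<Rightarrow> (nat \<Rightarrow> complex^2) \<Rightarrow> nat \<Rightarrow> complex^2" where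
  "SL2_act g w i = (if i = 0 then g *v w i else w i v* matrix_inv g)"

definition SL2_invariant :: "nat cpoly \<Rightarrow> bool" where
  "SL2_invariant p \<longleftrightarrow>
     (\<forall>g\<in>SL2. \<forall>w. cpoly_eval id (coords (SL2_act g w)) p = cpoly_eval id (coords w) p)"

definition joint_invariants :: "nat \<Rightarrow> nat cpoly set" where
  "joint_invariants n = {p. cpoly_vars p \<subseteq> {2..<2 * n + 2} \<and> SL2_invariant p}"

definition joint_covariants :: "nat \<Rightarrow> nat cpoly set" where
  "joint_covariants n = {p. cpoly_vars p \<subseteq> {0..<2 * n + 2} \<and> SL2_invariant p}"

(* The variables 0 and 1, the coordinates of \<complex>^2, are not counted in the degree. *)
definition graded_part :: "nat cpoly set \<Rightarrow> nat \<Rightarrow> nat cpoly set" where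
  "graded_part R j =
     {p \<in> R. \<forall>m\<in>Poly_Mapping.keys p.
        (\<Sum>k\<in>Poly_Mapping.keys m - {0, 1}. Poly_Mapping.lookup m k) = j}"

definition poincare_series :: "nat cpoly set \<Rightarrow> complex fps" where
  "poincare_series R = Abs_fps (\<lambda>j. of_nat (cpoly_dim (graded_part R j)))"


definition quotient_field :: "'a::idom set \<Rightarrow> 'a fract set" where
  "quotient_field R = {Fraction_Field.Fract a b | a b. a \<in> R \<and> b \<in> R \<and> b \<noteq> 0}"

(* The elements of B themselves serve as the variables of the polynomials. *)
definition algebraically_independent :: "nat cpoly fract set \<Rightarrow> bool" where
  "algebraically_independent B \<longleftrightarrow>
     (\<forall>p. cpoly_vars p \<subseteq> B \<and>
          cpoly_eval (\<lambda>c. Fraction_Field.Fract (cpoly_const c) 1) id p = 0 \<longrightarrow> p = 0)"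

definition transcendence_basis :: "nat cpoly fract set \<Rightarrow> nat cpoly fract set \<Rightarrow> bool" where
  "transcendence_basis K B \<longleftrightarrow>
     B \<subseteq> K \<and> algebraically_independent B \<and>
     (\<forall>y\<in>K - B. \<not> algebraically_independent (insert y B))"

definition has_transcendence_degree :: "nat cpoly fract set \<Rightarrow> nat \<Rightarrow> bool" where
  "has_transcendence_degree K r \<longleftrightarrow>
     (\<exists>B. transcendence_basis K B \<and> finite B \<and> card B = r)"

(* The Poincare series is the expansion at 0 of the rational function p/q,
   and the limit is that of this rational function. *)
definition has_algebra_degree :: "nat cpoly set \<Rightarrow> complex \<Rightarrow> bool" where
  "has_algebra_degree R d \<longleftrightarrow>
     (\<exists>r p q. has_transcendence_degree (quotient_field R) r \<and>
        q \<noteq> 0 \<and> fps_of_poly q * poincare_series R = fps_of_poly p \<and>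
        ((\<lambda>z. (1 - z) ^ r * (poly p z / poly q z)) \<longlongrightarrow> d) (at 1))"

definition narayana_poly :: "nat \<Rightarrow> complex poly" where
  "narayana_poly m =
     (\<Sum>k=1..m. monom (of_nat ((m - 1) choose (k - 1)) * of_nat (m choose (k - 1)) / of_nat k) (k - 1))"

end

theory Submission
  imports Defs
begin

text \<open>
  Twisting the vector \<open>(x, y)\<close> of \<open>\<complex>\<^sup>2\<close> to \<open>(y, -x)\<close> makes \<open>SL\<^sub>2\<close> act on all the vectors alike.
  A polynomial is invariant iff its monomials have weight \<open>0\<close> and the raising operator \<open>E\<close> of
  \<open>sl\<^sub>2\<close> kills it. For the Fischer inner product the lowering operator \<open>F\<close> is adjoint to \<open>E\<close>, so the
  commutator relation gives \<open>|F f|\<^sup>2 = |E f|\<^sup>2 + w |f|\<^sup>2\<close> in weight \<open>w\<close>; hence \<open>E F\<close> is injective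
  in weight \<open>2\<close>, \<open>E\<close> maps weight \<open>0\<close> onto weight \<open>2\<close>, and the dimension of the invariants is the
  number of monomials of weight \<open>0\<close> minus the number of monomials of weight \<open>2\<close>. With
  \<open>g(d) = ((n + d - 1) choose d)\<close> this yields \<open>dim (\<I>\<^sub>n)\<^sub>2\<^sub>d = g(d)\<^sup>2 - g(d + 1) g(d - 1)\<close> and
  \<open>dim (\<C>\<^sub>n)\<^sub>j = g(\<lfloor>j/2\<rfloor>) g(\<lceil>j/2\<rceil>)\<close>, polynomials on each parity class of \<open>j\<close>, whose leading
  coefficients determine the limit.

  For the transcendence degree, \<open>SL\<^sub>2\<close> moves a generic point to the slice where the first two
  vectors are \<open>(1, 0)\<close> and \<open>(0, t)\<close>. The remaining coordinates are brackets, up to division by \<open>t\<close>,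
  so these brackets are algebraically independent and generate the field of quotients.
\<close>

section \<open>Complex polynomials and their values\<close>


text \<open>Why E alone decides invariance: in weight 0 the norm identity turns E f = 0 into F f =
  0, and a polynomial killed by both operators is constant along the two unipotent one-parameter
  groups, which generate SL2. The same identity gives surjectivity of E without decomposing
  polynomials into irreducible representations.

  The covariants have an extra obstacle: the degree in the coordinates of the plane is not counted,
  so a graded part is not visibly contained in the span of finitely many monomials. It is exhausted
  by finite-dimensional pieces, which turn out to be stationary.

  Both products in g(d)^2 - g(d + 1) g(d - 1) have degree 2n - 2 in d, but the difference has degree
  2n - 4, one less than the transcendence degree 2n - 3. For covariants the two numbers are 2n - 2
  and 2n - 1. Polynomials of degree at most D in d on the two parity classes j = 2d and j = 2d + 1
  give a series with denominator (1 - z^2)^(D + 1), so the limit is D! / 2^(D + 1) times the sum of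
  their coefficients in degree D; this is where the powers of 2 come from.\<close>

lemma keys_add_nat: "Poly_Mapping.keys (m + n) = Poly_Mapping.keys m \<union> Poly_Mapping.keys (n :: 'v \<Rightarrow>\<^sub>0 nat)"
  by (auto simp: in_keys_iff lookup_add)

lemma poly_mapping_sum_single:
  "p = (\<Sum>m\<in>Poly_Mapping.keys p. Poly_Mapping.single m (Poly_Mapping.lookup p m))"
  by (rule poly_mapping_eqI)
     (auto simp: lookup_sum lookup_single when_def in_keys_iff sum.delta)

definition cvar :: "'v \<Rightarrow> 'v cpoly" where
  "cvar k = Poly_Mapping.single (Poly_Mapping.single k 1) 1"

text \<open>Every monomial other than 1 splits off one of its variables, which lowers the total
  degree. Confining the variables to \<open>V\<close> makes the rule usable for claims such as the
  chain rule, where only the variables in \<open>V\<close> are differentiated.\<close>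

lemma cpoly_induct [consumes 1, case_names const var add]:
  fixes p :: "'v cpoly"
  assumes V: "cpoly_vars p \<subseteq> V"
    and const: "\<And>c. P (cpoly_const c)"
    and var: "\<And>k q. k \<in> V \<Longrightarrow> P q \<Longrightarrow> P (cvar k * q)"
    and add: "\<And>p q. P p \<Longrightarrow> P q \<Longrightarrow> P (p + q)"
  shows "P p"
proof -
  have mono: "P (Poly_Mapping.single m c)" if "Poly_Mapping.keys m \<subseteq> V" for m c
    using that
  proof (induction "\<Sum>k\<in>Poly_Mapping.keys m. Poly_Mapping.lookup m k" arbitrary: m rule: less_induct)
    case less
    show ?case
    proof (cases "m = 0")
      case True
      then show ?thesis using const[of c] by (simp add: cpoly_const_def)
    next
      case False
      then obtain k where k: "k \<in> Poly_Mapping.keys m"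
        by fastforce
      define n where "n = m - Poly_Mapping.single k 1"
      have m: "m = Poly_Mapping.single k 1 + n"
        using k by (intro poly_mapping_eqI)
          (auto simp: n_def lookup_add lookup_minus lookup_single when_def in_keys_iff)
      have nk: "Poly_Mapping.keys n \<subseteq> Poly_Mapping.keys m"
        unfolding m by (auto simp: keys_add_nat)
      have "(\<Sum>j\<in>Poly_Mapping.keys n. Poly_Mapping.lookup n j)
          = (\<Sum>j\<in>Poly_Mapping.keys m. Poly_Mapping.lookup n j)"
        using nk by (intro sum.mono_neutral_left) (auto simp: in_keys_iff)
      also have "\<dots> < (\<Sum>j\<in>Poly_Mapping.keys m. Poly_Mapping.lookup m j)"
        using k by (intro sum_strict_mono_ex1) (auto simp: m lookup_add lookup_single when_def)
      finally have "P (Poly_Mapping.single n c)"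
        using less nk by blast
      then have "P (cvar k * Poly_Mapping.single n c)"
        using var k less by blast
      then show ?thesis by (simp add: cvar_def mult_single m)
    qed
  qed
  have "P 0" using const[of 0] by (simp add: cpoly_const_def)
  have "P (\<Sum>m\<in>A. Poly_Mapping.single m (Poly_Mapping.lookup p m))"
    if "finite A" "A \<subseteq> Poly_Mapping.keys p" for A
    using that
    by (induction A) (use V \<open>P 0\<close> in \<open>auto intro!: add mono simp: cpoly_vars_def\<close>)
  from this[of "Poly_Mapping.keys p"] show ?thesis
    using poly_mapping_sum_single[of p] by simp
qed

lemma keys_mult_cvar: "Poly_Mapping.keys (cvar k * p) \<subseteq> (+) (Poly_Mapping.single k 1) ` Poly_Mapping.keys p"
  using keys_mult[of "cvar k" p] by (auto simp: cvar_def)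

lemma cpoly_const_mult_lookup [simp]:
  "Poly_Mapping.lookup (cpoly_const c * p) m = c * Poly_Mapping.lookup p m"
proof -
  have "cpoly_const c * p = Poly_Mapping.map ((*) c) p"
    by (simp add: cpoly_const_def mult_map_scale_conv_mult)
  then show ?thesis by (simp add: Poly_Mapping.map.rep_eq when_def)
qed

lemma cpoly_const_mult: "cpoly_const a * cpoly_const b = cpoly_const (a * b)"
  by (simp add: cpoly_const_def mult_single)

lemma lookup_mult_cvar_add [simp]:
  "Poly_Mapping.lookup (cvar k * p) (m + Poly_Mapping.single k (Suc 0)) = Poly_Mapping.lookup p m"
proof -
  have "Poly_Mapping.lookup (cvar k * (\<Sum>n\<in>A. Poly_Mapping.single n (f n))) (m + Poly_Mapping.single k (Suc 0))
      = Poly_Mapping.lookup (\<Sum>n\<in>A. Poly_Mapping.single n (f n)) m" for A f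
    by (auto simp: sum_distrib_left lookup_sum cvar_def mult_single lookup_single add.commute
          intro!: sum.cong when_cong)
  from this[of "Poly_Mapping.lookup p" "Poly_Mapping.keys p"] show ?thesis
    using poly_mapping_sum_single[of p] by simp
qed

lemma lookup_mult_cvar_0:
  assumes "Poly_Mapping.lookup m k = 0"
  shows "Poly_Mapping.lookup (cvar k * p) m = 0"
proof (rule ccontr)
  assume "\<not> ?thesis"
  then have "m \<in> Poly_Mapping.keys (cvar k * p)" by (simp add: in_keys_iff)
  then show False using keys_mult_cvar[of k p] assms by (auto simp: lookup_add)
qed

lemma monomial_split:
  assumes "Poly_Mapping.lookup m k \<noteq> (0::nat)"
  obtains n where "m = n + Poly_Mapping.single k (Suc 0)"
proof
  show "m = (m - Poly_Mapping.single k (Suc 0)) + Poly_Mapping.single k (Suc 0)"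
    using assms by (intro poly_mapping_eqI)
      (auto simp: lookup_add lookup_minus lookup_single when_def)
qed

section \<open>Formal partial derivatives\<close>

definition cderiv :: "'v \<Rightarrow> 'v cpoly \<Rightarrow> 'v cpoly" where
  "cderiv k p = Abs_poly_mapping (\<lambda>m.
     of_nat (Suc (Poly_Mapping.lookup m k)) * Poly_Mapping.lookup p (m + Poly_Mapping.single k (Suc 0)))"

lemma lookup_cderiv [simp]:
  "Poly_Mapping.lookup (cderiv k p) m =
     of_nat (Suc (Poly_Mapping.lookup m k)) * Poly_Mapping.lookup p (m + Poly_Mapping.single k (Suc 0))"
proof -
  have "finite ((\<lambda>m. m + Poly_Mapping.single k (Suc 0)) -` Poly_Mapping.keys p)"
    by (rule finite_vimageI) (auto simp: inj_on_def)
  then have "finite {m. of_nat (Suc (Poly_Mapping.lookup m k)) *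
      Poly_Mapping.lookup p (m + Poly_Mapping.single k (Suc 0)) \<noteq> 0}"
    by (rule finite_subset[rotated]) (auto simp: in_keys_iff)
  then show ?thesis unfolding cderiv_def by simp
qed

lemma cderiv_add: "cderiv k (p + q) = cderiv k p + cderiv k q"
  by (rule poly_mapping_eqI) (simp add: lookup_add algebra_simps)

lemma cderiv_scale: "cderiv k (cpoly_const c * p) = cpoly_const c * cderiv k p"
  by (rule poly_mapping_eqI) simp

lemma cderiv_const [simp]: "cderiv k (cpoly_const c) = 0"
proof (rule poly_mapping_eqI)
  fix m :: "'a \<Rightarrow>\<^sub>0 nat"
  have "m + Poly_Mapping.single k (Suc 0) \<noteq> 0"
    by (metis add_eq_0_iff_both_eq_0 lookup_add lookup_single_eq lookup_zero nat.simps(3))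
  then show "Poly_Mapping.lookup (cderiv k (cpoly_const c)) m = Poly_Mapping.lookup 0 m"
    by (simp add: cpoly_const_def lookup_single when_def)
qed

lemma cderiv_cvar_mult:
  "cderiv k (cvar l * p) = cvar l * cderiv k p + (if k = l then p else 0)"
proof (rule poly_mapping_eqI)
  fix m
  show "Poly_Mapping.lookup (cderiv k (cvar l * p)) m =
      Poly_Mapping.lookup (cvar l * cderiv k p + (if k = l then p else 0)) m"
  proof (cases "Poly_Mapping.lookup m l = 0")
    case True
    show ?thesis
    proof (cases "k = l")
      case False
      then show ?thesis using True
        by (simp add: lookup_add lookup_mult_cvar_0 lookup_single when_def)
    qed (use True in \<open>simp add: lookup_add lookup_mult_cvar_0\<close>)
  next
    case False
    then obtain n where m: "m = n + Poly_Mapping.single l (Suc 0)"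
      by (rule monomial_split)
    show ?thesis
    proof (cases "k = l")
      case True
      then show ?thesis
        by (simp add: m lookup_add) (simp add: algebra_simps)
    next
      case False
      have "n + Poly_Mapping.single l (Suc 0) + Poly_Mapping.single k (Suc 0)
          = (n + Poly_Mapping.single k (Suc 0)) + Poly_Mapping.single l (Suc 0)"
        by (simp add: ac_simps)
      then have "Poly_Mapping.lookup (cvar l * p) (n + Poly_Mapping.single l (Suc 0) + Poly_Mapping.single k (Suc 0))
        = Poly_Mapping.lookup p (n + Poly_Mapping.single k (Suc 0))"
        by simp
      then show ?thesis using False
        by (simp add: m lookup_add lookup_single when_def)
    qed
  qed
qed

text \<open>Monomials are eigenvectors of the Euler operator of each variable. Differences of these
  operators make up the operator whose eigenvalue is the weight.\<close>

lemma cvar_cderiv_lookup: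
  "Poly_Mapping.lookup (cvar k * cderiv k p) m = of_nat (Poly_Mapping.lookup m k) * Poly_Mapping.lookup p m"
proof (cases "Poly_Mapping.lookup m k = 0")
  case False
  then obtain n where m: "m = n + Poly_Mapping.single k (Suc 0)"
    by (rule monomial_split)
  then show ?thesis by (simp add: lookup_add)
qed (simp add: lookup_mult_cvar_0)


section \<open>Evaluation in a commutative complex algebra\<close>

locale complex_algebra =
  fixes h :: "complex \<Rightarrow> 'a::comm_ring_1"
  assumes h_0 [simp]: "h 0 = 0" and h_1 [simp]: "h 1 = 1"
    and h_add: "h (x + y) = h x + h y" and h_mult: "h (x * y) = h x * h y"
begin

lemma eval_superset:
  assumes "finite S" "Poly_Mapping.keys p \<subseteq> S"
  shows "cpoly_eval h v p = (\<Sum>m\<in>S. h (Poly_Mapping.lookup p m) *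
        (\<Prod>x\<in>Poly_Mapping.keys m. v x ^ Poly_Mapping.lookup m x))"
  unfolding cpoly_eval_def using assms
  by (intro sum.mono_neutral_left) (auto simp: in_keys_iff)

lemma eval_add: "cpoly_eval h v (p + q) = cpoly_eval h v p + cpoly_eval h v q"
proof -
  have "finite (Poly_Mapping.keys p \<union> Poly_Mapping.keys q)" by simp
  then show ?thesis
    using keys_add[of p q]
    by (simp add: eval_superset[of "Poly_Mapping.keys p \<union> Poly_Mapping.keys q"]
        lookup_add h_add algebra_simps sum.distrib)
qed

lemma eval_single:
  "cpoly_eval h v (Poly_Mapping.single m c) =
    h c * (\<Prod>x\<in>Poly_Mapping.keys m. v x ^ Poly_Mapping.lookup m x)"
  by (subst eval_superset[of "{m}"]) auto

lemma eval_const [simp]: "cpoly_eval h v (cpoly_const c) = h c"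
  by (simp add: cpoly_const_def eval_single)

lemma eval_0 [simp]: "cpoly_eval h v 0 = 0"
  by (simp add: cpoly_eval_def)

lemma eval_1 [simp]: "cpoly_eval h v 1 = 1"
  using eval_const[of v 1] by (simp add: cpoly_const_def)

lemma eval_sum: "cpoly_eval h v (sum f A) = (\<Sum>a\<in>A. cpoly_eval h v (f a))"
  by (induction A rule: infinite_finite_induct) (simp_all add: eval_add)

lemma eval_cvar_mult: "cpoly_eval h v (cvar k * p) = v k * cpoly_eval h v p"
proof -
  have mono: "(\<Prod>x\<in>Poly_Mapping.keys (Poly_Mapping.single k (Suc 0) + m).
        v x ^ Poly_Mapping.lookup (Poly_Mapping.single k (Suc 0) + m) x)
      = v k * (\<Prod>x\<in>Poly_Mapping.keys m. v x ^ Poly_Mapping.lookup m x)" (is "?L = ?R") for m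
  proof -
    let ?K = "insert k (Poly_Mapping.keys m)"
    have "?L = (\<Prod>x\<in>?K. v x ^ (Poly_Mapping.lookup (Poly_Mapping.single k (Suc 0)) x) *
        v x ^ Poly_Mapping.lookup m x)"
      by (simp add: keys_add_nat lookup_add power_add)
    also have "\<dots> = (\<Prod>x\<in>?K. if x = k then v k else 1) * (\<Prod>x\<in>?K. v x ^ Poly_Mapping.lookup m x)"
      unfolding prod.distrib
      by (intro arg_cong2[of _ _ _ _ "(*)"] prod.cong) (auto simp: lookup_single when_def)
    also have "(\<Prod>x\<in>?K. v x ^ Poly_Mapping.lookup m x) = (\<Prod>x\<in>Poly_Mapping.keys m. v x ^ Poly_Mapping.lookup m x)"
      by (rule prod.mono_neutral_right) (auto simp: in_keys_iff)
    finally show ?thesis by simp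
  qed
  have "cpoly_eval h v (cvar k * (\<Sum>n\<in>A. Poly_Mapping.single n (f n)))
      = v k * cpoly_eval h v (\<Sum>n\<in>A. Poly_Mapping.single n (f n))" for A f
    by (auto simp: sum_distrib_left eval_sum cvar_def mult_single eval_single mono mult.left_commute
          intro!: sum.cong)
  from this[of "Poly_Mapping.lookup p" "Poly_Mapping.keys p"] show ?thesis
    using poly_mapping_sum_single[of p] by simp
qed

lemma eval_cvar [simp]: "cpoly_eval h v (cvar k) = v k"
  using eval_cvar_mult[of v k 1] by simp

lemma eval_scale: "cpoly_eval h v (cpoly_const c * p) = h c * cpoly_eval h v p"
  by (rule cpoly_induct[of p UNIV])
     (simp_all add: eval_add eval_cvar_mult distrib_left mult.left_commute[of "cpoly_const c"]
        mult.left_commute[of "h c"] cpoly_const_mult h_mult)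

lemma eval_mult: "cpoly_eval h v (p * q) = cpoly_eval h v p * cpoly_eval h v q"
  by (rule cpoly_induct[of p UNIV])
     (simp_all add: eval_add eval_cvar_mult eval_scale distrib_right mult.assoc)

lemma eval_uminus: "cpoly_eval h v (- p) = - cpoly_eval h v p"
  using eval_add[of v p "- p"] by (simp add: eq_neg_iff_add_eq_0 add.commute)

lemma eval_diff: "cpoly_eval h v (p - q) = cpoly_eval h v p - cpoly_eval h v q"
  using eval_add[of v p "- q"] by (simp add: eval_uminus)

lemma eval_cong:
  assumes "\<And>k. k \<in> cpoly_vars p \<Longrightarrow> v k = w k"
  shows "cpoly_eval h v p = cpoly_eval h w p"
  unfolding cpoly_eval_def
  by (intro sum.cong arg_cong2[of _ _ _ _ "(*)"] prod.cong refl)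
     (use assms in \<open>auto simp: cpoly_vars_def intro: arg_cong2[of _ _ _ _ power]\<close>)

end

interpretation id: complex_algebra "id :: complex \<Rightarrow> complex"
  by unfold_locales auto

definition ev :: "('v \<Rightarrow> complex) \<Rightarrow> 'v cpoly \<Rightarrow> complex" where
  "ev = cpoly_eval id"

lemma ev_simps [simp]:
  "ev v (cpoly_const c) = c" "ev v 0 = 0" "ev v 1 = 1" "ev v (cvar k) = v k"
  "ev v (p + q) = ev v p + ev v q" "ev v (p - q) = ev v p - ev v q" "ev v (- p) = - ev v p"
  "ev v (p * q) = ev v p * ev v q" "ev v (sum f A) = (\<Sum>a\<in>A. ev v (f a))"
  by (simp_all add: ev_def id.eval_add id.eval_diff id.eval_uminus id.eval_mult id.eval_sum)

lemma ev_power [simp]: "ev v (p ^ N) = ev v p ^ N"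
  by (induction N) simp_all

lemma ev_cong: "(\<And>k. k \<in> cpoly_vars p \<Longrightarrow> v k = w k) \<Longrightarrow> ev v p = ev w p"
  unfolding ev_def by (rule id.eval_cong)

text \<open>This ties formal derivatives to analytic ones. It is applied to coordinate lines, to
  recover coefficients from values, and to curves of matrices, to differentiate the group
  action.\<close>

lemma ev_chain_rule:
  assumes "finite V" "cpoly_vars p \<subseteq> V"
    and "\<And>k. k \<in> V \<Longrightarrow> ((\<lambda>s. c s k) has_field_derivative c' k) (at s)"
  shows "((\<lambda>s. ev (c s) p) has_field_derivative (\<Sum>k\<in>V. c' k * ev (c s) (cderiv k p))) (at s)"
  using assms(2)
proof (induction rule: cpoly_induct)
  case (var k q)
  have "(\<Sum>j\<in>V. c' j * ev (c s) (cderiv j (cvar k * q)))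
     = (\<Sum>j\<in>V. c s k * (c' j * ev (c s) (cderiv j q)) + (if j = k then c' k * ev (c s) q else 0))"
    by (intro sum.cong) (auto simp: cderiv_cvar_mult distrib_left mult.left_commute)
  also have "\<dots> = c s k * (\<Sum>j\<in>V. c' j * ev (c s) (cderiv j q)) + c' k * ev (c s) q"
    using var(1) assms(1) by (simp add: sum.distrib sum_distrib_left)
  finally show ?case
    using DERIV_mult[OF assms(3)[OF var(1)] var(2)] by (simp add: algebra_simps)
qed (simp_all add: cderiv_add DERIV_add distrib_left sum.distrib)

text \<open>The constant coefficient is the value at the origin. Every other coefficient is, up to a
  positive integer factor, a coefficient of lower degree of a partial derivative, and the values of
  that derivative vanish because they are derivatives of the zero function.\<close>

lemma cpoly_eq_0_if_ev_0:
  assumes "\<And>v. ev v p = 0"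
  shows "p = 0"
proof -
  have "Poly_Mapping.lookup p m = 0" if "\<And>v. ev v p = 0" for p and m :: "'a \<Rightarrow>\<^sub>0 nat"
    using that
  proof (induction "\<Sum>k\<in>Poly_Mapping.keys m. Poly_Mapping.lookup m k" arbitrary: m p rule: less_induct)
    case (less m p)
    show ?case
    proof (cases "m = 0")
      case True
      have "ev (\<lambda>_. 0) p = (\<Sum>m\<in>insert 0 (Poly_Mapping.keys p).
          Poly_Mapping.lookup p m * (\<Prod>x\<in>Poly_Mapping.keys m. 0 ^ Poly_Mapping.lookup m x))"
        unfolding ev_def by (subst id.eval_superset[of "insert 0 (Poly_Mapping.keys p)"]) auto
      also have "\<dots> = (\<Sum>m\<in>{0}. Poly_Mapping.lookup p m * (\<Prod>x\<in>Poly_Mapping.keys m. 0 ^ Poly_Mapping.lookup m x))"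
        by (intro sum.mono_neutral_right) (auto simp: in_keys_iff intro!: poly_mapping_eqI)
      finally show ?thesis using less.prems True by simp
    next
      case False
      then obtain k where k: "Poly_Mapping.lookup m k \<noteq> 0"
        by (metis lookup_zero poly_mapping_eqI)
      then obtain n where m: "m = n + Poly_Mapping.single k (Suc 0)"
        by (rule monomial_split)
      have "(\<Sum>j\<in>Poly_Mapping.keys n. Poly_Mapping.lookup n j)
          = (\<Sum>j\<in>Poly_Mapping.keys m. Poly_Mapping.lookup n j)"
        by (intro sum.mono_neutral_left) (auto simp: in_keys_iff m lookup_add)
      also have "\<dots> < (\<Sum>j\<in>Poly_Mapping.keys m. Poly_Mapping.lookup m j)"
        using k by (intro sum_strict_mono_ex1) (auto simp: m lookup_add lookup_single when_def in_keys_iff)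
      finally have lt: "(\<Sum>j\<in>Poly_Mapping.keys n. Poly_Mapping.lookup n j)
         < (\<Sum>j\<in>Poly_Mapping.keys m. Poly_Mapping.lookup m j)" .
      have "ev v (cderiv k p) = 0" for v
      proof -
        let ?V = "insert k (cpoly_vars p)"
        have fin: "finite ?V" by (simp add: cpoly_vars_def)
        have "((\<lambda>s. ev (v(k := s)) p) has_field_derivative
            (\<Sum>j\<in>?V. (if j = k then 1 else 0) * ev (v(k := v k)) (cderiv j p))) (at (v k))"
          by (rule ev_chain_rule[OF fin]) (auto intro!: derivative_eq_intros)
        moreover have "(\<Sum>j\<in>?V. (if j = k then 1 else 0) * ev (v(k := v k)) (cderiv j p))
            = (\<Sum>j\<in>?V. if j = k then ev v (cderiv k p) else 0)"
          by (intro sum.cong) auto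
        moreover have "\<dots> = ev v (cderiv k p)" using fin by (simp add: sum.delta)
        ultimately have "((\<lambda>s. 0) has_field_derivative ev v (cderiv k p)) (at (v k))"
          by (simp add: less.prems)
        then show ?thesis using DERIV_unique[OF DERIV_const] by metis
      qed
      from less.hyps[OF lt this] show ?thesis by (simp add: m del: of_nat_Suc)
    qed
  qed
  with assms show ?thesis by (intro poly_mapping_eqI) simp
qed

lemma cpoly_eqI_ev: "(\<And>v. ev v p = ev v q) \<Longrightarrow> p = q"
  using cpoly_eq_0_if_ev_0[of "p - q"] by simp


section \<open>The raising and lowering operators\<close>


lemma cderiv_commute: "cderiv k (cderiv l p) = cderiv l (cderiv k p)"
proof (cases "k = l")
  case False
  then show ?thesis
    by (intro poly_mapping_eqI) (simp add: lookup_add lookup_single when_def ac_simps)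
qed simp

lemma cderiv_0 [simp]: "cderiv k 0 = 0"
  by (rule poly_mapping_eqI) simp

lemma cderiv_sum: "cderiv k (sum f A) = (\<Sum>a\<in>A. cderiv k (f a))"
  by (induction A rule: infinite_finite_induct) (simp_all add: cderiv_add)

section \<open>The Fischer inner product\<close>

definition mfact :: "('v \<Rightarrow>\<^sub>0 nat) \<Rightarrow> nat" where
  "mfact m = (\<Prod>k\<in>Poly_Mapping.keys m. fact (Poly_Mapping.lookup m k))"

lemma mfact_pos: "mfact m > 0"
  unfolding mfact_def by (rule prod_pos) simp

text \<open>\<open>mfact m\<close> is the squared norm of the monomial \<open>m\<close>; this
  recursion supplies exactly the factor that differentiation produces, whence the adjointness in
  \<open>fischer_cvar_left\<close>.\<close>

lemma mfact_add_single:
  "mfact (m + Poly_Mapping.single k (Suc 0)) = Suc (Poly_Mapping.lookup m k) * mfact m"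
proof -
  let ?K = "insert k (Poly_Mapping.keys m)"
  have "mfact (m + Poly_Mapping.single k (Suc 0))
      = (\<Prod>j\<in>?K. fact (Poly_Mapping.lookup (m + Poly_Mapping.single k (Suc 0)) j))"
    unfolding mfact_def by (simp add: keys_add_nat)
  also have "\<dots> = (\<Prod>j\<in>?K. (if j = k then Suc (Poly_Mapping.lookup m k) else 1)
      * fact (Poly_Mapping.lookup m j))"
    by (intro prod.cong) (auto simp: lookup_add lookup_single when_def)
  also have "\<dots> = Suc (Poly_Mapping.lookup m k) * (\<Prod>j\<in>?K. fact (Poly_Mapping.lookup m j))"
    unfolding prod.distrib by simp
  also have "(\<Prod>j\<in>?K. fact (Poly_Mapping.lookup m j)) = mfact m"
    unfolding mfact_def by (rule prod.mono_neutral_right) (auto simp: in_keys_iff)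
  finally show ?thesis .
qed

text \<open>Multiplication by a variable is adjoint to differentiation for this inner product.\<close>

definition fischer :: "'v cpoly \<Rightarrow> 'v cpoly \<Rightarrow> complex" where
  "fischer p q = (\<Sum>m\<in>Poly_Mapping.keys p.
     of_nat (mfact m) * Poly_Mapping.lookup p m * cnj (Poly_Mapping.lookup q m))"

lemma fischer_superset:
  assumes "finite S" "Poly_Mapping.keys p \<subseteq> S"
  shows "fischer p q = (\<Sum>m\<in>S. of_nat (mfact m) * Poly_Mapping.lookup p m * cnj (Poly_Mapping.lookup q m))"
  unfolding fischer_def using assms by (intro sum.mono_neutral_left) (auto simp: in_keys_iff)

lemma fischer_sym: "fischer q p = cnj (fischer p q)"
  by (subst (1 2) fischer_superset[of "Poly_Mapping.keys p \<union> Poly_Mapping.keys q"])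
     (auto simp: mult_ac)

lemma fischer_add_left: "fischer (p + p') q = fischer p q + fischer p' q"
  using keys_add[of p p']
  by (simp add: fischer_superset[of "Poly_Mapping.keys p \<union> Poly_Mapping.keys p'"]
      lookup_add algebra_simps sum.distrib)

lemma fischer_add_right: "fischer p (q + q') = fischer p q + fischer p q'"
  by (metis complex_cnj_add fischer_add_left fischer_sym)

lemma fischer_scale_left: "fischer (cpoly_const c * p) q = c * fischer p q"
proof -
  have "Poly_Mapping.keys (cpoly_const c * p) \<subseteq> Poly_Mapping.keys p"
    by (auto simp: in_keys_iff)
  then show ?thesis
    by (simp add: fischer_superset[of "Poly_Mapping.keys p"] sum_distrib_left mult.left_commute
        mult.assoc)
qed

lemma fischer_scale_right: "fischer p (cpoly_const c * q) = cnj c * fischer p q"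
  by (metis complex_cnj_mult fischer_scale_left fischer_sym)

lemma fischer_0 [simp]: "fischer 0 q = 0" "fischer p 0 = 0"
  by (simp_all add: fischer_def)

lemma fischer_sum_left: "fischer (sum f A) q = (\<Sum>a\<in>A. fischer (f a) q)"
  by (induction A rule: infinite_finite_induct) (simp_all add: fischer_add_left)

lemma fischer_sum_right: "fischer p (sum f A) = (\<Sum>a\<in>A. fischer p (f a))"
  by (induction A rule: infinite_finite_induct) (simp_all add: fischer_add_right)

lemma fischer_self: "fischer p p =
    of_real (\<Sum>m\<in>Poly_Mapping.keys p. real (mfact m) * (cmod (Poly_Mapping.lookup p m))\<^sup>2)"
  unfolding fischer_def of_real_sum
  by (intro sum.cong) (simp_all add: mult.assoc flip: complex_norm_square)

lemma fischer_self_eq_0 [simp]: "fischer p p = 0 \<longleftrightarrow> p = 0"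
proof
  assume "fischer p p = 0"
  then have *: "(\<Sum>m\<in>Poly_Mapping.keys p. real (mfact m) * (cmod (Poly_Mapping.lookup p m))\<^sup>2) = 0"
    unfolding fischer_self by (simp only: of_real_eq_0_iff)
  show "p = 0"
  proof (rule ccontr)
    assume "p \<noteq> 0"
    then have "Poly_Mapping.keys p \<noteq> {}" by simp
    then have "(\<Sum>m\<in>Poly_Mapping.keys p. real (mfact m) * (cmod (Poly_Mapping.lookup p m))\<^sup>2) > 0"
      by (intro sum_pos) (auto simp: mfact_pos in_keys_iff)
    with * show False by simp
  qed
qed simp

lemma fischer_self_nonneg: "\<exists>r\<ge>0. fischer p p = of_real r"
  unfolding fischer_self by (metis (no_types, lifting) mult_nonneg_nonneg of_nat_0_le_iff sum_nonneg zero_le_power2)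

lemma fischer_cvar_left: "fischer (cvar k * p) q = fischer p (cderiv k q)"
proof -
  have "fischer (cvar k * p) q = (\<Sum>m\<in>(\<lambda>m. m + Poly_Mapping.single k (Suc 0)) ` Poly_Mapping.keys p.
     of_nat (mfact m) * Poly_Mapping.lookup (cvar k * p) m * cnj (Poly_Mapping.lookup q m))"
    using keys_mult_cvar[of k p] by (intro fischer_superset) (auto simp: add.commute)
  also have "\<dots> = fischer p (cderiv k q)"
    unfolding fischer_def
    by (subst sum.reindex) (auto simp: inj_on_def mfact_add_single intro!: sum.cong, simp add: algebra_simps)
  finally show ?thesis .
qed

lemma fischer_cderiv_left: "fischer (cderiv k p) q = fischer p (cvar k * q)"
  by (metis fischer_cvar_left fischer_sym)

text \<open>The vector field of a unipotent one-parameter group acting on the pairs of variables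
  \<open>(p i, q i)\<close>. Leaving \<open>p\<close> and \<open>q\<close> as parameters gives both
  operators at once: for \<open>hs\<close>, \<open>hq\<close>, \<open>hp\<close> it is the raising
  operator, for \<open>hs\<close>, \<open>hp\<close>, \<open>hq\<close> the lowering one. The signs
  \<open>\<sigma>\<close> account for the twisted vector.\<close>

definition shear :: "('i \<Rightarrow> complex) \<Rightarrow> ('i \<Rightarrow> 'v) \<Rightarrow> ('i \<Rightarrow> 'v) \<Rightarrow> 'i set \<Rightarrow> 'v cpoly \<Rightarrow> 'v cpoly" where
  "shear \<sigma> p q I f = (\<Sum>i\<in>I. cpoly_const (\<sigma> i) * (cvar (q i) * cderiv (p i) f))"

lemma shear_0 [simp]: "shear \<sigma> p q I 0 = 0"
  by (simp add: shear_def)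

lemma shear_add: "shear \<sigma> p q I (f + g) = shear \<sigma> p q I f + shear \<sigma> p q I g"
  by (simp add: shear_def cderiv_add distrib_left sum.distrib)

lemma shear_scale: "shear \<sigma> p q I (cpoly_const c * f) = cpoly_const c * shear \<sigma> p q I f"
  by (simp add: shear_def cderiv_scale sum_distrib_left mult.left_commute)

text \<open>Taking adjoints exchanges variable and derivative in each summand; the coefficients stay
  the same because they are real.\<close>

lemma fischer_shear:
  assumes "\<And>i. i \<in> I \<Longrightarrow> \<sigma> i \<in> {1, -1}"
  shows "fischer (shear \<sigma> p q I f) g = fischer f (shear \<sigma> q p I g)"
  unfolding shear_def fischer_sum_left fischer_sum_right fischer_scale_left fischer_scale_right
    fischer_cvar_left fischer_cderiv_left
  using assms by (intro sum.cong refl) (metis complex_cnj_minus complex_cnj_one insertE singletonD)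

text \<open>The eigenvalue on the monomial \<open>m\<close> of the diagonal element of sl2.\<close>

definition weight :: "('i \<Rightarrow> 'v) \<Rightarrow> ('i \<Rightarrow> 'v) \<Rightarrow> 'i set \<Rightarrow> ('v \<Rightarrow>\<^sub>0 nat) \<Rightarrow> int" where
  "weight p q I m = (\<Sum>i\<in>I. int (Poly_Mapping.lookup m (p i)) - int (Poly_Mapping.lookup m (q i)))"

text \<open>The sl2 relation EF = FE + H. Injectivity of \<open>p\<close> and of \<open>q\<close>
  ensures that a derivative meets the newly created variable only for equal indices, and the signs
  then cancel in pairs.\<close>

lemma shear_commutator:
  fixes p q :: "'i \<Rightarrow> 'v"
  assumes "finite I" "inj_on p I" "inj_on q I" "\<And>i. i \<in> I \<Longrightarrow> \<sigma> i \<in> {1, -1}"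
  shows "shear \<sigma> q p I (shear \<sigma> p q I f) = shear \<sigma> p q I (shear \<sigma> q p I f)
     + (\<Sum>i\<in>I. cvar (p i) * cderiv (p i) f - cvar (q i) * cderiv (q i) f)"
proof -
  \<comment> \<open>\<open>T i j\<close> is the second-order part, common to both compositions;
    \<open>D\<close> and \<open>E\<close> are the first-order terms that arise when a derivative
    hits the variable multiplied in before.\<close>
  define T where "T i j = cpoly_const (\<sigma> i * \<sigma> j) * (cvar (p i) * (cvar (q j) * cderiv (q i) (cderiv (p j) f)))" for i j
  define D where "D i = cvar (p i) * cderiv (p i) f" for i
  define E where "E i = cvar (q i) * cderiv (q i) f" for i
  have \<sigma>: "cpoly_const (\<sigma> i) * cpoly_const (\<sigma> i) = (1 :: 'v cpoly)" if "i \<in> I" for i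
    using assms(4)[OF that] by (auto simp: cpoly_const_mult) (auto simp: cpoly_const_def)
  have "shear \<sigma> q p I (shear \<sigma> p q I f) = (\<Sum>i\<in>I. \<Sum>j\<in>I. T i j + (if i = j then D i else 0))"
    unfolding shear_def cderiv_sum sum_distrib_left
  proof (intro sum.cong refl)
    fix i j assume ij: "i \<in> I" "j \<in> I"
    have "q i = q j \<longleftrightarrow> i = j" using ij assms(3) by (auto dest: inj_onD)
    then show "cpoly_const (\<sigma> i) * (cvar (p i) * cderiv (q i) (cpoly_const (\<sigma> j) * (cvar (q j) * cderiv (p j) f)))
       = T i j + (if i = j then D i else 0)"
      using \<sigma>[OF ij(1)] \<sigma>[OF ij(2)]
      by (auto simp: cderiv_scale cderiv_cvar_mult T_def D_def distrib_left cpoly_const_mult[symmetric] mult.left_commute mult.assoc)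
         (simp_all flip: mult.assoc)
  qed
  also have "\<dots> = (\<Sum>i\<in>I. \<Sum>j\<in>I. T i j) + (\<Sum>i\<in>I. D i)"
    by (simp add: sum.distrib assms(1))
  finally have 1: "shear \<sigma> q p I (shear \<sigma> p q I f) = (\<Sum>i\<in>I. \<Sum>j\<in>I. T i j) + (\<Sum>i\<in>I. D i)" .
  have "shear \<sigma> p q I (shear \<sigma> q p I f) = (\<Sum>j\<in>I. \<Sum>i\<in>I. T i j + (if i = j then E i else 0))"
    unfolding shear_def cderiv_sum sum_distrib_left
  proof (intro sum.cong refl)
    fix i j assume ij: "i \<in> I" "j \<in> I"
    have "p j = p i \<longleftrightarrow> i = j" using ij assms(2) by (auto dest: inj_onD)
    then show "cpoly_const (\<sigma> j) * (cvar (q j) * cderiv (p j) (cpoly_const (\<sigma> i) * (cvar (p i) * cderiv (q i) f)))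
       = T i j + (if i = j then E i else 0)"
      using \<sigma>[OF ij(1)] \<sigma>[OF ij(2)]
      by (auto simp: cderiv_scale cderiv_cvar_mult T_def E_def distrib_left cpoly_const_mult[symmetric] mult.left_commute mult.assoc
            cderiv_commute[of "p j"])
         (simp_all flip: mult.assoc)
  qed
  also have "\<dots> = (\<Sum>i\<in>I. \<Sum>j\<in>I. T i j) + (\<Sum>i\<in>I. E i)"
    by (simp add: sum.distrib assms(1) sum.swap[of T])
  finally show ?thesis unfolding 1 by (simp add: sum_subtractf D_def E_def)
qed

lemma fischer_shear_weight:
  assumes I: "finite I" "inj_on p I" "inj_on q I" "\<And>i. i \<in> I \<Longrightarrow> \<sigma> i \<in> {1, -1}"
    and wt: "\<And>m. m \<in> Poly_Mapping.keys f \<Longrightarrow> weight p q I m = k"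
  shows "fischer (shear \<sigma> p q I f) (shear \<sigma> p q I f) =
    fischer (shear \<sigma> q p I f) (shear \<sigma> q p I f) + of_int k * fischer f f"
proof -
  \<comment> \<open>All monomials of \<open>f\<close> have weight \<open>k\<close>, so the diagonal
    operator multiplies \<open>f\<close> by \<open>k\<close>.\<close>
  have H: "(\<Sum>i\<in>I. cvar (p i) * cderiv (p i) f - cvar (q i) * cderiv (q i) f) = cpoly_const (of_int k) * f"
  proof (rule poly_mapping_eqI)
    fix m
    have "of_int (weight p q I m) * Poly_Mapping.lookup f m = of_int k * Poly_Mapping.lookup f m"
      using wt[of m] by (auto simp: in_keys_iff)
    then show "Poly_Mapping.lookup (\<Sum>i\<in>I. cvar (p i) * cderiv (p i) f - cvar (q i) * cderiv (q i) f) m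
       = Poly_Mapping.lookup (cpoly_const (of_int k) * f) m"
      by (simp add: lookup_sum lookup_minus cvar_cderiv_lookup weight_def sum_distrib_right
          left_diff_distrib)
  qed
  have "fischer (shear \<sigma> p q I f) (shear \<sigma> p q I f) = fischer f (shear \<sigma> q p I (shear \<sigma> p q I f))"
    by (rule fischer_shear[OF I(4)])
  also have "\<dots> = fischer f (shear \<sigma> p q I (shear \<sigma> q p I f)) + of_int k * fischer f f"
    by (subst shear_commutator[OF I], assumption) (simp add: H fischer_add_right fischer_scale_right)
  also have "fischer f (shear \<sigma> p q I (shear \<sigma> q p I f)) = fischer (shear \<sigma> q p I f) (shear \<sigma> q p I f)"
    by (rule fischer_shear[OF I(4), symmetric])
  finally show ?thesis .
qed

text \<open>In weight 0 the images of \<open>f\<close> under the two operators have equal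
  norm.\<close>

lemma shear_eq_0_iff_weight_0:
  assumes "finite I" "inj_on p I" "inj_on q I" "\<And>i. i \<in> I \<Longrightarrow> \<sigma> i \<in> {1, -1}"
    and "\<And>m. m \<in> Poly_Mapping.keys f \<Longrightarrow> weight p q I m = 0"
  shows "shear \<sigma> p q I f = 0 \<longleftrightarrow> shear \<sigma> q p I f = 0"
  using fischer_shear_weight[of I p q \<sigma> f 0, OF assms]
  by (metis add.right_neutral fischer_self_eq_0 mult_zero_left of_int_0)

text \<open>If EF kills \<open>f\<close>, adjointness gives F f norm 0. By the norm identity this 0
  is a sum of two nonnegative numbers, one of which is \<open>k\<close> times the squared norm of
  \<open>f\<close>.\<close>

lemma shear_shear_inj_weight_pos:
  assumes I: "finite I" "inj_on p I" "inj_on q I" "\<And>i. i \<in> I \<Longrightarrow> \<sigma> i \<in> {1, -1}"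
    and wt: "\<And>m. m \<in> Poly_Mapping.keys f \<Longrightarrow> weight p q I m = k" and "k > 0"
    and 0: "shear \<sigma> q p I (shear \<sigma> p q I f) = 0"
  shows "f = 0"
proof -
  have "fischer (shear \<sigma> p q I f) (shear \<sigma> p q I f) = fischer f (shear \<sigma> q p I (shear \<sigma> p q I f))"
    by (rule fischer_shear[OF I(4)])
  with 0 have *: "0 = fischer (shear \<sigma> q p I f) (shear \<sigma> q p I f) + of_int k * fischer f f"
    using fischer_shear_weight[of I p q \<sigma> f k, OF I wt] by simp
  obtain r s where r: "r \<ge> 0" "fischer (shear \<sigma> q p I f) (shear \<sigma> q p I f) = of_real r"
    and s: "s \<ge> 0" "fischer f f = of_real s"
    using fischer_self_nonneg by metis
  have "complex_of_real (r + of_int k * s) = 0" using * r s by simp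
  then have "r + of_int k * s = 0" by (simp only: of_real_eq_0_iff)
  then have "s = 0" using r s \<open>k > 0\<close>
    by (smt (verit) mult_pos_pos of_int_0_less_iff)
  with s show ?thesis by simp
qed

text \<open>The composition EF is an injective endomorphism of the finite-dimensional space
  \<open>span Q\<close>, hence onto, so E maps \<open>span P\<close> onto \<open>span Q\<close>. The
  count is then rank-nullity: a basis \<open>B\<close> of the kernel is extended to a basis
  \<open>D\<close> of \<open>span P\<close>, and E carries \<open>D - B\<close> to a basis of
  \<open>span Q\<close>.\<close>

lemma (in vector_space) dim_kernel_if_comp_inj:
  assumes E: "Vector_Spaces.linear scale scale E" and F: "Vector_Spaces.linear scale scale F"
    and P: "finite P" "independent P" and Q: "finite Q" "independent Q"
    and EP: "E ` P \<subseteq> span Q" and FQ: "F ` Q \<subseteq> span P"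
    and inj: "\<And>v. v \<in> span Q \<Longrightarrow> E (F v) = 0 \<Longrightarrow> v = 0"
  shows "dim {v \<in> span P. E v = 0} + card Q = card P"
proof -
  interpret E: Vector_Spaces.linear scale scale E by (rule E)
  interpret F: Vector_Spaces.linear scale scale F by (rule F)
  define K where "K = {v \<in> span P. E v = 0}"
  obtain B where B: "B \<subseteq> K" "independent B" "K \<subseteq> span B" "card B = dim K"
    by (rule basis_exists)
  obtain D where D: "B \<subseteq> D" "D \<subseteq> span P" "independent D" "span P \<subseteq> span D"
    using maximal_independent_subset_extend[of B "span P"] B K_def by auto
  have finD: "finite D" using independent_span_bound[OF P(1) D(3) D(2)] by simp
  have spD: "span D = span P" using D by (simp add: span_minimal subset_antisym)
  have cardD: "card D = card P"
    using D(3) P(2) spD by (metis dim_eq_card)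
  have EK: "E v = 0" if "v \<in> span B" for v
  proof -
    have "span B \<subseteq> {v. E v = 0}"
      using B(1) by (intro span_minimal) (auto simp: K_def intro!: E.subspace_kernel)
    with that show ?thesis by auto
  qed
  have injC: "inj_on E (span (D - B))"
  proof (subst E.inj_on_iff_eq_0)
    show "subspace (span (D - B))" by simp
    show "\<forall>x\<in>span (D - B). E x = 0 \<longrightarrow> x = 0"
    proof (intro ballI impI)
      fix x assume x: "x \<in> span (D - B)" "E x = 0"
      have "x \<in> span D" using x span_mono[of "D - B" D] by auto
      then have "x \<in> span B" using x B(3) spD by (auto simp: K_def)
      \<comment> \<open>The coordinates of \<open>x\<close> with respect to \<open>D\<close> are
        supported in \<open>D - B\<close> and also in \<open>B\<close>, so all of them
        vanish.\<close>
      have "representation D x b = 0" for b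
        using representation_extend[OF D(3) x(1)] representation_extend[OF D(3) \<open>x \<in> span B\<close> D(1)]
          representation_ne_zero[of "D - B" x b] representation_ne_zero[of B x b]
        by (metis Diff_iff Diff_subset)
      then show "x = 0"
        using sum_representation_eq[OF D(3) \<open>x \<in> span D\<close> finD order_refl] by simp
    qed
  qed
  have indC: "independent (E ` (D - B))"
    by (rule E.independent_injective_image[OF independent_mono[OF D(3)] injC]) auto
  have cardC: "card (E ` (D - B)) = card (D - B)"
    by (rule card_image[OF inj_on_subset[OF injC span_superset]])
  have "span (E ` (D - B)) = span Q"
  proof
    have ED: "E ` span P \<subseteq> span Q"
      using span_minimal[OF EP subspace_span] by (simp add: E.span_image[symmetric])
    then show "span (E ` (D - B)) \<subseteq> span Q"
      using D(2) by (intro span_minimal) auto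
    let ?EF = "\<lambda>v. E (F v)"
    have EF: "Vector_Spaces.linear scale scale ?EF"
      using Vector_Spaces.linear_compose[OF F E] by (simp add: o_def)
    interpret EF: Vector_Spaces.linear scale scale ?EF by (rule EF)
    have injEF: "inj_on ?EF (span Q)"
      by (subst EF.inj_on_iff_eq_0) (use inj in auto)
    have indEF: "independent (?EF ` Q)"
      by (rule EF.independent_injective_image[OF Q(2) injEF])
    have cardEF: "card (?EF ` Q) = card Q"
      by (rule card_image[OF inj_on_subset[OF injEF span_superset]])
    have FP: "F ` Q \<subseteq> span P" by (rule FQ)
    have sub: "?EF ` Q \<subseteq> span Q" using FP ED by auto
    \<comment> \<open>Injective implies onto: a vector of \<open>span Q\<close> outside the span of
      the image of \<open>Q\<close> would enlarge an independent set of \<open>card Q\<close>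
      elements inside \<open>span Q\<close>.\<close>
    have "span Q \<subseteq> span (?EF ` Q)"
    proof (rule ccontr)
      assume "\<not> ?thesis"
      then obtain y where y: "y \<in> span Q" "y \<notin> span (?EF ` Q)" by auto
      then have "independent (insert y (?EF ` Q))"
        using indEF by (simp add: independent_insertI)
      then have "card (insert y (?EF ` Q)) \<le> card Q"
        using independent_span_bound[OF Q(1), of "insert y (?EF ` Q)"] sub y(1) by simp
      moreover have "y \<notin> ?EF ` Q" using y(2) span_base by auto
      ultimately show False using cardEF Q(1) by simp
    qed
    also have "\<dots> \<subseteq> span (E ` span P)"
      using FP by (intro span_mono) auto
    also have "\<dots> \<subseteq> span (E ` (D - B))"
    proof (intro span_minimal subspace_span)
      have "E ` D \<subseteq> span (E ` (D - B))"
      proof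
        fix x assume "x \<in> E ` D"
        then obtain d where d: "d \<in> D" "x = E d" by auto
        show "x \<in> span (E ` (D - B))"
        proof (cases "d \<in> B")
          case True
          then show ?thesis using EK[of d] d by (simp add: span_base span_zero)
        qed (use d in \<open>auto intro: span_base\<close>)
      qed
      then have "span (E ` D) \<subseteq> span (E ` (D - B))"
        by (simp add: span_minimal)
      then show "E ` span P \<subseteq> span (E ` (D - B))"
        by (simp add: E.span_image flip: spD)
    qed
    finally show "span Q \<subseteq> span (E ` (D - B))" .
  qed
  then have "card (D - B) = card Q"
    using dim_eq_card[OF _ indC] dim_eq_card[OF refl Q(2)] cardC by (metis dim_span)
  moreover have "card (D - B) + card B = card D"
    using D(1) finD by (metis add.commute card_Diff_subset card_mono finite_subset le_add_diff_inverse)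
  ultimately show ?thesis using B(4) cardD by (simp add: K_def)
qed

section \<open>Spaces spanned by monomials\<close>

definition monomials :: "('v \<Rightarrow>\<^sub>0 nat) set \<Rightarrow> 'v cpoly set" where
  "monomials M = (\<lambda>m. Poly_Mapping.single m 1) ` M"

lemma card_monomials: "card (monomials M) = card M"
  unfolding monomials_def by (intro card_image) (metis (mono_tags, lifting) inj_onI lookup_single_not_eq lookup_single_eq zero_neq_one)

lemma span_monomials: "cpoly.span (monomials M) = {f :: nat cpoly. Poly_Mapping.keys f \<subseteq> M}"
proof
  show "cpoly.span (monomials M) \<subseteq> {f :: nat cpoly. Poly_Mapping.keys f \<subseteq> M}"
  proof (rule cpoly.span_minimal)
    show "cpoly.subspace {f :: nat cpoly. Poly_Mapping.keys f \<subseteq> M}"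
    proof (rule cpoly.subspaceI)
      show "x + y \<in> {f :: nat cpoly. Poly_Mapping.keys f \<subseteq> M}"
        if "x \<in> {f :: nat cpoly. Poly_Mapping.keys f \<subseteq> M}" "y \<in> {f :: nat cpoly. Poly_Mapping.keys f \<subseteq> M}" for x y :: "nat cpoly"
        using that keys_add[of x y] by auto
      show "cpoly_const c * x \<in> {f :: nat cpoly. Poly_Mapping.keys f \<subseteq> M}"
        if "x \<in> {f :: nat cpoly. Poly_Mapping.keys f \<subseteq> M}" for c and x :: "nat cpoly"
        using that by (auto simp: subset_iff in_keys_iff)
    qed simp
  qed (auto simp: monomials_def)
  show "{f :: nat cpoly. Poly_Mapping.keys f \<subseteq> M} \<subseteq> cpoly.span (monomials M)"
  proof
    fix f :: "nat cpoly" assume "f \<in> {f :: nat cpoly. Poly_Mapping.keys f \<subseteq> M}"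
    then have "(\<Sum>m\<in>Poly_Mapping.keys f. cpoly_const (Poly_Mapping.lookup f m) * Poly_Mapping.single m 1)
        \<in> cpoly.span (monomials M)"
      by (intro cpoly.span_sum cpoly.span_scale cpoly.span_base) (auto simp: monomials_def)
    also have "(\<Sum>m\<in>Poly_Mapping.keys f. cpoly_const (Poly_Mapping.lookup f m) * Poly_Mapping.single m 1) = f"
      using poly_mapping_sum_single[of f] by (simp add: cpoly_const_def mult_single)
    finally show "f \<in> cpoly.span (monomials M)" .
  qed
qed

lemma independent_monomials: "cpoly.independent (monomials M)"
  unfolding cpoly.dependent_def
proof
  assume "\<exists>a\<in>monomials M. a \<in> cpoly.span (monomials M - {a})"
  then obtain m where m: "m \<in> M" "Poly_Mapping.single m 1 \<in> cpoly.span (monomials M - {Poly_Mapping.single m 1})"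
    by (auto simp: monomials_def)
  have "monomials M - {Poly_Mapping.single m 1} \<subseteq> monomials (M - {m})"
    by (auto simp: monomials_def)
  then have "Poly_Mapping.single m (1::complex) \<in> cpoly.span (monomials (M - {m}))"
    using m cpoly.span_mono by blast
  then show False by (simp add: span_monomials)
qed

lemma linear_shear: "Vector_Spaces.linear (\<lambda>c p. cpoly_const c * p) (\<lambda>c p. cpoly_const c * p)
    (shear \<sigma> p q I :: nat cpoly \<Rightarrow> nat cpoly)"
  by (simp add: linear_iff_module_hom module_hom_iff cpoly.module_axioms shear_add shear_scale)

text \<open>The common core of both dimension counts. Invariants and covariants differ only in the
  monomial sets \<open>M0\<close> and \<open>M2\<close>, for which it remains to check that the two
  operators map between their spans.\<close>

lemma dim_kernel_shear:
  fixes p q :: "'i \<Rightarrow> nat"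
  assumes I: "finite I" "inj_on p I" "inj_on q I" "\<And>i. i \<in> I \<Longrightarrow> \<sigma> i \<in> {1, -1}"
    and M: "finite M0" "finite M2" and wt: "\<And>m. m \<in> M2 \<Longrightarrow> weight p q I m = 2"
    and 02: "\<And>f. Poly_Mapping.keys f \<subseteq> M0 \<Longrightarrow> Poly_Mapping.keys (shear \<sigma> q p I f) \<subseteq> M2"
    and 20: "\<And>f. Poly_Mapping.keys f \<subseteq> M2 \<Longrightarrow> Poly_Mapping.keys (shear \<sigma> p q I f) \<subseteq> M0"
  shows "cpoly_dim {f. Poly_Mapping.keys f \<subseteq> M0 \<and> shear \<sigma> q p I f = 0} + card M2 = card M0"
proof -
  have "cpoly_dim {f \<in> cpoly.span (monomials M0). shear \<sigma> q p I f = 0} + card (monomials M2) = card (monomials M0)"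
  proof (rule cpoly.dim_kernel_if_comp_inj[OF linear_shear linear_shear])
    show "finite (monomials M0)" "finite (monomials M2)"
      using M by (simp_all add: monomials_def)
    show "shear \<sigma> q p I ` monomials M0 \<subseteq> cpoly.span (monomials M2)"
      unfolding span_monomials using 02[of "Poly_Mapping.single _ 1"] by (auto simp: monomials_def)
    show "shear \<sigma> p q I ` monomials M2 \<subseteq> cpoly.span (monomials M0)"
      unfolding span_monomials using 20[of "Poly_Mapping.single _ 1"] by (auto simp: monomials_def)
    fix v assume "v \<in> cpoly.span (monomials M2)" "shear \<sigma> q p I (shear \<sigma> p q I v) = 0"
    then show "v = 0"
      using shear_shear_inj_weight_pos[of I p q \<sigma> v 2, OF I] wt by (auto simp: span_monomials)
  qed (rule independent_monomials)+
  then show ?thesis by (simp add: card_monomials span_monomials)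
qed


section \<open>Infinitesimal characterisation of invariance\<close>


text \<open>
  The twisted vector with index \<open>i\<close> has the coordinates \<open>v (hp i)\<close> and \<open>hs i * v (hq i)\<close>; on it the
  group acts by right multiplication with the inverse matrix.
\<close>

definition hp :: "nat \<Rightarrow> nat" where "hp i = (if i = 0 then 1 else 2 * i)"
definition hq :: "nat \<Rightarrow> nat" where "hq i = (if i = 0 then 0 else 2 * i + 1)"
definition hs :: "nat \<Rightarrow> complex" where "hs i = (if i = 0 then -1 else 1)"

lemma hp_hq_simps [simp]: "hp i div 2 = i" "hq i div 2 = i" "hp i \<noteq> hq j" "hq j \<noteq> hp i"
  "hp i = hp j \<longleftrightarrow> i = j" "hq i = hq j \<longleftrightarrow> i = j" "hs i * hs i = 1" "hs i * (hs i * x) = x"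
  by (auto simp: hp_def hq_def hs_def) presburger+

lemma hp_hq_cases: "k = hp (k div 2) \<or> k = hq (k div 2)"
  by (auto simp: hp_def hq_def)

lemma inj_on_hp [simp]: "inj_on hp I" and inj_on_hq [simp]: "inj_on hq I"
  by (auto simp: inj_on_def)

text \<open>Every twisted vector, as a row, is multiplied by the matrix with rows
  \<open>(\<alpha>, \<beta>)\<close> and \<open>(\<gamma>, \<delta>)\<close>; the factors
  \<open>hs\<close> translate this to the untwisted coordinates. The determinant is left free, so
  that the derivative of a curve of matrices is again of this form.\<close>

definition hact :: "complex \<Rightarrow> complex \<Rightarrow> complex \<Rightarrow> complex \<Rightarrow> (nat \<Rightarrow> complex) \<Rightarrow> nat \<Rightarrow> complex" where
  "hact \<alpha> \<beta> \<gamma> \<delta> v k = (let i = k div 2 in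
     if k = hp i then \<alpha> * v (hp i) + \<gamma> * (hs i * v (hq i))
     else \<beta> * (hs i * v (hp i)) + \<delta> * v (hq i))"

lemma hact_hp [simp]: "hact \<alpha> \<beta> \<gamma> \<delta> v (hp i) = \<alpha> * v (hp i) + \<gamma> * (hs i * v (hq i))"
  and hact_hq [simp]: "hact \<alpha> \<beta> \<gamma> \<delta> v (hq i) = \<beta> * (hs i * v (hp i)) + \<delta> * v (hq i)"
  by (simp_all add: hact_def)

lemma eq_on_hp_hq: "(\<And>i. v (hp i) = w (hp i)) \<Longrightarrow> (\<And>i. v (hq i) = w (hq i)) \<Longrightarrow> v = w"
  using hp_hq_cases by (metis ext)

text \<open>Row vectors give a right action: the matrix applied first is the left factor of the
  product.\<close>

lemma hact_hact:
  "hact \<alpha> \<beta> \<gamma> \<delta> (hact a b c d v) =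
     hact (a * \<alpha> + b * \<gamma>) (a * \<beta> + b * \<delta>) (c * \<alpha> + d * \<gamma>) (c * \<beta> + d * \<delta>) v"
  by (rule eq_on_hp_hq) (simp_all add: algebra_simps)

lemma matrix_inv_SL2:
  fixes g :: "complex^2^2"
  assumes "det g = 1"
  shows "matrix_inv g = vector [vector [g$2$2, - g$1$2], vector [- g$2$1, g$1$1]]" (is "_ = ?h")
proof -
  have d: "g$1$1 * g$2$2 - g$1$2 * g$2$1 = 1" using assms by (simp add: det_2)
  have 1: "g ** ?h = mat 1" and 2: "?h ** g = mat 1"
    using d by (simp_all add: vec_eq_iff forall_2 matrix_matrix_mult_def sum_2 mat_def algebra_simps)
  then have "g ** matrix_inv g = mat 1"
    unfolding matrix_inv_def by (metis (mono_tags, lifting) someI)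
  have "matrix_inv g = (?h ** g) ** matrix_inv g"
    unfolding 2 by (rule matrix_mul_lid[symmetric])
  also have "\<dots> = ?h ** (g ** matrix_inv g)" by (rule matrix_mul_assoc[symmetric])
  also have "\<dots> = ?h" unfolding \<open>g ** matrix_inv g = mat 1\<close> by (rule matrix_mul_rid)
  finally show ?thesis .
qed

lemma coords_simps: "coords w (i * 2) = w i $ 1" "coords w (Suc (i * 2)) = w i $ 2" "coords w (2 * i) = w i $ 1" "coords w (Suc (2 * i)) = w i $ 2"
  by (simp_all add: coords_def)

text \<open>The twist pays off here: if \<open>(x, y)\<close> is multiplied by \<open>g\<close> from
  the left, then \<open>(y, -x)\<close> is multiplied by the inverse of \<open>g\<close> from the
  right, just as the forms are.\<close>

lemma coords_SL2_act:
  assumes "g \<in> SL2"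
  shows "coords (SL2_act g w) = hact (g$2$2) (- g$1$2) (- g$2$1) (g$1$1) (coords w)"
proof (rule eq_on_hp_hq)
  have inv: "matrix_inv g = vector [vector [g$2$2, - g$1$2], vector [- g$2$1, g$1$1]]"
    using assms by (intro matrix_inv_SL2) (simp add: SL2_def)
  have [simp]: "coords w 0 = w 0 $ 1" "coords w (Suc 0) = w 0 $ 2" for w
    by (simp_all add: coords_def)
  fix i
  show "coords (SL2_act g w) (hp i) = hact (g$2$2) (- g$1$2) (- g$2$1) (g$1$1) (coords w) (hp i)"
    "coords (SL2_act g w) (hq i) = hact (g$2$2) (- g$1$2) (- g$2$1) (g$1$1) (coords w) (hq i)"
    by (cases "i = 0"; simp only: hact_hp hact_hq; simp add: hp_def hq_def hs_def coords_simps SL2_act_def inv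
        matrix_vector_mult_def vector_matrix_mult_def sum_2 mult.commute)+
qed

lemma SL2_invariant_iff_hact:
  "SL2_invariant p \<longleftrightarrow> (\<forall>\<alpha> \<beta> \<gamma> \<delta>. \<alpha> * \<delta> - \<beta> * \<gamma> = 1 \<longrightarrow> (\<forall>v. ev (hact \<alpha> \<beta> \<gamma> \<delta> v) p = ev v p))"
proof
  assume inv: "SL2_invariant p"
  show "\<forall>\<alpha> \<beta> \<gamma> \<delta>. \<alpha> * \<delta> - \<beta> * \<gamma> = 1 \<longrightarrow> (\<forall>v. ev (hact \<alpha> \<beta> \<gamma> \<delta> v) p = ev v p)"
  proof (intro allI impI)
    fix \<alpha> \<beta> \<gamma> \<delta> v assume d: "\<alpha> * \<delta> - \<beta> * \<gamma> = (1::complex)"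
    \<comment> \<open>The inverse of the given matrix, since \<open>hact\<close> describes right
      multiplication by the inverse of \<open>g\<close>.\<close>
    define g :: "complex^2^2" where "g = vector [vector [\<delta>, - \<beta>], vector [- \<gamma>, \<alpha>]]"
    define w :: "nat \<Rightarrow> complex^2" where "w i = vector [v (2 * i), v (2 * i + 1)]" for i
    have g: "g \<in> SL2" using d by (simp add: SL2_def g_def det_2 algebra_simps)
    have v: "coords w = v"
      by (rule ext) (auto simp: coords_def w_def elim!: evenE oddE)
    show "ev (hact \<alpha> \<beta> \<gamma> \<delta> v) p = ev v p"
      using inv g coords_SL2_act[OF g, of w] v by (simp add: SL2_invariant_def ev_def g_def) metis
  qed
next
  assume inv: "\<forall>\<alpha> \<beta> \<gamma> \<delta>. \<alpha> * \<delta> - \<beta> * \<gamma> = 1 \<longrightarrow> (\<forall>v. ev (hact \<alpha> \<beta> \<gamma> \<delta> v) p = ev v p)"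
  show "SL2_invariant p"
    unfolding SL2_invariant_def ev_def[symmetric]
  proof (intro ballI allI)
    fix g w assume g: "g \<in> SL2"
    then have "g$2$2 * g$1$1 - (- g$1$2) * (- g$2$1) = 1"
      by (simp add: SL2_def det_2 algebra_simps)
    then show "ev (coords (SL2_act g w)) p = ev (coords w) p"
      using inv coords_SL2_act[OF g] by metis
  qed
qed

lemma hact_derivative:
  assumes I: "finite I" and vars: "cpoly_vars f \<subseteq> hp ` I \<union> hq ` I"
    and ders: "(a has_field_derivative a') (at s)" "(b has_field_derivative b') (at s)"
       "(c has_field_derivative c') (at s)" "(d has_field_derivative d') (at s)"
  shows "((\<lambda>s. ev (hact (a s) (b s) (c s) (d s) v) f) has_field_derivative
    (\<Sum>i\<in>I. (a' * v (hp i) + c' * (hs i * v (hq i))) * ev (hact (a s) (b s) (c s) (d s) v) (cderiv (hp i) f)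
         + (b' * (hs i * v (hp i)) + d' * v (hq i)) * ev (hact (a s) (b s) (c s) (d s) v) (cderiv (hq i) f))) (at s)"
proof -
  let ?V = "hp ` I \<union> hq ` I"
  have "((\<lambda>s. ev (hact (a s) (b s) (c s) (d s) v) f) has_field_derivative
     (\<Sum>k\<in>?V. hact a' b' c' d' v k * ev (hact (a s) (b s) (c s) (d s) v) (cderiv k f))) (at s)"
    by (rule ev_chain_rule[OF _ vars]) (use I ders in \<open>auto intro!: derivative_eq_intros\<close>)
  also have "(\<Sum>k\<in>?V. hact a' b' c' d' v k * ev (hact (a s) (b s) (c s) (d s) v) (cderiv k f)) =
     (\<Sum>k\<in>hp ` I. hact a' b' c' d' v k * ev (hact (a s) (b s) (c s) (d s) v) (cderiv k f)) +
     (\<Sum>k\<in>hq ` I. hact a' b' c' d' v k * ev (hact (a s) (b s) (c s) (d s) v) (cderiv k f))"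
    using I by (intro sum.union_disjoint) auto
  finally show ?thesis by (simp add: sum.reindex sum.distrib)
qed

lemma hact_id [simp]: "hact 1 0 0 1 v = v"
  by (rule eq_on_hp_hq) simp_all

text \<open>The coordinate that multiplies the derivative is fixed by the shear, so the derivative
  at every time \<open>s\<close> is the operator evaluated at the moved point. If the operator kills
  \<open>f\<close>, then \<open>f\<close> is constant along the whole curve, not just stationary at
  the identity.\<close>

lemma lower_shear_derivative:
  assumes I: "finite I" and vars: "cpoly_vars f \<subseteq> hp ` I \<union> hq ` I"
  shows "((\<lambda>s. ev (hact 1 0 s 1 v) f) has_field_derivative ev (hact 1 0 s 1 v) (shear hs hp hq I f)) (at s)"
  using hact_derivative[OF assms DERIV_const DERIV_const DERIV_ident DERIV_const, of 1 0 1 v s]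
  by (simp add: shear_def mult.assoc)

lemma upper_shear_derivative:
  assumes I: "finite I" and vars: "cpoly_vars f \<subseteq> hp ` I \<union> hq ` I"
  shows "((\<lambda>s. ev (hact 1 s 0 1 v) f) has_field_derivative ev (hact 1 s 0 1 v) (shear hs hq hp I f)) (at s)"
  using hact_derivative[OF assms DERIV_const DERIV_ident DERIV_const DERIV_const, of 1 0 1 v s]
  by (simp add: shear_def mult.assoc)

lemma torus_derivative:
  assumes I: "finite I" and vars: "cpoly_vars f \<subseteq> hp ` I \<union> hq ` I"
  shows "((\<lambda>s. ev (hact s 0 0 (inverse s) v) f) has_field_derivative
     ev v (\<Sum>i\<in>I. cvar (hp i) * cderiv (hp i) f - cvar (hq i) * cderiv (hq i) f)) (at 1)"
proof -
  have "(inverse has_field_derivative - 1) (at (1::complex))"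
    by (auto intro!: derivative_eq_intros)
  from hact_derivative[OF assms DERIV_ident DERIV_const DERIV_const this, of 0 0 v]
  show ?thesis by simp
qed

text \<open>The two unipotent groups generate SL2: a matrix with nonzero lower left entry is a
  product of three shears, and one more shear reduces the remaining matrices to this case.\<close>

lemma SL2_invariant_if_shear_invariant:
  assumes lower: "\<And>s v. ev (hact 1 0 s 1 v) p = ev v p" and upper: "\<And>s v. ev (hact 1 s 0 1 v) p = ev v p"
  shows "SL2_invariant p"
proof -
  have gen: "ev (hact \<alpha> \<beta> \<gamma> \<delta> v) p = ev v p" if d: "\<alpha> * \<delta> - \<beta> * \<gamma> = 1" and "\<gamma> \<noteq> 0" for \<alpha> \<beta> \<gamma> \<delta> v
  proof -
    \<comment> \<open>Upper, lower, upper: the lower shear supplies the entry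
      \<open>\<gamma>\<close>, the upper ones correct the diagonal entries, and the determinant
      forces the last entry.\<close>
    have "hact 1 ((\<delta> - 1) / \<gamma>) 0 1 (hact 1 0 \<gamma> 1 (hact 1 ((\<alpha> - 1) / \<gamma>) 0 1 v)) = hact \<alpha> \<beta> \<gamma> \<delta> v"
    proof -
      have "\<alpha> * ((\<delta> - 1) / \<gamma>) + (\<alpha> - 1) / \<gamma> = \<beta>"
        using d \<open>\<gamma> \<noteq> 0\<close> by (simp add: field_simps)
      then show ?thesis using \<open>\<gamma> \<noteq> 0\<close> by (simp add: hact_hact)
    qed
    then show ?thesis using lower upper by metis
  qed
  show ?thesis unfolding SL2_invariant_iff_hact
  proof (intro allI impI)
    fix \<alpha> \<beta> \<gamma> \<delta> v assume d: "\<alpha> * \<delta> - \<beta> * \<gamma> = (1::complex)"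
    show "ev (hact \<alpha> \<beta> \<gamma> \<delta> v) p = ev v p"
    proof (cases "\<gamma> = 0")
      case True
      then have "\<delta> \<noteq> 0" using d by auto
      \<comment> \<open>A further lower shear changes the lower left entry from 0 to
        \<open>\<delta>\<close>.\<close>
      have "ev (hact \<alpha> \<beta> \<gamma> \<delta> v) p = ev (hact 1 0 1 1 (hact \<alpha> \<beta> \<gamma> \<delta> v)) p"
        by (simp add: lower)
      also have "\<dots> = ev v p"
        unfolding hact_hact by (rule gen) (use d \<open>\<delta> \<noteq> 0\<close> True in \<open>simp_all add: algebra_simps\<close>)
      finally show ?thesis .
    qed (use gen d in blast)
  qed
qed

lemma constant_if_derivative_0:
  fixes f :: "complex \<Rightarrow> complex"
  assumes "\<And>s. (f has_field_derivative 0) (at s)"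
  shows "f s = f 0"
  using has_field_derivative_zero_constant[of UNIV f] assms by auto

text \<open>Invariance is differentiated at the identity along the upper shears and along the torus.
  Conversely, weight 0 turns the vanishing of E f into that of F f, which makes \<open>f\<close>
  constant along all shears.\<close>

lemma SL2_invariant_iff_shear:
  assumes I: "finite I" and vars: "cpoly_vars f \<subseteq> hp ` I \<union> hq ` I"
  shows "SL2_invariant f \<longleftrightarrow>
    (\<forall>m\<in>Poly_Mapping.keys f. weight hp hq I m = 0) \<and> shear hs hq hp I f = 0"
proof
  assume inv: "SL2_invariant f"
  then have inv': "ev (hact \<alpha> \<beta> \<gamma> \<delta> v) f = ev v f" if "\<alpha> * \<delta> - \<beta> * \<gamma> = 1" for \<alpha> \<beta> \<gamma> \<delta> v
    using that by (simp add: SL2_invariant_iff_hact)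
  have "ev v (shear hs hq hp I f) = 0" for v
    using upper_shear_derivative[OF assms, of v 0] inv' DERIV_unique[OF _ DERIV_const] by simp
  then have shear: "shear hs hq hp I f = 0" by (rule cpoly_eq_0_if_ev_0)
  let ?H = "\<Sum>i\<in>I. cvar (hp i) * cderiv (hp i) f - cvar (hq i) * cderiv (hq i) f"
  have "ev v ?H = 0" for v
  proof -
    \<comment> \<open>The diagonal matrix has determinant 1 only for nonzero \<open>s\<close>, as
      \<open>inverse 0 = 0\<close>; an open neighbourhood of 1 is enough for the derivative
      there.\<close>
    have "((\<lambda>s. ev v f) has_field_derivative ev v ?H) (at 1)"
    proof (rule has_field_derivative_transform_within_open[OF torus_derivative[OF assms]])
      show "open (- {0::complex})" by (simp add: open_Compl)
      show "ev (hact s 0 0 (inverse s) v) f = ev v f" if "s \<in> - {0}" for s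
        using that by (intro inv') simp
    qed simp
    then show ?thesis using DERIV_unique[OF _ DERIV_const] by blast
  qed
  then have H: "?H = 0" by (rule cpoly_eq_0_if_ev_0)
  have "weight hp hq I m = 0" if "m \<in> Poly_Mapping.keys f" for m
  proof -
    have "Poly_Mapping.lookup ?H m = of_int (weight hp hq I m) * Poly_Mapping.lookup f m"
      by (simp add: lookup_sum lookup_minus cvar_cderiv_lookup weight_def sum_distrib_right
          left_diff_distrib)
    then show ?thesis using H that by (simp add: in_keys_iff)
  qed
  with shear show "(\<forall>m\<in>Poly_Mapping.keys f. weight hp hq I m = 0) \<and> shear hs hq hp I f = 0" by blast
next
  assume *: "(\<forall>m\<in>Poly_Mapping.keys f. weight hp hq I m = 0) \<and> shear hs hq hp I f = 0"
  then have **: "shear hs hp hq I f = 0"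
    using shear_eq_0_iff_weight_0[of I hp hq hs f] I by (auto simp: hs_def)
  show "SL2_invariant f"
  proof (rule SL2_invariant_if_shear_invariant)
    fix s v
    show "ev (hact 1 0 s 1 v) f = ev v f"
      using constant_if_derivative_0[of "\<lambda>s. ev (hact 1 0 s 1 v) f" s] lower_shear_derivative[OF assms, of v] **
      by simp
    show "ev (hact 1 s 0 1 v) f = ev v f"
      using constant_if_derivative_0[of "\<lambda>s. ev (hact 1 s 0 1 v) f" s] upper_shear_derivative[OF assms, of v] *
      by simp
  qed
qed


section \<open>Counting monomials by weight\<close>


definition mons :: "'v set \<Rightarrow> nat \<Rightarrow> ('v \<Rightarrow>\<^sub>0 nat) set" where
  "mons S d = {m. Poly_Mapping.keys m \<subseteq> S \<and> (\<Sum>k\<in>S. Poly_Mapping.lookup m k) = d}"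

text \<open>Exponent functions are the counting functions of multisets, which reduces the count to
  multisets of given size.\<close>

lemma bij_betw_mons:
  assumes "finite S"
  shows "bij_betw (\<lambda>X. Abs_poly_mapping (count X)) (multisets_of_size S d) (mons S d)"
proof -
  have lk [simp]: "Poly_Mapping.lookup (Abs_poly_mapping (count X)) = count X" for X :: "'a multiset"
    by (rule lookup_Abs_poly_mapping) (simp add: flip: set_mset_def)
  have cnt [simp]: "count (Abs_multiset (Poly_Mapping.lookup m)) = Poly_Mapping.lookup m" for m :: "'a \<Rightarrow>\<^sub>0 nat"
    by (rule count_Abs_multiset) simp
  have keys: "Poly_Mapping.keys (Abs_poly_mapping (count X)) = set_mset X" for X :: "'a multiset"
    by (auto simp: in_keys_iff)
  have size: "size X = (\<Sum>k\<in>S. count X k)" if "set_mset X \<subseteq> S" for X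
    unfolding size_multiset_overloaded_eq using that assms
    by (intro sum.mono_neutral_left) (auto simp: not_in_iff)
  show ?thesis
    by (rule bij_betw_byWitness[where f' = "\<lambda>m. Abs_multiset (Poly_Mapping.lookup m)"])
      (auto simp: multisets_of_size_def mons_def keys size multiset_eq_iff subset_iff in_keys_iff
        intro!: poly_mapping_eqI simp flip: count_greater_zero_iff)
qed

lemma finite_mons: "finite S \<Longrightarrow> finite (mons S d)"
  using bij_betw_mons bij_betw_finite finite_multisets_of_size by blast

lemma card_mons: "finite S \<Longrightarrow> card (mons S d) = (card S + d - 1) choose d"
  using bij_betw_mons[of S d] card_multisets_of_size[of S d] by (metis bij_betw_same_card)

definition pm_restrict :: "'v set \<Rightarrow> ('v \<Rightarrow>\<^sub>0 nat) \<Rightarrow> ('v \<Rightarrow>\<^sub>0 nat)" where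
  "pm_restrict S m = Abs_poly_mapping (\<lambda>k. if k \<in> S then Poly_Mapping.lookup m k else 0)"

lemma lookup_pm_restrict [simp]:
  "Poly_Mapping.lookup (pm_restrict S m) k = (if k \<in> S then Poly_Mapping.lookup m k else 0)"
proof -
  have "finite {k. (if k \<in> S then Poly_Mapping.lookup m k else 0) \<noteq> 0}"
    by (rule finite_subset[OF _ finite_keys[of m]]) (auto simp: in_keys_iff)
  then show ?thesis unfolding pm_restrict_def by simp
qed

lemma bij_betw_mons_Un:
  assumes "S \<inter> T = {}"
  shows "bij_betw (\<lambda>(m, m'). m + m') (mons S a \<times> mons T b)
    {m. Poly_Mapping.keys m \<subseteq> S \<union> T \<and> (\<Sum>k\<in>S. Poly_Mapping.lookup m k) = a \<and> (\<Sum>k\<in>T. Poly_Mapping.lookup m k) = b}"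
proof (rule bij_betw_byWitness[where f' = "\<lambda>m. (pm_restrict S m, pm_restrict T m)"])
  have z: "Poly_Mapping.lookup m k = 0" if "Poly_Mapping.keys m \<subseteq> S" "k \<notin> S" for m :: "'a \<Rightarrow>\<^sub>0 nat" and k S
    using that by (auto simp: in_keys_iff)
  show "\<forall>x\<in>mons S a \<times> mons T b. (pm_restrict S (case x of (m, m') \<Rightarrow> m + m'), pm_restrict T (case x of (m, m') \<Rightarrow> m + m')) = x"
    using assms by (auto simp: mons_def lookup_add intro!: poly_mapping_eqI dest: z) (meson disjoint_iff z)+
  show "\<forall>m\<in>{m. Poly_Mapping.keys m \<subseteq> S \<union> T \<and> (\<Sum>k\<in>S. Poly_Mapping.lookup m k) = a \<and>
     (\<Sum>k\<in>T. Poly_Mapping.lookup m k) = b}. (case (pm_restrict S m, pm_restrict T m) of (m, m') \<Rightarrow> m + m') = m"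
    using assms by (auto simp: lookup_add intro!: poly_mapping_eqI z)
  have s: "(\<Sum>k\<in>T. Poly_Mapping.lookup m k) = 0" if "Poly_Mapping.keys m \<subseteq> S" "S \<inter> T = {}" for m :: "'a \<Rightarrow>\<^sub>0 nat" and S T
    using that by (intro sum.neutral) (auto intro!: z)
  show "(\<lambda>(m, m'). m + m') ` (mons S a \<times> mons T b) \<subseteq> {m. Poly_Mapping.keys m \<subseteq> S \<union> T \<and>
     (\<Sum>k\<in>S. Poly_Mapping.lookup m k) = a \<and> (\<Sum>k\<in>T. Poly_Mapping.lookup m k) = b}"
    using assms by (auto simp: mons_def keys_add_nat lookup_add sum.distrib s Int_commute)
  show "(\<lambda>m. (pm_restrict S m, pm_restrict T m)) ` {m. Poly_Mapping.keys m \<subseteq> S \<union> T \<and>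
     (\<Sum>k\<in>S. Poly_Mapping.lookup m k) = a \<and> (\<Sum>k\<in>T. Poly_Mapping.lookup m k) = b} \<subseteq> mons S a \<times> mons T b"
    by (auto simp: mons_def in_keys_iff split: if_splits)
qed

lemma card_mons_split:
  fixes S T :: "'v set"
  assumes "finite S" "finite T" "S \<inter> T = {}"
  shows "card {m. Poly_Mapping.keys m \<subseteq> S \<union> T \<and>
      (\<Sum>k\<in>S. Poly_Mapping.lookup m k) + (\<Sum>k\<in>T. Poly_Mapping.lookup m k) = j \<and> P (\<Sum>k\<in>S. Poly_Mapping.lookup m k)}
    = (\<Sum>a | a \<le> j \<and> P a. card (mons S a) * card (mons T (j - a)))" (is "card ?X = _")
    and "finite {m. Poly_Mapping.keys m \<subseteq> S \<union> T \<and>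
      (\<Sum>k\<in>S. Poly_Mapping.lookup m k) + (\<Sum>k\<in>T. Poly_Mapping.lookup m k) = j \<and> P (\<Sum>k\<in>S. Poly_Mapping.lookup m k)}"
proof -
  let ?F = "\<lambda>a b. {m :: 'v \<Rightarrow>\<^sub>0 nat. Poly_Mapping.keys m \<subseteq> S \<union> T \<and> (\<Sum>k\<in>S. Poly_Mapping.lookup m k) = a \<and>
      (\<Sum>k\<in>T. Poly_Mapping.lookup m k) = b}"
  have X: "?X = (\<Union>a\<in>{a. a \<le> j \<and> P a}. ?F a (j - a))" by auto
  have fin: "finite (?F a b)" for a b
    by (rule iffD1[OF bij_betw_finite[OF bij_betw_mons_Un[OF assms(3)]]])
       (intro finite_cartesian_product finite_mons assms)
  have card: "card (?F a b) = card (mons S a) * card (mons T b)" for a b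
    by (subst bij_betw_same_card[OF bij_betw_mons_Un[OF assms(3)], symmetric]) (rule card_cartesian_product)
  show "card ?X = (\<Sum>a | a \<le> j \<and> P a. card (mons S a) * card (mons T (j - a)))"
    unfolding X by (subst card_UN_disjoint) (auto simp: fin card)
  show "finite ?X" unfolding X using fin by auto
qed

text \<open>The predicate sees the degree \<open>a\<close> in the variables \<open>hp i\<close>.
  Since the weight is \<open>2 * a - j\<close>, it can express any condition on the weight.\<close>

definition form_mons :: "nat \<Rightarrow> nat \<Rightarrow> (nat \<Rightarrow> bool) \<Rightarrow> (nat \<Rightarrow>\<^sub>0 nat) set" where
  "form_mons n j P = {m. Poly_Mapping.keys m \<subseteq> {2..<2*n+2} \<and> (\<Sum>k\<in>{2..<2*n+2}. Poly_Mapping.lookup m k) = j \<and>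
     P (\<Sum>i=1..n. Poly_Mapping.lookup m (hp i))}"

lemma forms_decomp: "{2..<2*n+2} = hp ` {1..n} \<union> hq ` {1..n}"
proof -
  have "k \<in> hp ` {1..n} \<union> hq ` {1..n}" if "k \<in> {2..<2*n+2}" for k
    using hp_hq_cases[of k] that by force
  moreover have "k \<in> {2..<2*n+2}" if "k \<in> hp ` {1..n} \<union> hq ` {1..n}" for k
    using that by (auto simp: hp_def hq_def)
  ultimately show ?thesis by blast
qed

lemma forms_sum:
  "(\<Sum>k\<in>{2..<2*n+2}. f k) = (\<Sum>i=1..n. f (hp i)) + (\<Sum>i=1..n. f (hq i) :: nat)"
  unfolding forms_decomp by (subst sum.union_disjoint) (auto simp: sum.reindex)

text \<open>This is the number g(d) of the overview.\<close>

definition nmon :: "nat \<Rightarrow> nat \<Rightarrow> nat" where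
  "nmon n d = (n + d - 1) choose d"

lemma card_form_mons: "card (form_mons n j P) = (\<Sum>a | a \<le> j \<and> P a. nmon n a * nmon n (j - a))"
  and finite_form_mons: "finite (form_mons n j P)"
proof -
  have eq: "form_mons n j P = {m. Poly_Mapping.keys m \<subseteq> hp ` {1..n} \<union> hq ` {1..n} \<and>
      (\<Sum>k\<in>hp ` {1..n}. Poly_Mapping.lookup m k) + (\<Sum>k\<in>hq ` {1..n}. Poly_Mapping.lookup m k) = j \<and>
      P (\<Sum>k\<in>hp ` {1..n}. Poly_Mapping.lookup m k)}"
    unfolding form_mons_def forms_sum unfolding forms_decomp by (simp add: sum.reindex)
  have disj: "hp ` {1..n} \<inter> hq ` {1..n} = {}" by auto
  show "card (form_mons n j P) = (\<Sum>a | a \<le> j \<and> P a. nmon n a * nmon n (j - a))"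
    unfolding eq by (subst card_mons_split(1)[OF _ _ disj]) (simp_all add: card_mons card_image nmon_def)
  show "finite (form_mons n j P)"
    unfolding eq by (rule card_mons_split(2)[OF _ _ disj]) auto
qed

text \<open>Without the bound \<open>K\<close> these sets need not be finite: multiplication by the
  product of the variables 0 and 1 changes neither the degree in the forms nor the weight.\<close>

definition bounded_mons :: "nat \<Rightarrow> nat \<Rightarrow> nat \<Rightarrow> int \<Rightarrow> (nat \<Rightarrow>\<^sub>0 nat) set" where
  "bounded_mons n j K w = {m. Poly_Mapping.keys m \<subseteq> {0..<2*n+2} \<and>
     (\<Sum>k\<in>{2..<2*n+2}. Poly_Mapping.lookup m k) = j \<and>
     Poly_Mapping.lookup m 0 + Poly_Mapping.lookup m 1 \<le> K \<and> weight hp hq {0..n} m = w}"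

lemma weight_forms: "weight hp hq {1..n} m =
    int (\<Sum>i=1..n. Poly_Mapping.lookup m (hp i)) - int (\<Sum>i=1..n. Poly_Mapping.lookup m (hq i))"
  by (simp add: weight_def sum_subtractf)

lemma weight_with_vector: "weight hp hq {0..n} m =
    int (Poly_Mapping.lookup m 1) - int (Poly_Mapping.lookup m 0) + weight hp hq {1..n} m"
  by (simp add: weight_def sum.atLeast_Suc_atMost) (simp add: hp_def hq_def)

lemma finite_bounded_mons: "finite (bounded_mons n j K w)"
proof (rule finite_subset)
  show "bounded_mons n j K w \<subseteq> (\<Union>d\<in>{..j + K}. mons {0..<2*n+2} d)"
  proof
    fix m assume m: "m \<in> bounded_mons n j K w"
    have "{0..<2*n+2} = insert 0 (insert 1 {2..<2*n+2})" by auto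
    then have "(\<Sum>k\<in>{0..<2*n+2}. Poly_Mapping.lookup m k) =
       Poly_Mapping.lookup m 0 + (Poly_Mapping.lookup m 1 + (\<Sum>k\<in>{2..<2*n+2}. Poly_Mapping.lookup m k))"
      by simp
    with m show "m \<in> (\<Union>d\<in>{..j + K}. mons {0..<2*n+2} d)"
      by (auto simp: bounded_mons_def mons_def)
  qed
qed (auto intro: finite_mons)

text \<open>If only one of the variables 0 and 1 may occur, its exponent is forced by the weight.
  Such monomials correspond to monomials in the forms for which the forced exponent \<open>c\<close>
  is nonnegative.\<close>

lemma card_attach_power:
  assumes "l \<in> {0, 1}" "P = (\<lambda>a. c a \<ge> (0::int))"
  shows "card {m. Poly_Mapping.keys m \<subseteq> insert l {2..<2*n+2} \<and>
      (\<Sum>k\<in>{2..<2*n+2}. Poly_Mapping.lookup m k) = j \<and>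
      int (Poly_Mapping.lookup m l) = c (\<Sum>i=1..n. Poly_Mapping.lookup m (hp i))} = card (form_mons n j P)"
proof -
  define V where "V = {2..<2*n+2}"
  define I where "I = {1..n}"
  have hpV: "hp i \<in> V" if "i \<in> I" for i
    using that by (auto simp: hp_def V_def I_def)
  have l: "l \<notin> V" using assms(1) by (auto simp: V_def)
  let ?A = "\<lambda>m. \<Sum>i\<in>I. Poly_Mapping.lookup m (hp i)"
  have eq: "form_mons n j P = {m. Poly_Mapping.keys m \<subseteq> V \<and> (\<Sum>k\<in>V. Poly_Mapping.lookup m k) = j \<and> P (?A m)}"
    by (simp only: form_mons_def V_def I_def)
  have on_V: "(\<Sum>k\<in>V. Poly_Mapping.lookup m k) = (\<Sum>k\<in>V. Poly_Mapping.lookup m' k)" "?A m = ?A m'"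
    if "\<And>k. k \<in> V \<Longrightarrow> Poly_Mapping.lookup m k = Poly_Mapping.lookup m' k" for m m' :: "nat \<Rightarrow>\<^sub>0 nat"
    using that hpV by (auto intro!: sum.cong)
  let ?e = "\<lambda>m. m + Poly_Mapping.single l (nat (c (?A m)))"
  have e: "Poly_Mapping.lookup (?e m) k = Poly_Mapping.lookup m k" if "k \<in> V" for m k
    using that l by (auto simp: lookup_add lookup_single when_def)
  have r: "Poly_Mapping.lookup (pm_restrict V m) k = Poly_Mapping.lookup m k" if "k \<in> V" for m k
    using that by simp
  let ?X = "{m. Poly_Mapping.keys m \<subseteq> insert l V \<and> (\<Sum>k\<in>V. Poly_Mapping.lookup m k) = j \<and>
      int (Poly_Mapping.lookup m l) = c (?A m)}"
  have "bij_betw ?e (form_mons n j P) ?X"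
  proof (rule bij_betw_byWitness[where f' = "pm_restrict V"])
    show "\<forall>m\<in>form_mons n j P. pm_restrict V (?e m) = m"
    proof (intro ballI poly_mapping_eqI)
      fix m k assume "m \<in> form_mons n j P"
      then show "Poly_Mapping.lookup (pm_restrict V (?e m)) k = Poly_Mapping.lookup m k"
        using e[of k m] by (auto simp: eq in_keys_iff)
    qed
    show "?e ` form_mons n j P \<subseteq> ?X"
    proof clarify
      fix m assume m: "m \<in> form_mons n j P"
      then have ml: "Poly_Mapping.lookup m l = 0" using l by (auto simp: eq in_keys_iff)
      have "Poly_Mapping.keys (?e m) \<subseteq> insert l V"
        using m by (auto simp: eq keys_add_nat split: if_splits)
      moreover have "int (Poly_Mapping.lookup (?e m) l) = c (?A (?e m))"
      proof -
        have "P (?A m)" using m by (simp add: eq)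
        then have "c (?A m) \<ge> 0" by (simp add: assms(2))
        then have "int (Poly_Mapping.lookup (?e m) l) = c (?A m)" using ml by (simp add: lookup_add)
        moreover have "?A (?e m) = ?A m" by (rule on_V(2)[OF e])
        ultimately show ?thesis by (simp only:)
      qed
      ultimately show "Poly_Mapping.keys (?e m) \<subseteq> insert l V \<and> (\<Sum>k\<in>V. Poly_Mapping.lookup (?e m) k) = j \<and>
          int (Poly_Mapping.lookup (?e m) l) = c (?A (?e m))"
        using on_V(1)[of "?e m" m, OF e] m by (simp add: eq)
    qed
    show "\<forall>m\<in>?X. ?e (pm_restrict V m) = m"
    proof clarify
      fix m assume m: "Poly_Mapping.keys m \<subseteq> insert l V" "int (Poly_Mapping.lookup m l) = c (?A m)"
      have "?A (pm_restrict V m) = ?A m" by (rule on_V(2)[OF r])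
      then have c: "nat (c (?A (pm_restrict V m))) = Poly_Mapping.lookup m l"
        by (simp only: m(2)[symmetric] nat_int)
      show "?e (pm_restrict V m) = m"
        unfolding c using m(1) l
        by (intro poly_mapping_eqI) (auto simp: lookup_add lookup_single when_def in_keys_iff subset_iff)
    qed
    show "pm_restrict V ` ?X \<subseteq> form_mons n j P"
    proof clarify
      fix m assume m: "int (Poly_Mapping.lookup m l) = c (?A m)" "j = (\<Sum>k\<in>V. Poly_Mapping.lookup m k)"
      then have "P (?A m)" unfolding assms(2) by linarith
      moreover have "?A (pm_restrict V m) = ?A m" by (rule on_V(2)[OF r])
      moreover have "(\<Sum>k\<in>V. Poly_Mapping.lookup (pm_restrict V m) k) = j"
        unfolding m(2) by (rule on_V(1)[OF r])
      moreover have "Poly_Mapping.keys (pm_restrict V m) \<subseteq> V"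
        by (auto simp: in_keys_iff split: if_splits)
      ultimately show "pm_restrict V m \<in> form_mons n (\<Sum>k\<in>V. Poly_Mapping.lookup m k) P"
        unfolding eq m(2)[symmetric] mem_Collect_eq by (simp only:)
    qed
  qed
  then show ?thesis unfolding V_def I_def by (rule bij_betw_same_card[symmetric])
qed

lemma bounded_mons_eq: "bounded_mons n j K w = {m. Poly_Mapping.keys m \<subseteq> {0..<2*n+2} \<and>
     (\<Sum>k\<in>{2..<2*n+2}. Poly_Mapping.lookup m k) = j \<and>
     Poly_Mapping.lookup m 0 + Poly_Mapping.lookup m 1 \<le> K \<and>
     int (Poly_Mapping.lookup m 1) - int (Poly_Mapping.lookup m 0) +
       (2 * int (\<Sum>i=1..n. Poly_Mapping.lookup m (hp i)) - int j) = w}"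
  unfolding bounded_mons_def weight_with_vector weight_forms forms_sum by force

text \<open>
  Exchanging a factor \<open>x\<^sub>1\<close> for \<open>x\<^sub>0\<close> matches monomials of weight \<open>2\<close> with monomials of weight \<open>0\<close>. The
  unmatched ones lack one of these two variables, so their number does not depend on the bound \<open>K\<close>
  on the degree in \<open>x\<^sub>0, x\<^sub>1\<close>; hence this degree is at most \<open>j\<close> for every covariant.
\<close>

lemma bij_betw_bounded_mons:
  "bij_betw (\<lambda>m. m - Poly_Mapping.single 1 1 + Poly_Mapping.single 0 1)
    {m \<in> bounded_mons n j K 2. Poly_Mapping.lookup m 1 > 0} {m \<in> bounded_mons n j K 0. Poly_Mapping.lookup m 0 > 0}"
proof -
  define mv where "mv a b m = m - Poly_Mapping.single a 1 + Poly_Mapping.single b 1" for a b :: nat and m :: "nat \<Rightarrow>\<^sub>0 nat"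
  have lk: "Poly_Mapping.lookup (mv a b m) k =
      Poly_Mapping.lookup m k - (if k = a then 1 else 0) + (if k = b then 1 else 0)" for a b m k
    by (simp add: mv_def lookup_add lookup_minus lookup_single when_def)
  have hpi: "hp i \<noteq> 0" "hp i \<noteq> 1" "hp i \<noteq> Suc 0" if "i \<in> {1..n}" for i
    using that by (auto simp: hp_def)
  have sums: "(\<Sum>k\<in>{2..<2*n+2}. Poly_Mapping.lookup (mv a b m) k) = (\<Sum>k\<in>{2..<2*n+2}. Poly_Mapping.lookup m k)"
     "(\<Sum>i=1..n. Poly_Mapping.lookup (mv a b m) (hp i)) = (\<Sum>i=1..n. Poly_Mapping.lookup m (hp i))"
    if "a \<in> {0, 1}" "b \<in> {0, 1}" for a b m
    using that by (auto simp: lk hpi intro!: sum.cong)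
  have keys: "Poly_Mapping.keys (mv a b m) \<subseteq> {0..<2*n+2}"
    if "a \<in> {0, 1}" "b \<in> {0, 1}" "Poly_Mapping.keys m \<subseteq> {0..<2*n+2}" for a b m
    using that by (auto simp: in_keys_iff lk subset_iff split: if_splits)
  show ?thesis
    unfolding mv_def[symmetric]
  proof (rule bij_betw_byWitness[where f' = "mv 0 1"])
    show "\<forall>m\<in>{m \<in> bounded_mons n j K 2. Poly_Mapping.lookup m 1 > 0}. mv 0 1 (mv 1 0 m) = m"
      "\<forall>m\<in>{m \<in> bounded_mons n j K 0. Poly_Mapping.lookup m 0 > 0}. mv 1 0 (mv 0 1 m) = m"
      by (auto intro!: poly_mapping_eqI simp: lk)
    have mv: "mv a b m \<in> bounded_mons n j K w' \<and> Poly_Mapping.lookup (mv a b m) b > 0"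
      if m: "m \<in> bounded_mons n j K w" "Poly_Mapping.lookup m a > 0" and ab: "(a, b, w, w') \<in> {(1, 0, 2, 0), (0, 1, 0, 2)}"
      for a b m w w'
    proof -
      have ab': "a \<in> {0, 1}" "b \<in> {0, 1}" using ab by auto
      note m' = m(1)[unfolded bounded_mons_eq mem_Collect_eq]
      have "Poly_Mapping.keys (mv a b m) \<subseteq> {0..<2*n+2}" by (rule keys[OF ab']) (use m' in blast)
      moreover have "Poly_Mapping.lookup (mv a b m) 0 + Poly_Mapping.lookup (mv a b m) 1 =
          Poly_Mapping.lookup m 0 + Poly_Mapping.lookup m 1"
        and "int (Poly_Mapping.lookup (mv a b m) 1) - int (Poly_Mapping.lookup (mv a b m) 0) =
          int (Poly_Mapping.lookup m 1) - int (Poly_Mapping.lookup m 0) + w' - w"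
        and "Poly_Mapping.lookup (mv a b m) b > 0"
        using ab m(2) by (auto simp: lk)
      ultimately show ?thesis
        unfolding bounded_mons_eq mem_Collect_eq sums[OF ab'] using m' by (intro conjI) linarith+
    qed
    show "mv 1 0 ` {m \<in> bounded_mons n j K 2. Poly_Mapping.lookup m 1 > 0} \<subseteq>
       {m \<in> bounded_mons n j K 0. Poly_Mapping.lookup m 0 > 0}"
      using mv[of _ 2 1 0 0] by blast
    show "mv 0 1 ` {m \<in> bounded_mons n j K 0. Poly_Mapping.lookup m 0 > 0} \<subseteq>
       {m \<in> bounded_mons n j K 2. Poly_Mapping.lookup m 1 > 0}"
      using mv[of _ 0 0 1 2] by blast
  qed
qed

text \<open>The unmatched monomials of weight 0 lack variable 0 and contain variable 1 to the power
  \<open>j - 2 * a\<close>; those of weight 2 lack variable 1 and contain variable 0 to the power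
  \<open>2 * a - j - 2\<close>. Both exponents are at most \<open>j\<close>, so a bound
  \<open>K\<close> of at least \<open>j\<close> does not cut any of them off.\<close>

lemma card_bounded_mons:
  assumes "j \<le> K"
  shows "card (bounded_mons n j K 0) = card (bounded_mons n j K 2) + nmon n (j div 2) * nmon n (j - j div 2)"
proof -
  let ?A = "\<lambda>m. \<Sum>i=1..n. Poly_Mapping.lookup m (hp i)"
  have A: "?A m \<le> j" if "(\<Sum>k\<in>{2..<2*n+2}. Poly_Mapping.lookup m k) = j" for m
    using that unfolding forms_sum by simp
  have split: "card (bounded_mons n j K w) = card {m \<in> bounded_mons n j K w. Poly_Mapping.lookup m l > 0} +
      card {m \<in> bounded_mons n j K w. Poly_Mapping.lookup m l = 0}" for w l
    using finite_bounded_mons[of n j K w]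
    by (subst card_Un_disjoint[symmetric]) (auto intro: arg_cong[of _ _ card])
  have "{m \<in> bounded_mons n j K 0. Poly_Mapping.lookup m 0 = 0} =
     {m. Poly_Mapping.keys m \<subseteq> insert 1 {2..<2*n+2} \<and> (\<Sum>k\<in>{2..<2*n+2}. Poly_Mapping.lookup m k) = j \<and>
      int (Poly_Mapping.lookup m 1) = (\<lambda>a. int j - 2 * int a) (?A m)}" (is "?L = ?R")
  proof (intro equalityI subsetI)
    fix m assume "m \<in> ?L"
    then show "m \<in> ?R"
      unfolding bounded_mons_eq
      by (auto simp: subset_iff in_keys_iff) (metis One_nat_def Suc_1 Suc_leI le_neq_implies_less less_one neq0_conv)
  next
    fix m assume m: "m \<in> ?R"
    then have "int (Poly_Mapping.lookup m 1) = int j - 2 * int (?A m)" by blast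
    then have "Poly_Mapping.lookup m 1 \<le> K" using assms by linarith
    moreover have "Poly_Mapping.lookup m 0 = 0" using m by (auto simp: subset_iff in_keys_iff)
    ultimately show "m \<in> ?L" using m unfolding bounded_mons_eq by auto
  qed
  then have c0: "card {m \<in> bounded_mons n j K 0. Poly_Mapping.lookup m 0 = 0} =
     (\<Sum>a | a \<le> j \<and> int j - 2 * int a \<ge> 0. nmon n a * nmon n (j - a))"
    using card_attach_power[of 1 _ "\<lambda>a. int j - 2 * int a" n j, OF _ refl] by (simp add: card_form_mons)
  have "{m \<in> bounded_mons n j K 2. Poly_Mapping.lookup m 1 = 0} =
     {m. Poly_Mapping.keys m \<subseteq> insert 0 {2..<2*n+2} \<and> (\<Sum>k\<in>{2..<2*n+2}. Poly_Mapping.lookup m k) = j \<and>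
      int (Poly_Mapping.lookup m 0) = (\<lambda>a. 2 * int a - int j - 2) (?A m)}" (is "?L = ?R")
  proof (intro equalityI subsetI)
    fix m assume "m \<in> ?L"
    then show "m \<in> ?R"
      unfolding bounded_mons_eq
      by (auto simp: subset_iff in_keys_iff) (metis One_nat_def Suc_1 Suc_leI le_neq_implies_less less_one neq0_conv)
  next
    fix m assume m: "m \<in> ?R"
    then have "int (Poly_Mapping.lookup m 0) = 2 * int (?A m) - int j - 2" "?A m \<le> j" using A by blast+
    then have "Poly_Mapping.lookup m 0 \<le> K" using assms by linarith
    moreover have "Poly_Mapping.lookup m 1 = 0" using m by (auto simp: subset_iff in_keys_iff)
    ultimately show "m \<in> ?L" using m unfolding bounded_mons_eq by auto
  qed
  then have c2: "card {m \<in> bounded_mons n j K 2. Poly_Mapping.lookup m 1 = 0} =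
     (\<Sum>a | a \<le> j \<and> 2 * int a - int j - 2 \<ge> 0. nmon n a * nmon n (j - a))"
    using card_attach_power[of 0 _ "\<lambda>a. 2 * int a - int j - 2" n j, OF _ refl] by (simp add: card_form_mons)
  \<comment> \<open>The reflection of \<open>a\<close> to \<open>j - a\<close> leaves the summand
    unchanged and makes the two index ranges comparable.\<close>
  have "(\<Sum>a | a \<le> j \<and> 2 * int a - int j - 2 \<ge> 0. nmon n a * nmon n (j - a)) =
     (\<Sum>a | 2 * a + 2 \<le> j. nmon n a * nmon n (j - a))"
    by (rule sum.reindex_bij_witness[of _ "\<lambda>a. j - a" "\<lambda>a. j - a"]) (auto simp: mult.commute)
  \<comment> \<open>The ranges differ by the single index \<open>j div 2\<close>, which therefore
    accounts for the whole difference.\<close>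
  moreover have "{a. a \<le> j \<and> int j - 2 * int a \<ge> 0} = insert (j div 2) {a. 2 * a + 2 \<le> j}"
    by auto
  moreover have "finite {a. 2 * a + 2 \<le> j}" by (rule finite_subset[of _ "{..j}"]) auto
  ultimately have "(\<Sum>a | a \<le> j \<and> int j - 2 * int a \<ge> 0. nmon n a * nmon n (j - a)) =
     (\<Sum>a | a \<le> j \<and> 2 * int a - int j - 2 \<ge> 0. nmon n a * nmon n (j - a)) + nmon n (j div 2) * nmon n (j - j div 2)"
    by simp
  then show ?thesis
    using split[of 0 0] split[of 2 1] bij_betw_same_card[OF bij_betw_bounded_mons[of n j K]] c0 c2 by simp
qed


section \<open>Dimensions of the graded parts\<close>


text \<open>A monomial of the image arises by exchanging one variable \<open>p i\<close> for
  \<open>q i\<close>. The additive form of the equation avoids truncated subtraction of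
  exponents.\<close>

lemma keys_shear:
  assumes "m \<in> Poly_Mapping.keys (shear \<sigma> p q I f)"
  obtains i m' where "i \<in> I" "m' \<in> Poly_Mapping.keys f"
    "m + Poly_Mapping.single (p i) (Suc 0) = m' + Poly_Mapping.single (q i) (Suc 0)"
proof -
  obtain i where i: "i \<in> I" "Poly_Mapping.lookup (cpoly_const (\<sigma> i) * (cvar (q i) * cderiv (p i) f)) m \<noteq> 0"
    using assms unfolding shear_def in_keys_iff lookup_sum by (metis (no_types, lifting) sum.neutral)
  then have nz: "Poly_Mapping.lookup (cvar (q i) * cderiv (p i) f) m \<noteq> 0" by simp
  then have "Poly_Mapping.lookup m (q i) \<noteq> 0" using lookup_mult_cvar_0 by metis
  then obtain n where n: "m = n + Poly_Mapping.single (q i) (Suc 0)" by (rule monomial_split)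
  with nz have "n + Poly_Mapping.single (p i) (Suc 0) \<in> Poly_Mapping.keys f"
    by (simp add: in_keys_iff del: of_nat_Suc)
  moreover have "m + Poly_Mapping.single (p i) (Suc 0) =
      n + Poly_Mapping.single (p i) (Suc 0) + Poly_Mapping.single (q i) (Suc 0)"
    unfolding n by (simp add: ac_simps)
  ultimately show ?thesis using i(1) that by blast
qed

lemma weight_add: "weight p q I (m + m') = weight p q I m + weight p q I m'"
  by (simp add: weight_def lookup_add sum.distrib[symmetric] algebra_simps)

lemma weight_single_hp: "finite I \<Longrightarrow> i \<in> I \<Longrightarrow> weight hp hq I (Poly_Mapping.single (hp i) (Suc 0)) = 1"
  and weight_single_hq: "finite I \<Longrightarrow> i \<in> I \<Longrightarrow> weight hp hq I (Poly_Mapping.single (hq i) (Suc 0)) = - 1"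
proof -
  have [simp]: "int (if P then Suc 0 else 0) = (if P then 1 else 0)" for P by simp
  show "finite I \<Longrightarrow> i \<in> I \<Longrightarrow> weight hp hq I (Poly_Mapping.single (hp i) (Suc 0)) = 1"
    "finite I \<Longrightarrow> i \<in> I \<Longrightarrow> weight hp hq I (Poly_Mapping.single (hq i) (Suc 0)) = - 1"
    by (simp_all add: weight_def lookup_single when_def sum_negf)
qed

lemma sum_single: "finite V \<Longrightarrow> (\<Sum>k\<in>V. Poly_Mapping.lookup (Poly_Mapping.single l (Suc 0)) k) = (if l \<in> V then 1 else 0)"
  by (simp add: lookup_single when_def)

text \<open>The exchanged variables belong to the same vector, so both are coordinates of forms or
  both are coordinates of the plane; neither of the two degrees changes.\<close>

lemma exchange_degrees:
  assumes eq: "m + Poly_Mapping.single x (Suc 0) = m' + Poly_Mapping.single y (Suc 0)"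
    and xy: "(x, y) \<in> {(hp i, hq i), (hq i, hp i)}" and i: "i \<le> n"
  shows "(\<Sum>k\<in>{2..<2*n+2}. Poly_Mapping.lookup m k) = (\<Sum>k\<in>{2..<2*n+2}. Poly_Mapping.lookup m' k)"
    and "Poly_Mapping.lookup m 0 + Poly_Mapping.lookup m 1 = Poly_Mapping.lookup m' 0 + Poly_Mapping.lookup m' 1"
    and "Poly_Mapping.keys m \<subseteq> insert y (Poly_Mapping.keys m')"
proof -
  have V: "x \<in> V \<longleftrightarrow> y \<in> V" if "V = {2..<2*n+2} \<or> V = {0, 1}" for V
    using that xy i by (auto simp: hp_def hq_def split: if_splits)
  have *: "(\<Sum>k\<in>V. Poly_Mapping.lookup m k) = (\<Sum>k\<in>V. Poly_Mapping.lookup m' k)"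
    if "V = {2..<2*n+2} \<or> V = {0, 1}" for V
  proof -
    have "finite V" using that by auto
    have "(\<Sum>k\<in>V. Poly_Mapping.lookup m k) + (if x \<in> V then 1 else 0) =
       (\<Sum>k\<in>V. Poly_Mapping.lookup m' k) + (if y \<in> V then 1 else 0)"
      using arg_cong[OF eq, of "\<lambda>m. \<Sum>k\<in>V. Poly_Mapping.lookup m k"]
      unfolding lookup_add sum.distrib sum_single[OF \<open>finite V\<close>] .
    then show ?thesis unfolding V[OF that] by simp
  qed
  show "(\<Sum>k\<in>{2..<2*n+2}. Poly_Mapping.lookup m k) = (\<Sum>k\<in>{2..<2*n+2}. Poly_Mapping.lookup m' k)"
    by (rule *) simp
  show "Poly_Mapping.lookup m 0 + Poly_Mapping.lookup m 1 = Poly_Mapping.lookup m' 0 + Poly_Mapping.lookup m' 1"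
    using *[of "{0, 1}"] by simp
  show "Poly_Mapping.keys m \<subseteq> insert y (Poly_Mapping.keys m')"
    using arg_cong[OF eq, of Poly_Mapping.keys] by (auto simp: keys_add_nat split: if_splits)
qed

lemma exchange_weight:
  assumes "finite I" "i \<in> I"
  shows "m + Poly_Mapping.single (hp i) (Suc 0) = m' + Poly_Mapping.single (hq i) (Suc 0) \<Longrightarrow>
      weight hp hq I m = weight hp hq I m' - 2"
    and "m + Poly_Mapping.single (hq i) (Suc 0) = m' + Poly_Mapping.single (hp i) (Suc 0) \<Longrightarrow>
      weight hp hq I m = weight hp hq I m' + 2"
  by (drule arg_cong[of _ _ "weight hp hq I"], simp add: weight_add weight_single_hp[OF assms] weight_single_hq[OF assms])+

lemma form_mons_weight:
  "form_mons n j (\<lambda>a. 2 * int a - int j = w) = {m. Poly_Mapping.keys m \<subseteq> {2..<2*n+2} \<and>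
     (\<Sum>k\<in>{2..<2*n+2}. Poly_Mapping.lookup m k) = j \<and> weight hp hq {1..n} m = w}"
  unfolding form_mons_def weight_forms forms_sum by force

lemma graded_degree:
  fixes m :: "nat \<Rightarrow>\<^sub>0 nat"
  assumes "Poly_Mapping.keys m \<subseteq> {0..<2*n+2}"
  shows "(\<Sum>k\<in>Poly_Mapping.keys m - {0, 1}. Poly_Mapping.lookup m k) = (\<Sum>k\<in>{2..<2*n+2}. Poly_Mapping.lookup m k)"
  using assms by (intro sum.mono_neutral_left) (auto simp: in_keys_iff subset_iff)

lemma graded_invariants_eq:
  "graded_part (joint_invariants n) j =
     {f. Poly_Mapping.keys f \<subseteq> form_mons n j (\<lambda>a. 2 * int a - int j = 0) \<and> shear hs hq hp {1..n} f = 0}"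
proof (intro equalityI subsetI)
  fix f assume f: "f \<in> graded_part (joint_invariants n) j"
  then have vars: "cpoly_vars f \<subseteq> {2..<2*n+2}" and inv: "SL2_invariant f"
    and deg: "\<And>m. m \<in> Poly_Mapping.keys f \<Longrightarrow> (\<Sum>k\<in>Poly_Mapping.keys m - {0, 1}. Poly_Mapping.lookup m k) = j"
    by (simp_all add: graded_part_def joint_invariants_def)
  have km: "Poly_Mapping.keys m \<subseteq> {2..<2*n+2}" if "m \<in> Poly_Mapping.keys f" for m
    using vars that by (force simp: cpoly_vars_def)
  have "(\<Sum>k\<in>{2..<2*n+2}. Poly_Mapping.lookup m k) = j" if "m \<in> Poly_Mapping.keys f" for m
  proof -
    have "Poly_Mapping.keys m \<subseteq> {0..<2*n+2}" using km[OF that] by force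
    from graded_degree[OF this] deg[OF that] show ?thesis by (simp only:)
  qed
  moreover have "(\<forall>m\<in>Poly_Mapping.keys f. weight hp hq {1..n} m = 0) \<and> shear hs hq hp {1..n} f = 0"
    using SL2_invariant_iff_shear[of "{1..n}" f] vars inv unfolding forms_decomp by blast
  ultimately show "f \<in> {f. Poly_Mapping.keys f \<subseteq> form_mons n j (\<lambda>a. 2 * int a - int j = 0) \<and> shear hs hq hp {1..n} f = 0}"
    unfolding form_mons_weight using km by blast
next
  fix f assume f: "f \<in> {f. Poly_Mapping.keys f \<subseteq> form_mons n j (\<lambda>a. 2 * int a - int j = 0) \<and> shear hs hq hp {1..n} f = 0}"
  then have m: "Poly_Mapping.keys m \<subseteq> {2..<2*n+2} \<and> (\<Sum>k\<in>{2..<2*n+2}. Poly_Mapping.lookup m k) = j \<and>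
       weight hp hq {1..n} m = 0" if "m \<in> Poly_Mapping.keys f" for m
    using that unfolding form_mons_weight by blast
  have vars: "cpoly_vars f \<subseteq> {2..<2*n+2}"
    using m unfolding cpoly_vars_def by blast
  then have "SL2_invariant f"
    using SL2_invariant_iff_shear[of "{1..n}" f] m f unfolding forms_decomp by blast
  moreover have "(\<Sum>k\<in>Poly_Mapping.keys m - {0, 1}. Poly_Mapping.lookup m k) = j" if "m \<in> Poly_Mapping.keys f" for m
  proof -
    have "Poly_Mapping.keys m \<subseteq> {0..<2*n+2}" using m[OF that] by force
    from graded_degree[OF this] m[OF that] show ?thesis by (simp only:)
  qed
  ultimately show "f \<in> graded_part (joint_invariants n) j"
    using vars unfolding graded_part_def joint_invariants_def by blast
qed

lemma dim_graded_invariants: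
  "cpoly_dim (graded_part (joint_invariants n) j) + card (form_mons n j (\<lambda>a. 2 * int a - int j = 2)) =
     card (form_mons n j (\<lambda>a. 2 * int a - int j = 0))"
  unfolding graded_invariants_eq
proof (rule dim_kernel_shear)
  fix m assume "m \<in> form_mons n j (\<lambda>a. 2 * int a - int j = 2)"
  then show "weight hp hq {1..n} m = 2" unfolding form_mons_weight by blast
next
  fix f :: "nat cpoly" assume f: "Poly_Mapping.keys f \<subseteq> form_mons n j (\<lambda>a. 2 * int a - int j = 0)"
  show "Poly_Mapping.keys (shear hs hq hp {1..n} f) \<subseteq> form_mons n j (\<lambda>a. 2 * int a - int j = 2)"
  proof
    fix m assume "m \<in> Poly_Mapping.keys (shear hs hq hp {1..n} f)"
    then obtain i m' where i: "i \<in> {1..n}" and m': "m' \<in> Poly_Mapping.keys f"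
      and eq: "m + Poly_Mapping.single (hq i) (Suc 0) = m' + Poly_Mapping.single (hp i) (Suc 0)"
      by (rule keys_shear)
    have y: "hp i \<in> {2..<2*n+2}" using i by (auto simp: hp_def)
    have xy: "(hq i, hp i) \<in> {(hp i, hq i), (hq i, hp i)}" "i \<le> n" using i by simp_all
      note e = exchange_degrees[OF eq xy]
      have w: "weight hp hq {1..n} m = weight hp hq {1..n} m' + 2"
        by (rule exchange_weight(2)[OF _ i eq]) simp
      show "m \<in> form_mons n j (\<lambda>a. 2 * int a - int j = 2)"
      using subsetD[OF f m'] e(3) y
        unfolding form_mons_weight mem_Collect_eq e(1) e(2) w by auto
  qed
next
  fix f :: "nat cpoly" assume f: "Poly_Mapping.keys f \<subseteq> form_mons n j (\<lambda>a. 2 * int a - int j = 2)"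
  show "Poly_Mapping.keys (shear hs hp hq {1..n} f) \<subseteq> form_mons n j (\<lambda>a. 2 * int a - int j = 0)"
  proof
    fix m assume "m \<in> Poly_Mapping.keys (shear hs hp hq {1..n} f)"
    then obtain i m' where i: "i \<in> {1..n}" and m': "m' \<in> Poly_Mapping.keys f"
      and eq: "m + Poly_Mapping.single (hp i) (Suc 0) = m' + Poly_Mapping.single (hq i) (Suc 0)"
      by (rule keys_shear)
    have y: "hq i \<in> {2..<2*n+2}" using i by (auto simp: hq_def)
    have xy: "(hp i, hq i) \<in> {(hp i, hq i), (hq i, hp i)}" "i \<le> n" using i by simp_all
      note e = exchange_degrees[OF eq xy]
      have w: "weight hp hq {1..n} m = weight hp hq {1..n} m' - 2"
        by (rule exchange_weight(1)[OF _ i eq]) simp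
      show "m \<in> form_mons n j (\<lambda>a. 2 * int a - int j = 0)"
      using subsetD[OF f m'] e(3) y
        unfolding form_mons_weight mem_Collect_eq e(1) e(2) w by auto
  qed
qed (simp_all add: hs_def finite_form_mons)

lemma all_decomp: "{0..<2*n+2} = hp ` {0..n} \<union> hq ` {0..n}"
proof -
  have "k \<in> hp ` {0..n} \<union> hq ` {0..n}" if "k \<in> {0..<2*n+2}" for k
    using hp_hq_cases[of k] that by force
  moreover have "k \<in> {0..<2*n+2}" if "k \<in> hp ` {0..n} \<union> hq ` {0..n}" for k
    using that by (auto simp: hp_def hq_def split: if_splits)
  ultimately show ?thesis by blast
qed

text \<open>The grading does not restrict the degree in the variables 0 and 1, but a single
  polynomial has finitely many monomials and thus satisfies some bound \<open>K\<close>.\<close>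

lemma graded_covariants_eq:
  "graded_part (joint_covariants n) j =
     (\<Union>K. {f. Poly_Mapping.keys f \<subseteq> bounded_mons n j K 0 \<and> shear hs hq hp {0..n} f = 0})"
proof (intro equalityI subsetI)
  fix f assume f: "f \<in> graded_part (joint_covariants n) j"
  then have vars: "cpoly_vars f \<subseteq> {0..<2*n+2}" and inv: "SL2_invariant f"
    and deg: "\<And>m. m \<in> Poly_Mapping.keys f \<Longrightarrow> (\<Sum>k\<in>Poly_Mapping.keys m - {0, 1}. Poly_Mapping.lookup m k) = j"
    by (simp_all add: graded_part_def joint_covariants_def)
  have km: "Poly_Mapping.keys m \<subseteq> {0..<2*n+2}" if "m \<in> Poly_Mapping.keys f" for m
    using vars that by (force simp: cpoly_vars_def)
  have "(\<Sum>k\<in>{2..<2*n+2}. Poly_Mapping.lookup m k) = j" if "m \<in> Poly_Mapping.keys f" for m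
    using graded_degree[OF km[OF that]] deg[OF that] by (simp only:)
  moreover have "(\<forall>m\<in>Poly_Mapping.keys f. weight hp hq {0..n} m = 0) \<and> shear hs hq hp {0..n} f = 0"
    using SL2_invariant_iff_shear[of "{0..n}" f] vars inv unfolding all_decomp by blast
  moreover obtain K where "\<And>m. m \<in> Poly_Mapping.keys f \<Longrightarrow> Poly_Mapping.lookup m 0 + Poly_Mapping.lookup m 1 \<le> K"
    using finite_imageI[OF finite_keys[of f], of "\<lambda>m. Poly_Mapping.lookup m 0 + Poly_Mapping.lookup m 1"]
    unfolding finite_nat_set_iff_bounded_le by blast
  ultimately have "f \<in> {f. Poly_Mapping.keys f \<subseteq> bounded_mons n j K 0 \<and> shear hs hq hp {0..n} f = 0}"
    unfolding bounded_mons_def using km by blast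
  then show "f \<in> (\<Union>K. {f. Poly_Mapping.keys f \<subseteq> bounded_mons n j K 0 \<and> shear hs hq hp {0..n} f = 0})" by blast
next
  fix f assume "f \<in> (\<Union>K. {f. Poly_Mapping.keys f \<subseteq> bounded_mons n j K 0 \<and> shear hs hq hp {0..n} f = 0})"
  then obtain K where f: "Poly_Mapping.keys f \<subseteq> bounded_mons n j K 0" "shear hs hq hp {0..n} f = 0" by blast
  then have m: "Poly_Mapping.keys m \<subseteq> {0..<2*n+2} \<and> (\<Sum>k\<in>{2..<2*n+2}. Poly_Mapping.lookup m k) = j \<and>
       weight hp hq {0..n} m = 0" if "m \<in> Poly_Mapping.keys f" for m
    using that unfolding bounded_mons_def by blast
  have vars: "cpoly_vars f \<subseteq> {0..<2*n+2}"
    using m unfolding cpoly_vars_def by blast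
  then have "SL2_invariant f"
    using SL2_invariant_iff_shear[of "{0..n}" f] m f unfolding all_decomp by blast
  moreover have "(\<Sum>k\<in>Poly_Mapping.keys m - {0, 1}. Poly_Mapping.lookup m k) = j" if "m \<in> Poly_Mapping.keys f" for m
    using graded_degree[of m n] m[OF that] by (simp only:)
  ultimately show "f \<in> graded_part (joint_covariants n) j"
    using vars unfolding graded_part_def joint_covariants_def by blast
qed

lemma dim_bounded_covariants:
  assumes "j \<le> K"
  shows "cpoly_dim {f. Poly_Mapping.keys f \<subseteq> bounded_mons n j K 0 \<and> shear hs hq hp {0..n} f = 0} =
     nmon n (j div 2) * nmon n (j - j div 2)"
proof -
  have "cpoly_dim {f. Poly_Mapping.keys f \<subseteq> bounded_mons n j K 0 \<and> shear hs hq hp {0..n} f = 0} +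
     card (bounded_mons n j K 2) = card (bounded_mons n j K 0)"
  proof (rule dim_kernel_shear)
    fix m assume "m \<in> bounded_mons n j K 2"
    then show "weight hp hq {0..n} m = 2" unfolding bounded_mons_def by blast
  next
    fix f :: "nat cpoly" assume f: "Poly_Mapping.keys f \<subseteq> bounded_mons n j K 0"
    show "Poly_Mapping.keys (shear hs hq hp {0..n} f) \<subseteq> bounded_mons n j K 2"
    proof
      fix m assume "m \<in> Poly_Mapping.keys (shear hs hq hp {0..n} f)"
      then obtain i m' where i: "i \<in> {0..n}" and m': "m' \<in> Poly_Mapping.keys f"
        and eq: "m + Poly_Mapping.single (hq i) (Suc 0) = m' + Poly_Mapping.single (hp i) (Suc 0)"
        by (rule keys_shear)
      have y: "hp i \<in> {0..<2*n+2}" using i unfolding all_decomp by blast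
      have xy: "(hq i, hp i) \<in> {(hp i, hq i), (hq i, hp i)}" "i \<le> n" using i by simp_all
      note e = exchange_degrees[OF eq xy]
      have w: "weight hp hq {0..n} m = weight hp hq {0..n} m' + 2"
        by (rule exchange_weight(2)[OF _ i eq]) simp
      show "m \<in> bounded_mons n j K 2"
        using subsetD[OF f m'] e(3) y
        unfolding bounded_mons_def mem_Collect_eq e(1) e(2) w by auto
    qed
  next
    fix f :: "nat cpoly" assume f: "Poly_Mapping.keys f \<subseteq> bounded_mons n j K 2"
    show "Poly_Mapping.keys (shear hs hp hq {0..n} f) \<subseteq> bounded_mons n j K 0"
    proof
      fix m assume "m \<in> Poly_Mapping.keys (shear hs hp hq {0..n} f)"
      then obtain i m' where i: "i \<in> {0..n}" and m': "m' \<in> Poly_Mapping.keys f"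
        and eq: "m + Poly_Mapping.single (hp i) (Suc 0) = m' + Poly_Mapping.single (hq i) (Suc 0)"
        by (rule keys_shear)
      have y: "hq i \<in> {0..<2*n+2}" using i unfolding all_decomp by blast
      have xy: "(hp i, hq i) \<in> {(hp i, hq i), (hq i, hp i)}" "i \<le> n" using i by simp_all
      note e = exchange_degrees[OF eq xy]
      have w: "weight hp hq {0..n} m = weight hp hq {0..n} m' - 2"
        by (rule exchange_weight(1)[OF _ i eq]) simp
      show "m \<in> bounded_mons n j K 0"
        using subsetD[OF f m'] e(3) y
        unfolding bounded_mons_def mem_Collect_eq e(1) e(2) w by auto
    qed
  qed (simp_all add: hs_def finite_bounded_mons)
  then show ?thesis using card_bounded_mons[OF assms, of n] by simp
qed

text \<open>A vector of \<open>T\<close> outside \<open>S\<close> would extend a basis of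
  \<open>S\<close> to an independent subset of \<open>T\<close> with more than \<open>dim T\<close>
  elements.\<close>

lemma (in vector_space) subset_if_dim_eq:
  assumes "S \<subseteq> T" "subspace S" "T \<subseteq> span F" "finite F" "dim S = dim T"
  shows "T \<subseteq> S"
proof
  fix y assume y: "y \<in> T"
  obtain B where B: "B \<subseteq> S" "independent B" "S \<subseteq> span B" "card B = dim S" by (rule basis_exists)
  obtain C where C: "C \<subseteq> T" "independent C" "T \<subseteq> span C" "card C = dim T" by (rule basis_exists)
  have finC: "finite C" using independent_span_bound[OF assms(4) C(2)] C(1) assms(3) by auto
  have finB: "finite B" using independent_span_bound[OF assms(4) B(2)] B(1) assms(1,3) by auto
  show "y \<in> S"
  proof (rule ccontr)
    assume "y \<notin> S"
    moreover have "span B \<subseteq> S" using B(1) assms(2) by (rule span_minimal)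
    ultimately have yB: "y \<notin> span B" by auto
    then have "independent (insert y B)" using B(2) by (rule independent_insertI)
    then have "card (insert y B) \<le> card C"
      using independent_span_bound[OF finC, of "insert y B"] y C(3) B(1) assms(1) by auto
    moreover have "y \<notin> B" using yB span_base by auto
    ultimately show False using finB B(4) C(4) assms(5) by simp
  qed
qed

text \<open>The pieces \<open>G K\<close> increase with \<open>K\<close> but have the same dimension
  from \<open>K = j\<close> on. Hence they are stationary there, and the union over all
  \<open>K\<close> is \<open>G j\<close>.\<close>

lemma dim_graded_covariants:
  "cpoly_dim (graded_part (joint_covariants n) j) = nmon n (j div 2) * nmon n (j - j div 2)"
proof -
  define G where "G K = {f. Poly_Mapping.keys f \<subseteq> bounded_mons n j K 0 \<and> shear hs hq hp {0..n} f = 0}" for K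
  have mono: "G K \<subseteq> G K'" if "K \<le> K'" for K K'
    using that unfolding G_def bounded_mons_def by force
  have "cpoly.subspace (G K)" for K
  proof (rule cpoly.subspaceI)
    show "x + y \<in> G K" if "x \<in> G K" "y \<in> G K" for x y
      using that keys_add[of x y] by (auto simp: G_def shear_add)
    show "cpoly_const c * x \<in> G K" if "x \<in> G K" for c x
      using that by (auto simp: G_def shear_scale subset_iff in_keys_iff)
  qed (simp add: G_def)
  moreover have "G K \<subseteq> cpoly.span (monomials (bounded_mons n j K 0))" for K
    by (auto simp: span_monomials G_def)
  moreover have "cpoly_dim (G j) = cpoly_dim (G K)" if "j \<le> K" for K
    using that by (simp add: G_def dim_bounded_covariants)
  ultimately have "G K \<subseteq> G j" if "j \<le> K" for K
    using cpoly.subset_if_dim_eq[OF mono[OF that]] that finite_bounded_mons unfolding monomials_def by blast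
  then have "(\<Union>K. G K) = G j" using mono by (meson UN_least UN_upper UNIV_I linear order_trans subset_antisym)
  then show ?thesis
    unfolding graded_covariants_eq G_def[symmetric] by (simp add: G_def dim_bounded_covariants)
qed


section \<open>Poincare series\<close>


text \<open>Monic of degree \<open>Suc b - a\<close>. Lower bound 1 gives binomial coefficients up
  to a factorial; lower bound 2 occurs as the factor shared with the shifted argument.\<close>

definition rising_poly :: "nat \<Rightarrow> nat \<Rightarrow> complex poly" where
  "rising_poly a b = (\<Prod>i=a..b. [:of_nat i, 1:])"

lemma rising_poly_degree: "degree (rising_poly a b) = Suc b - a"
  unfolding rising_poly_def by (subst degree_prod_eq_sum_degree) auto

lemma rising_poly_lead: "lead_coeff (rising_poly a b) = 1"
  unfolding rising_poly_def lead_coeff_prod by simp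

lemma poly_rising_poly: "poly (rising_poly a b) x = (\<Prod>i=a..b. of_nat i + x)"
  by (simp add: rising_poly_def poly_prod)

lemma rising_poly_binomial:
  "poly (rising_poly (Suc 0) D) (of_nat d) = fact D * of_nat ((d + D) choose D)"
proof (induction D)
  case (Suc D)
  have "of_nat (Suc D) * of_nat ((d + Suc D) choose Suc D) = of_nat (d + Suc D) * (of_nat ((d + D) choose D) :: complex)"
    unfolding of_nat_mult[symmetric] using Suc_times_binomial_eq[of "d + D" D] by (simp del: of_nat_mult add: mult.commute)
  moreover have "poly (rising_poly (Suc 0) (Suc D)) (of_nat d) =
      poly (rising_poly (Suc 0) D) (of_nat d) * (of_nat (d + Suc D) :: complex)"
    by (simp add: poly_rising_poly algebra_simps)
  ultimately show ?case using Suc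
    by (simp del: binomial_Suc_Suc of_nat_Suc add: mult_ac)
qed (simp add: poly_rising_poly)

lemma fps_binomial_series:
  "(1 - fps_X) ^ Suc D * Abs_fps (\<lambda>d. of_nat ((d + D) choose D)) = (1 :: complex fps)"
proof (induction D)
  case 0
  show ?case by (rule fps_ext) (simp add: left_diff_distrib fps_X_mult_nth)
next
  case (Suc D)
  have "(1 - fps_X) * Abs_fps (\<lambda>d. of_nat ((d + Suc D) choose Suc D)) =
      (Abs_fps (\<lambda>d. of_nat ((d + D) choose D)) :: complex fps)"
  proof (rule fps_ext)
    fix d
    show "((1 - fps_X) * Abs_fps (\<lambda>d. of_nat ((d + Suc D) choose Suc D))) $ d =
      (Abs_fps (\<lambda>d. of_nat ((d + D) choose D)) :: complex fps) $ d"
      by (cases d) (simp_all add: left_diff_distrib)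
  qed
  then show ?case using Suc by (simp only: power_Suc2[of _ "Suc D"] mult.assoc)
qed

lemma fps_of_poly_one_minus_X: "fps_of_poly [:1, -1:] = (1 - fps_X :: complex fps)"
  by (simp add: fps_of_poly_pCons)

text \<open>Binomial coefficients have the series 1 / (1 - X)^(D + 1); subtracting a multiple of
  them lowers the degree. Using \<open>coeff f D\<close> instead of the leading coefficient admits
  polynomials of smaller degree, in particular the zero polynomial for invariants of odd
  degree.\<close>

lemma polynomial_sequence_series:
  fixes f :: "complex poly"
  assumes "degree f \<le> D"
  shows "\<exists>P. (1 - fps_X) ^ Suc D * Abs_fps (\<lambda>d. poly f (of_nat d)) = fps_of_poly P \<and>
     poly P 1 = coeff f D * fact D"
  using assms
proof (induction D arbitrary: f)
  case 0
  then obtain c where c: "f = [:c:]" using degree_eq_zeroE by blast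
  have "(1 - fps_X) * Abs_fps (\<lambda>d. c) = fps_const c"
    by (rule fps_ext) (simp add: left_diff_distrib fps_X_mult_nth)
  then show ?case by (intro exI[of _ "[:c:]"]) (simp add: c)
next
  case (Suc D)
  define c where "c = coeff f (Suc D)"
  \<comment> \<open>The subtracted multiple cancels the top coefficient. The series of the rest then
    needs one factor 1 - X less, so its contribution to the numerator vanishes at 1.\<close>
  define g where "g = f - smult c (rising_poly (Suc 0) (Suc D))"
  have "coeff g i = 0" if "i > D" for i
  proof (cases "i = Suc D")
    case True
    then show ?thesis using rising_poly_lead[of "Suc 0" "Suc D"] by (simp add: g_def c_def rising_poly_degree)
  next
    case False
    then show ?thesis using that Suc.prems
      by (simp add: g_def coeff_eq_0 rising_poly_degree)
  qed
  then have "degree g \<le> D" by (intro degree_le) auto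
  from Suc.IH[OF this] obtain P where P: "(1 - fps_X) ^ Suc D * Abs_fps (\<lambda>d. poly g (of_nat d)) = fps_of_poly P"
    by blast
  have "Abs_fps (\<lambda>d. poly f (of_nat d)) = Abs_fps (\<lambda>d. poly g (of_nat d)) +
      fps_const (c * fact (Suc D)) * Abs_fps (\<lambda>d. of_nat ((d + Suc D) choose Suc D))"
    by (rule fps_ext) (simp only: g_def poly_diff poly_smult rising_poly_binomial fps_add_nth fps_mult_left_const_nth fps_nth_Abs_fps, simp)
  then have "(1 - fps_X) ^ Suc (Suc D) * Abs_fps (\<lambda>d. poly f (of_nat d)) =
     (1 - fps_X) * ((1 - fps_X) ^ Suc D * Abs_fps (\<lambda>d. poly g (of_nat d))) + fps_const (c * fact (Suc D)) *
       ((1 - fps_X) ^ Suc (Suc D) * Abs_fps (\<lambda>d. of_nat ((d + Suc D) choose Suc D)))"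
    by (simp only: distrib_left power_Suc[of _ "Suc D"] mult_ac)
  also have "\<dots> = fps_of_poly ([:1, -1:] * P + [:c * fact (Suc D):])"
    unfolding fps_binomial_series P by (simp add: fps_of_poly_mult fps_of_poly_add fps_of_poly_one_minus_X del: fact_Suc)
  finally show ?case
    by (intro exI[of _ "[:1, -1:] * P + [:c * fact (Suc D):]"]) (simp add: c_def)
qed

lemma fps_compose_X_square_nth:
  "(F oo fps_X ^ 2) $ j = (if even j then F $ (j div 2) else (0 :: complex))"
proof -
  have "(F oo fps_X ^ 2) $ j = (\<Sum>i\<in>{0..j}. if 2 * i = j then F $ i else 0)"
    by (auto simp: fps_compose_nth power_mult[symmetric] intro!: sum.cong)
  also have "\<dots> = (if even j then F $ (j div 2) else 0)"
  proof (cases "even j")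
    case True
    then have "(\<Sum>i\<in>{0..j}. if 2 * i = j then F $ i else 0) = (\<Sum>i\<in>{0..j}. if i = j div 2 then F $ i else 0)"
      by (intro sum.cong) auto
    then show ?thesis using True by simp
  qed (auto intro!: sum.neutral)
  finally show ?thesis .
qed

text \<open>The series is the even part, a function of the square of z, plus z times another such
  function, with common denominator (1 - z^2)^(D + 1). The factor (1 - z)^(D + 1) cancels when the
  transcendence degree is \<open>Suc D\<close>, and (1 + z)^(D + 1) tends to the power of 2.\<close>

lemma has_algebra_degreeI:
  fixes f h :: "complex poly"
  assumes r: "has_transcendence_degree (quotient_field R) (Suc D)"
    and deg: "degree f \<le> D" "degree h \<le> D"
    and even: "\<And>d. of_nat (cpoly_dim (graded_part R (2 * d))) = poly f (of_nat d)"
    and odd: "\<And>d. of_nat (cpoly_dim (graded_part R (2 * d + 1))) = poly h (of_nat d)"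
  shows "has_algebra_degree R ((coeff f D + coeff h D) * fact D / 2 ^ Suc D)"
proof -
  define F where "F f = Abs_fps (\<lambda>d. poly f (of_nat d) :: complex)" for f
  obtain P where P: "(1 - fps_X) ^ Suc D * F f = fps_of_poly P" "poly P 1 = coeff f D * fact D"
    using polynomial_sequence_series[OF deg(1)] F_def by auto
  obtain Q where Q: "(1 - fps_X) ^ Suc D * F h = fps_of_poly Q" "poly Q 1 = coeff h D * fact D"
    using polynomial_sequence_series[OF deg(2)] F_def by auto
  let ?X2 = "[:0, 0, 1:] :: complex poly"
  let ?q = "[:1, 0, -1:] ^ Suc D :: complex poly"
  have X2: "fps_of_poly ?X2 = fps_X ^ 2"
    by (rule fps_ext) (auto simp: fps_of_poly_pCons power2_eq_square)
  have q: "fps_of_poly ?q = (1 - fps_X) ^ Suc D oo fps_X ^ 2"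
  proof -
    have "fps_of_poly [:1, 0, -1:] = (1 - fps_X oo fps_X ^ 2 :: complex fps)"
      by (simp add: fps_compose_sub_distrib fps_of_poly_pCons power2_eq_square)
    then show ?thesis by (simp only: fps_of_poly_power) (simp add: fps_compose_power del: power_Suc)
  qed
  have S: "poincare_series R = (F f oo fps_X ^ 2) + fps_X * (F h oo fps_X ^ 2)"
  proof (rule fps_ext)
    fix j
    show "poincare_series R $ j = ((F f oo fps_X ^ 2) + fps_X * (F h oo fps_X ^ 2)) $ j"
      using even[of "j div 2"] odd[of "j div 2"]
      by (cases j) (auto simp: poincare_series_def F_def fps_compose_X_square_nth elim!: evenE oddE)
  qed
  let ?p = "pcompose P ?X2 + [:0, 1:] * pcompose Q ?X2"
  have "fps_of_poly ?q * poincare_series R = fps_of_poly ?p"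
  proof -
    have "((1 - fps_X) ^ Suc D oo fps_X ^ 2) * (G oo fps_X ^ 2) = ((1 - fps_X) ^ Suc D * G) oo fps_X ^ 2" for G :: "complex fps"
      by (rule fps_compose_mult_distrib[symmetric]) simp
    then have "fps_of_poly ?q * poincare_series R = (fps_of_poly P oo fps_X ^ 2) + fps_X * (fps_of_poly Q oo fps_X ^ 2)"
      unfolding S q distrib_left mult.left_commute[of _ fps_X] P(1)[symmetric] Q(1)[symmetric] by (simp only:)
    also have "\<dots> = fps_of_poly ?p"
      by (simp only: fps_of_poly_add fps_of_poly_mult fps_of_poly_fps_X)
        (simp add: fps_of_poly_pcompose X2 del: pcompose_pCons)
    finally show ?thesis .
  qed
  moreover have "((\<lambda>z. (1 - z) ^ Suc D * (poly ?p z / poly ?q z)) \<longlongrightarrow>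
      (coeff f D + coeff h D) * fact D / 2 ^ Suc D) (at 1)"
  proof -
    have "((\<lambda>z. poly ?p z / (1 + z) ^ Suc D) \<longlongrightarrow> poly ?p 1 / (1 + 1) ^ Suc D) (at 1)"
      by (intro tendsto_intros) auto
    also have "poly ?p 1 / (1 + 1) ^ Suc D = (coeff f D + coeff h D) * fact D / 2 ^ Suc D"
      by (simp add: poly_pcompose P(2) Q(2) algebra_simps)
    finally show ?thesis
    proof (rule Lim_transform_eventually)
      have "\<forall>\<^sub>F z in at 1. z \<noteq> (1::complex)" by (simp add: eventually_at_filter)
      then show "\<forall>\<^sub>F z in at 1. poly ?p z / (1 + z) ^ Suc D = (1 - z) ^ Suc D * (poly ?p z / poly ?q z)"
      proof eventually_elim
        case (elim z)
        have "poly ?q z = (1 - z) ^ Suc D * (1 + z) ^ Suc D"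
          by (simp only: poly_power power_mult_distrib[symmetric]) (simp add: algebra_simps)
        then show ?case using elim by simp
      qed
    qed
  qed
  moreover have "?q \<noteq> 0" unfolding power_eq_0_iff by simp
  ultimately show ?thesis
    unfolding has_algebra_degree_def using r by blast
qed

section \<open>Dimensions as polynomials in the degree\<close>

lemma nmon_rising_poly:
  assumes "n \<ge> 1"
  shows "of_nat (nmon n d) = poly (rising_poly (Suc 0) (n - 1)) (of_nat d) / fact (n - 1)"
proof -
  have "nmon n d = (d + (n - 1)) choose (n - 1)"
    using assms binomial_symmetric[of d "n + d - 1"] by (simp add: nmon_def add.commute)
  then show ?thesis by (simp add: rising_poly_binomial)
qed

lemma rising_poly_shift:
  assumes "b \<ge> 1"
  shows "poly (rising_poly (Suc 0) b) (x + 1) = poly (rising_poly 2 b) x * (x + of_nat b + 1)"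
proof -
  have "poly (rising_poly (Suc 0) b) (x + 1) = (\<Prod>i=1..b. of_nat (Suc i) + x)"
    unfolding poly_rising_poly by (intro prod.cong) simp_all
  also have "\<dots> = (\<Prod>i=2..Suc b. of_nat i + x)"
    using prod.shift_bounds_cl_Suc_ivl[of "\<lambda>i. of_nat i + x" 1 b] by (simp add: numeral_2_eq_2)
  finally show ?thesis using assms by (simp add: poly_rising_poly algebra_simps)
qed

lemma rising_poly_first: "b \<ge> 1 \<Longrightarrow> poly (rising_poly (Suc 0) b) x = (1 + x) * poly (rising_poly 2 b) x"
  by (simp add: poly_rising_poly prod.atLeast_Suc_atMost numeral_2_eq_2)

lemma dim_graded_covariants_even:
  assumes "n \<ge> 1"
  shows "of_nat (cpoly_dim (graded_part (joint_covariants n) (2 * d))) =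
     poly (smult (1 / (fact (n - 1))\<^sup>2) (rising_poly (Suc 0) (n - 1) * rising_poly (Suc 0) (n - 1))) (of_nat d)"
  using assms by (simp add: dim_graded_covariants nmon_rising_poly power2_eq_square)

lemma dim_graded_covariants_odd:
  assumes "n \<ge> 1"
  shows "of_nat (cpoly_dim (graded_part (joint_covariants n) (2 * d + 1))) =
     poly (smult (1 / (fact (n - 1))\<^sup>2) (rising_poly (Suc 0) (n - 1) * rising_poly 2 n)) (of_nat d)"
proof -
  have "(2 * d + 1) div 2 = d" "2 * d + 1 - d = d + 1" by auto
  then have "of_nat (cpoly_dim (graded_part (joint_covariants n) (2 * d + 1))) =
    (poly (rising_poly (Suc 0) (n - 1)) (of_nat d) * poly (rising_poly (Suc 0) (n - 1)) (of_nat d + 1)) / (fact (n - 1))\<^sup>2"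
    unfolding dim_graded_covariants using assms nmon_rising_poly[OF assms, of "d + 1"]
    by (simp add: nmon_rising_poly power2_eq_square add.commute)
  \<comment> \<open>Shifting the argument by one turns the factors with constants 1 to
    \<open>n - 1\<close> into those with constants 2 to \<open>n\<close>; for \<open>n = 1\<close>
    both products are empty.\<close>
  moreover have "poly (rising_poly (Suc 0) (n - 1)) (of_nat d + 1) = poly (rising_poly 2 n) (of_nat d)"
  proof (cases "n = 1")
    case True
    then show ?thesis by (simp add: poly_rising_poly)
  next
    case False
    then have "n \<ge> 2" using assms by simp
    then show ?thesis using rising_poly_shift[of "n - 1" "of_nat d"]
      by (cases n) (auto simp: poly_rising_poly algebra_simps)
  qed
  ultimately show ?thesis by simp
qed

text \<open>The weight has the parity of the degree, so no monomial of odd degree in the forms has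
  weight 0.\<close>

lemma dim_graded_invariants_odd:
  "cpoly_dim (graded_part (joint_invariants n) (2 * d + 1)) = 0"
proof -
  have "{a. a \<le> 2 * d + 1 \<and> 2 * int a - int (2 * d + 1) = 0} = {}"
    by (auto, presburger)
  then have "card (form_mons n (2 * d + 1) (\<lambda>a. 2 * int a - int (2 * d + 1) = 0)) = 0"
    by (subst card_form_mons) (simp only: sum.empty)
  then show ?thesis using dim_graded_invariants[of n "2 * d + 1"] by (simp only: add_is_0)
qed

text \<open>Up to the factor 1 / (n - 1)!, g(d) is both (d + 1) A and (d + n - 1) B, while g(d + 1)
  is (d + n) A and g(d - 1) is d B. The cancellation is (d + 1)(d + n - 1) - d (d + n) = n -
  1.\<close>

lemma dim_graded_invariants_even:
  assumes "n \<ge> 3"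
  shows "of_nat (cpoly_dim (graded_part (joint_invariants n) (2 * d))) =
     poly (smult (of_nat (n - 1) / (fact (n - 1))\<^sup>2) (rising_poly 2 (n - 1) * rising_poly (Suc 0) (n - 2))) (of_nat d)"
proof -
  obtain m where n: "n = m + 2" "m \<ge> 1"
    using assms by (intro that[of "n - 2"]) auto
  have n1: "n - 1 = Suc m" and n2: "n - 2 = m" using n by simp_all
  have 0: "{a. a \<le> 2 * d \<and> 2 * int a - int (2 * d) = 0} = {d}" by auto
  \<comment> \<open>For \<open>d = 0\<close> the index \<open>d + 1\<close> exceeds the degree, so
    no monomial has weight 2. The uniform formula agrees because it carries a factor d.\<close>
  have 2: "{a. a \<le> 2 * d \<and> 2 * int a - int (2 * d) = 2} = (if d = 0 then {} else {d + 1})" by auto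
  let ?A = "poly (rising_poly 2 (n - 1)) (of_nat d)" and ?B = "poly (rising_poly (Suc 0) (n - 2)) (of_nat d)"
  have q1: "of_nat (nmon n d) = (1 + of_nat d) * ?A / fact (n - 1)"
    using assms rising_poly_first[of "n - 1" "of_nat d"] by (simp add: nmon_rising_poly)
  have q2: "of_nat (nmon n d) = (of_nat (n - 1) + of_nat d) * ?B / fact (n - 1)"
  proof -
    have "poly (rising_poly (Suc 0) (Suc m)) (of_nat d) =
        (of_nat (Suc m) + of_nat d) * poly (rising_poly (Suc 0) m) (of_nat d :: complex)"
      by (simp add: poly_rising_poly)
    moreover have "of_nat (nmon n d) = poly (rising_poly (Suc 0) (n - 1)) (of_nat d) / (fact (n - 1) :: complex)"
      using assms by (intro nmon_rising_poly) simp
    ultimately show ?thesis unfolding n1 n2 by (simp only:)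
  qed
  have q3: "of_nat (nmon n (d + 1)) = (of_nat d + of_nat (n - 1) + 1) * ?A / fact (n - 1)"
  proof -
    have "of_nat (nmon n (d + 1)) = poly (rising_poly (Suc 0) (n - 1)) (of_nat (d + 1)) / (fact (n - 1) :: complex)"
      using assms by (intro nmon_rising_poly) simp
    then show ?thesis using rising_poly_shift[of "Suc m" "of_nat d"] unfolding n1
      by (simp add: ac_simps)
  qed
  have q4: "of_nat (nmon n (d - 1)) = of_nat d * ?B / fact (n - 1)" if "d > 0"
  proof -
    obtain e where d: "d = Suc e" using \<open>d > 0\<close> by (cases d) auto
    have "poly (rising_poly (Suc 0) (Suc m)) (of_nat e) =
        (1 + of_nat e) * (poly (rising_poly 2 m) (of_nat e) * (of_nat (Suc m) + of_nat e :: complex))"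
      using n(2) rising_poly_first[of "Suc m" "of_nat e"] by (simp add: poly_rising_poly mult_ac)
    moreover have "poly (rising_poly (Suc 0) m) (of_nat (Suc e)) =
        poly (rising_poly 2 m) (of_nat e) * (of_nat e + of_nat m + 1 :: complex)"
      using n(2) rising_poly_shift[of m "of_nat e"] by (simp add: add.commute)
    moreover have "of_nat (nmon n e) = poly (rising_poly (Suc 0) (n - 1)) (of_nat e) / (fact (n - 1) :: complex)"
      using assms by (intro nmon_rising_poly) simp
    ultimately show ?thesis unfolding n1 n2 d by (simp add: ac_simps)
  qed
  define c :: complex where "c = of_nat (cpoly_dim (graded_part (joint_invariants n) (2 * d)))"
  have "cpoly_dim (graded_part (joint_invariants n) (2 * d)) +
      (if d = 0 then 0 else nmon n (d + 1) * nmon n (d - 1)) = nmon n d * nmon n d"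
  proof -
    have "2 * d - d = d" "2 * d - (d + 1) = d - 1" by auto
    then show ?thesis using dim_graded_invariants[of n "2 * d"] unfolding card_form_mons 0 2
      by (simp split: if_splits)
  qed
  then have "c + of_nat (if d = 0 then 0 else nmon n (d + 1) * nmon n (d - 1)) = of_nat (nmon n d) * of_nat (nmon n d)"
    unfolding c_def by (metis of_nat_add of_nat_mult)
  moreover have "of_nat (if d = 0 then 0 else nmon n (d + 1) * nmon n (d - 1)) =
     (of_nat d + of_nat (n - 1) + 1) * ?A * (of_nat d * ?B) / (fact (n - 1))\<^sup>2"
    using q3 q4 by (auto simp: power2_eq_square)
  moreover have "of_nat (nmon n d) * of_nat (nmon n d) =
     (1 + of_nat d) * ?A * ((of_nat (n - 1) + of_nat d) * ?B) / (fact (n - 1))\<^sup>2"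
    by (subst q1, subst q2) (simp add: power2_eq_square)
  ultimately have "c = ((1 + of_nat d) * ?A * ((of_nat (n - 1) + of_nat d) * ?B) -
     (of_nat d + of_nat (n - 1) + 1) * ?A * (of_nat d * ?B)) / (fact (n - 1))\<^sup>2"
    by (simp add: diff_divide_distrib eq_diff_eq)
  also have "\<dots> = of_nat (n - 1) * (?A * ?B) / (fact (n - 1))\<^sup>2"
    by (simp add: algebra_simps)
  finally show ?thesis by (simp add: c_def)
qed

text \<open>The value is a Catalan number: absorbing 1/k into the second binomial coefficient turns
  the sum into a Vandermonde convolution divided by m + 1.\<close>

lemma narayana_at_1:
  assumes "m \<ge> 1"
  shows "poly (narayana_poly m) 1 = of_nat ((2 * m) choose m) / of_nat (m + 1)"
proof -
  have t: "of_nat ((m - 1) choose (k - 1)) * of_nat (m choose (k - 1)) / of_nat k =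
      of_nat (((m - 1) choose (m - k)) * (Suc m choose k)) / (of_nat (m + 1) :: complex)" if "k \<in> {1..m}" for k
  proof -
    have "(m - 1) choose (k - 1) = (m - 1) choose (m - k)"
      using that binomial_symmetric[of "k - 1" "m - 1"] by fastforce
    moreover have "k * (Suc m choose k) = Suc m * (m choose (k - 1))"
      using that Suc_times_binomial[of "k - 1" m] by (cases k) auto
    then have "of_nat k * of_nat (Suc m choose k) = of_nat (Suc m) * (of_nat (m choose (k - 1)) :: complex)"
      by (metis of_nat_mult)
    then have "of_nat (m choose (k - 1)) / of_nat k = of_nat (Suc m choose k) / (of_nat (m + 1) :: complex)"
      using that by (simp add: divide_simps del: binomial_Suc_Suc of_nat_Suc) (simp add: mult.commute)
    ultimately show ?thesis by (simp del: binomial_Suc_Suc of_nat_Suc flip: times_divide_eq_right)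
  qed
  have "poly (narayana_poly m) 1 = (\<Sum>k=1..m. of_nat (((m - 1) choose (m - k)) * (Suc m choose k)) / of_nat (m + 1))"
    unfolding narayana_poly_def poly_sum poly_monom using t by (intro sum.cong) simp_all
  also have "\<dots> = of_nat (\<Sum>k=1..m. ((m - 1) choose (m - k)) * (Suc m choose k)) / of_nat (m + 1)"
    by (simp add: sum_divide_distrib)
  \<comment> \<open>The added term for \<open>k = 0\<close> is zero because
    \<open>(m - 1) choose m = 0\<close>.\<close>
  also have "(\<Sum>k=1..m. ((m - 1) choose (m - k)) * (Suc m choose k)) = (\<Sum>k\<le>m. (Suc m choose k) * ((m - 1) choose (m - k)))"
    using assms by (intro sum.mono_neutral_cong_left) (auto simp: not_le mult.commute)
  also have "\<dots> = (Suc m + (m - 1)) choose m" by (rule vandermonde)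
  also have "Suc m + (m - 1) = 2 * m" using assms by simp
  finally show ?thesis .
qed


section \<open>Transcendence degrees\<close>


lemma cpoly_vars_const [simp]: "cpoly_vars (cpoly_const c) = {}"
  by (auto simp: cpoly_vars_def cpoly_const_def split: if_splits)

lemma cpoly_vars_1 [simp]: "cpoly_vars 1 = {}"
  by (simp add: cpoly_vars_def)

lemma cpoly_vars_cvar [simp]: "cpoly_vars (cvar k) = {k}"
  by (simp add: cpoly_vars_def cvar_def)

lemma cpoly_vars_add: "cpoly_vars (p + q) \<subseteq> cpoly_vars p \<union> cpoly_vars q"
  using keys_add[of p q] by (auto simp: cpoly_vars_def)

lemma cpoly_vars_diff: "cpoly_vars (p - q) \<subseteq> cpoly_vars p \<union> cpoly_vars q"
proof -
  have "Poly_Mapping.keys (p - q) \<subseteq> Poly_Mapping.keys p \<union> Poly_Mapping.keys q"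
    by (auto simp: in_keys_iff lookup_minus)
  then show ?thesis by (auto simp: cpoly_vars_def)
qed

lemma cpoly_vars_mult: "cpoly_vars (p * q) \<subseteq> cpoly_vars p \<union> cpoly_vars q"
  using keys_mult[of p q] by (fastforce simp: cpoly_vars_def keys_add_nat)

lemma cpoly_vars_power: "cpoly_vars (p ^ N) \<subseteq> cpoly_vars p"
proof (induction N)
  case (Suc N)
  then show ?case using cpoly_vars_mult[of p "p ^ N"] by auto
qed simp

lemma complex_algebra_const: "complex_algebra (cpoly_const :: complex \<Rightarrow> 'v cpoly)"
  by unfold_locales
    (simp_all add: cpoly_const_mult, simp_all add: cpoly_const_def single_add)

context complex_algebra begin

lemma eval_power: "cpoly_eval h v (p ^ N) = cpoly_eval h v p ^ N"
  by (induction N) (simp_all add: eval_mult)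

lemma eval_eval:
  "cpoly_eval h v (cpoly_eval cpoly_const P F) = cpoly_eval h (\<lambda>k. cpoly_eval h v (P k)) F"
proof -
  interpret c: complex_algebra cpoly_const by (rule complex_algebra_const)
  show ?thesis
    by (rule cpoly_induct[of F UNIV]) (simp_all add: c.eval_add eval_add c.eval_cvar_mult eval_cvar_mult eval_mult)
qed

end

lemma cpoly_vars_eval:
  fixes P :: "'a \<Rightarrow> 'b cpoly"
  shows
  "cpoly_vars (cpoly_eval cpoly_const P F) \<subseteq> (\<Union>k\<in>cpoly_vars F. cpoly_vars (P k))"
proof -
  interpret c: complex_algebra "cpoly_const :: complex \<Rightarrow> 'b cpoly" by (rule complex_algebra_const)
  define U where "U = (\<Union>k\<in>cpoly_vars F. cpoly_vars (P k))"
  have "cpoly_vars F \<subseteq> cpoly_vars F" by simp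
  then have "cpoly_vars (cpoly_eval cpoly_const P F) \<subseteq> U"
  proof (induction rule: cpoly_induct)
    case (var k q)
    then show ?case
      using cpoly_vars_mult[of "P k" "cpoly_eval cpoly_const P q"] by (auto simp: c.eval_cvar_mult U_def)
  next
    case (add p q)
    then show ?case
      using cpoly_vars_add[of "cpoly_eval cpoly_const P p" "cpoly_eval cpoly_const P q"] by (auto simp: c.eval_add)
  qed simp
  then show ?thesis by (simp add: U_def)
qed

lemma cvar_mult_eq_0: "cvar k * p = 0 \<Longrightarrow> p = 0"
  by (metis lookup_mult_cvar_add lookup_zero poly_mapping_eqI)

abbreviation emb :: "'a::idom \<Rightarrow> 'a fract" where
  "emb x \<equiv> Fraction_Field.Fract x 1"

lemma emb_inject [simp]: "emb x = emb y \<longleftrightarrow> x = y"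
  by (simp add: eq_fract)

lemma emb_eq_0_iff [simp]: "emb x = 0 \<longleftrightarrow> x = 0"
  by (simp add: Zero_fract_def eq_fract)

lemma emb_mult: "emb (x * y) = emb x * emb y"
  by simp

lemma complex_algebra_fract: "complex_algebra (\<lambda>c. emb (cpoly_const c :: nat cpoly))"
  by unfold_locales
    (simp_all add: cpoly_const_mult[symmetric], simp_all add: cpoly_const_def single_add One_fract_def)

lemma eval_emb:
  fixes P :: "'v \<Rightarrow> nat cpoly"
  shows "cpoly_eval (\<lambda>c. emb (cpoly_const c)) (\<lambda>k. emb (P k)) F = emb (cpoly_eval cpoly_const P F)"
proof -
  interpret c: complex_algebra "cpoly_const :: complex \<Rightarrow> nat cpoly" by (rule complex_algebra_const)
  interpret d: complex_algebra "\<lambda>c. emb (cpoly_const c :: nat cpoly)" by (rule complex_algebra_fract)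
  show ?thesis
    by (rule cpoly_induct[of F UNIV]) (simp_all add: c.eval_add d.eval_add c.eval_cvar_mult d.eval_cvar_mult)
qed

lemma ev_eval: "ev w (cpoly_eval cpoly_const P F) = ev (\<lambda>k. ev w (P k)) F"
  unfolding ev_def by (rule id.eval_eval)

text \<open>The product of \<open>r\<close> with the difference vanishes everywhere, and the
  polynomial ring is a domain.\<close>

lemma cpoly_eqI_generic:
  fixes p q r :: "nat cpoly"
  assumes "r \<noteq> 0" "\<And>w. ev w r \<noteq> 0 \<Longrightarrow> ev w p = ev w q"
  shows "p = q"
proof -
  have "r * p = r * q"
    by (rule cpoly_eqI_ev) (use assms(2) in auto)
  with assms(1) show ?thesis by simp
qed

text \<open>The values of the \<open>P k\<close> can be prescribed freely apart from
  \<open>P \<beta>\<close> being nonzero, which makes them independent. Up to powers of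
  \<open>P \<beta>\<close> every element of \<open>R\<close> is a polynomial in them, so every
  further fraction is algebraically dependent on them.\<close>

lemma has_transcendence_degreeI:
  fixes P :: "nat \<Rightarrow> nat cpoly"
  assumes J: "finite J" "\<beta> \<in> J"
    and R: "\<And>k. k \<in> J \<Longrightarrow> P k \<in> R" "1 \<in> R"
    and slice: "\<And>u. u \<beta> \<noteq> 0 \<Longrightarrow> \<exists>w. \<forall>k\<in>J. ev w (P k) = u k"
    and gen: "\<And>f. f \<in> R \<Longrightarrow> \<exists>N F. cpoly_vars F \<subseteq> J \<and>
       (\<forall>w. ev w (P \<beta>) \<noteq> 0 \<longrightarrow> ev (\<lambda>k. ev w (P k)) F = ev w (P \<beta>) ^ N * ev w f)"
  shows "has_transcendence_degree (quotient_field R) (card J)"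
proof -
  interpret c: complex_algebra "cpoly_const :: complex \<Rightarrow> nat cpoly" by (rule complex_algebra_const)
  interpret d: complex_algebra "\<lambda>c. emb (cpoly_const c :: nat cpoly)" by (rule complex_algebra_fract)
  define \<rho> where "\<rho> k = emb (P k)" for k
  define B where "B = \<rho> ` J"
  define y\<beta> where "y\<beta> = \<rho> \<beta>"
  have inj: "inj_on \<rho> J"
  proof (rule inj_onI, rule ccontr)
    fix k l assume kl: "k \<in> J" "l \<in> J" "\<rho> k = \<rho> l" "k \<noteq> l"
    \<comment> \<open>The values 1 and 2 separate \<open>k\<close> from every other index, and
      neither is the forbidden value 0.\<close>
    have "(if \<beta> = k then 1 else 2) \<noteq> (0 :: complex)" by simp
    from slice[of "\<lambda>i. if i = k then 1 else 2", OF this]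
    obtain w where w: "\<forall>i\<in>J. ev w (P i) = (if i = k then 1 else 2)" by blast
    have "ev w (P k) = 1" "ev w (P l) = 2"
      using bspec[OF w kl(1)] bspec[OF w kl(2)] kl(4) by simp_all
    moreover have "P k = P l" using kl(3) by (simp add: \<rho>_def)
    ultimately show False by simp
  qed
  define idx where "idx = inv_into J \<rho>"
  have idx: "idx y \<in> J" "\<rho> (idx y) = y" if "y \<in> B" for y
    using that by (auto simp: idx_def B_def inv_into_into f_inv_into_f)
  have P\<beta>: "P \<beta> \<noteq> 0"
    using slice[of "\<lambda>_. 1"] J(2) by auto
  have y\<beta>: "y\<beta> \<in> B" "y\<beta> \<noteq> 0"
    using J(2) P\<beta> by (auto simp: y\<beta>_def B_def \<rho>_def)
  have indep: "algebraically_independent B"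
    unfolding algebraically_independent_def
  proof (intro allI impI, elim conjE)
    fix p assume vars: "cpoly_vars p \<subseteq> B" and "cpoly_eval (\<lambda>c. emb (cpoly_const c)) id p = 0"
    moreover have "cpoly_eval (\<lambda>c. emb (cpoly_const c)) id p =
        cpoly_eval (\<lambda>c. emb (cpoly_const c)) (\<lambda>y. emb (P (idx y))) p"
      by (rule d.eval_cong) (use vars idx in \<open>auto simp: \<rho>_def\<close>)
    ultimately have 0: "cpoly_eval cpoly_const (\<lambda>y. P (idx y)) p = 0"
      by (simp add: eval_emb)
    \<comment> \<open>Multiplying by the variable \<open>y\<beta>\<close> disposes of the points
      that the slice does not reach.\<close>
    have "ev v (cvar y\<beta> * p) = 0" for v
    proof (cases "v y\<beta> = 0")
      case False
      then obtain w where w: "\<forall>k\<in>J. ev w (P k) = v (\<rho> k)"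
        using slice[of "\<lambda>k. v (\<rho> k)"] by (auto simp: y\<beta>_def)
      have "ev v p = ev (\<lambda>y. ev w (P (idx y))) p"
        by (rule ev_cong) (use vars idx w in auto)
      also have "\<dots> = 0" using ev_eval[of w "\<lambda>y. P (idx y)" p] 0 by simp
      finally show ?thesis by simp
    qed simp
    then show "p = 0" by (rule cvar_mult_eq_0[OF cpoly_eq_0_if_ev_0])
  qed
  have gen': "\<exists>N F. cpoly_vars F \<subseteq> B \<and> cpoly_eval (\<lambda>c. emb (cpoly_const c)) id F = y\<beta> ^ N * emb f" if "f \<in> R" for f
  proof -
    obtain N F where F: "cpoly_vars F \<subseteq> J"
      and eq: "\<And>w. ev w (P \<beta>) \<noteq> 0 \<Longrightarrow> ev (\<lambda>k. ev w (P k)) F = ev w (P \<beta>) ^ N * ev w f"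
      using gen[OF \<open>f \<in> R\<close>] by blast
    let ?F = "cpoly_eval cpoly_const (\<lambda>k. cvar (\<rho> k)) F"
    have "cpoly_vars ?F \<subseteq> B"
      using cpoly_vars_eval[of "\<lambda>k. cvar (\<rho> k)" F] F by (auto simp: B_def)
    moreover have "cpoly_eval cpoly_const P F = P \<beta> ^ N * f"
      by (rule cpoly_eqI_generic[OF P\<beta>]) (simp add: ev_eval eq)
    then have "cpoly_eval (\<lambda>c. emb (cpoly_const c)) id ?F = emb (P \<beta> ^ N * f)"
      unfolding d.eval_eval d.eval_cvar by (simp only: \<rho>_def id_apply eval_emb)
    moreover have "emb (P \<beta> ^ N * f) = y\<beta> ^ N * emb f"
      by (induction N) (simp_all add: y\<beta>_def \<rho>_def mult.assoc emb_mult del: mult_fract)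
    ultimately have "cpoly_vars ?F \<subseteq> B \<and> cpoly_eval (\<lambda>c. emb (cpoly_const c)) id ?F = y\<beta> ^ N * emb f"
      by (simp only:)
    then show ?thesis by (intro exI)
  qed
  have max: "\<not> algebraically_independent (insert y B)" if y: "y \<in> quotient_field R - B" for y
  proof
    assume ind: "algebraically_independent (insert y B)"
    obtain a b where ab: "a \<in> R" "b \<in> R" "b \<noteq> 0" "y = Fraction_Field.Fract a b"
      using y by (auto simp: quotient_field_def)
    obtain N F where F: "cpoly_vars F \<subseteq> B" "cpoly_eval (\<lambda>c. emb (cpoly_const c)) id F = y\<beta> ^ N * emb a"
      using gen'[OF ab(1)] by blast
    obtain M G where G: "cpoly_vars G \<subseteq> B" "cpoly_eval (\<lambda>c. emb (cpoly_const c)) id G = y\<beta> ^ M * emb b"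
      using gen'[OF ab(2)] by blast
    \<comment> \<open>With y = a/b and equalized powers of \<open>y\<beta>\<close>, \<open>S\<close>
      represents the denominator and \<open>T\<close> the numerator, so
      \<open>cvar y * S - T\<close> is a relation linear in \<open>y\<close>.\<close>
    define S where "S = cvar y\<beta> ^ N * G"
    define T where "T = cvar y\<beta> ^ M * F"
    have yb: "y * emb b = emb a" using ab by (simp add: eq_fract mult.commute)
    have S: "cpoly_eval (\<lambda>c. emb (cpoly_const c)) id S = y\<beta> ^ N * (y\<beta> ^ M * emb b)"
      unfolding S_def d.eval_mult d.eval_power d.eval_cvar G(2) by simp
    have T: "cpoly_eval (\<lambda>c. emb (cpoly_const c)) id T = y\<beta> ^ M * (y\<beta> ^ N * emb a)"
      unfolding T_def d.eval_mult d.eval_power d.eval_cvar F(2) by simp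
    have vars: "cpoly_vars S \<subseteq> B" "cpoly_vars T \<subseteq> B"
      using cpoly_vars_mult[of "cvar y\<beta> ^ N" G] cpoly_vars_mult[of "cvar y\<beta> ^ M" F]
        cpoly_vars_power[of "cvar y\<beta>"] F(1) G(1) y\<beta>(1) unfolding S_def T_def by fastforce+
    have "cpoly_eval (\<lambda>c. emb (cpoly_const c)) id (cvar y * S - T) = 0"
      unfolding d.eval_diff d.eval_cvar_mult S T yb[symmetric] by (simp add: mult_ac)
    moreover have "cpoly_vars (cvar y * S - T) \<subseteq> insert y B"
      using cpoly_vars_diff[of "cvar y * S" T] cpoly_vars_mult[of "cvar y" S] vars by auto
    ultimately have "cvar y * S - T = 0"
      using ind unfolding algebraically_independent_def by blast
    then have T': "T = cvar y * S" by simp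
    have "S \<noteq> 0" using S y\<beta>(2) ab(3) by auto
    then obtain m where m: "Poly_Mapping.lookup S m \<noteq> 0"
      by (metis lookup_zero poly_mapping_eqI)
    \<comment> \<open>Since \<open>S\<close> is nonzero, \<open>y\<close> occurs in
      \<open>cvar y * S\<close>; but the variables of \<open>T\<close> all lie in \<open>B\<close>,
      which does not contain \<open>y\<close>.\<close>
    then have "m + Poly_Mapping.single y (Suc 0) \<in> Poly_Mapping.keys T"
      by (simp add: T' in_keys_iff)
    then have "y \<in> cpoly_vars T"
      by (force simp: cpoly_vars_def keys_add_nat)
    with vars y show False by auto
  qed
  have "B \<subseteq> quotient_field R"
    using R by (force simp: B_def \<rho>_def quotient_field_def)
  then have "transcendence_basis (quotient_field R) B"
    using indep max by (simp add: transcendence_basis_def)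
  moreover have "finite B" "card B = card J"
    using J(1) inj by (simp_all add: B_def card_image)
  ultimately show ?thesis unfolding has_transcendence_degree_def by blast
qed

text \<open>The determinant of the twisted vectors \<open>i\<close> and \<open>j\<close>. Because of
  the twist, \<open>bracket 0 j\<close> is the value of the form \<open>j\<close> at the point of
  the plane.\<close>

definition bracket :: "nat \<Rightarrow> nat \<Rightarrow> nat cpoly" where
  "bracket i j = cvar (hp i) * (cpoly_const (hs j) * cvar (hq j)) - cvar (hp j) * (cpoly_const (hs i) * cvar (hq i))"

lemma ev_bracket: "ev v (bracket i j) = v (hp i) * (hs j * v (hq j)) - v (hp j) * (hs i * v (hq i))"
  by (simp add: bracket_def)

lemma cpoly_vars_bracket: "cpoly_vars (bracket i j) \<subseteq> {hp i, hq i, hp j, hq j}"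
proof -
  have *: "cpoly_vars (cvar k * (cpoly_const c * cvar l)) \<subseteq> {k, l}" for k l :: nat and c
    using cpoly_vars_mult[of "cvar k" "cpoly_const c * cvar l"] cpoly_vars_mult[of "cpoly_const c" "cvar l"] by auto
  show ?thesis
    using cpoly_vars_diff[of "cvar (hp i) * (cpoly_const (hs j) * cvar (hq j))" "cvar (hp j) * (cpoly_const (hs i) * cvar (hq i))"]
      *[of "hp i" "hs j" "hq j"] *[of "hp j" "hs i" "hq i"]
    unfolding bracket_def by blast
qed

lemma SL2_invariant_bracket: "SL2_invariant (bracket i j)"
  unfolding SL2_invariant_iff_hact
proof (intro allI impI)
  fix \<alpha> \<beta> \<gamma> \<delta> :: complex and v :: "nat \<Rightarrow> complex" assume d: "\<alpha> * \<delta> - \<beta> * \<gamma> = 1"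
  define x y x' y' where "x = v (hp i)" and "y = hs i * v (hq i)" and "x' = v (hp j)" and "y' = hs j * v (hq j)"
  have "ev (hact \<alpha> \<beta> \<gamma> \<delta> v) (bracket i j) =
      (\<alpha> * x + \<gamma> * y) * (\<beta> * x' + \<delta> * y') - (\<alpha> * x' + \<gamma> * y') * (\<beta> * x + \<delta> * y)"
  proof -
    have "hs k * (\<beta> * (hs k * r) + \<delta> * s) = \<beta> * r + \<delta> * (hs k * s)" for k r s
      by (simp add: hs_def)
    then show ?thesis unfolding ev_bracket hact_hp hact_hq x_def y_def x'_def y'_def by (simp only:)
  qed
  also have "\<dots> = (\<alpha> * \<delta> - \<beta> * \<gamma>) * (x * y' - x' * y)" by (simp add: algebra_simps)
  finally show "ev (hact \<alpha> \<beta> \<gamma> \<delta> v) (bracket i j) = ev v (bracket i j)"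
    by (simp add: d ev_bracket x_def y_def x'_def y'_def)
qed

text \<open>Here \<open>a\<close> is the least index of a vector in use: 0 for covariants, 1 for
  invariants. The vectors \<open>a\<close> and \<open>Suc a\<close> are normalized to (1, 0) and (0,
  t) with \<open>t = u (hq (Suc a))\<close>; the remaining values of \<open>u\<close> are meant as
  brackets, and those that fix first coordinates must be divided by t.\<close>

definition slice :: "nat \<Rightarrow> (nat \<Rightarrow> complex) \<Rightarrow> nat \<Rightarrow> complex" where
  "slice a u k = (if k = hp a then 1 else if k = hq a \<or> k = hp (Suc a) then 0 else
     if k = hq (Suc a) then u k else if even k then u k / u (hq (Suc a)) else u k)"

text \<open>The bracket is numbered by the coordinate that it recovers on the slice: brackets with
  \<open>Suc a\<close> give t times a first coordinate, brackets with \<open>a\<close> give a second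
  coordinate. The number \<open>2 * a + 3\<close> is \<open>hq (Suc a)\<close> and yields t.\<close>

definition slice_coord :: "nat \<Rightarrow> nat \<Rightarrow> nat cpoly" where
  "slice_coord a k = (if even k then bracket (k div 2) (Suc a) else bracket a (k div 2))"

lemma slice_coord_slice:
  assumes "a \<le> 1" "k \<ge> 2 * a + 3" "u (2 * a + 3) \<noteq> 0"
  shows "ev (slice a u) (slice_coord a k) = u k"
proof (cases "even k")
  case True
  then obtain j where j: "k = 2 * j" by (rule evenE)
  then have "j > Suc a" using assms by simp
  moreover have "2 * j \<noteq> Suc (Suc (Suc (2 * a)))" by presburger
  ultimately have "j > Suc a" "2 * j \<noteq> Suc (Suc (Suc (2 * a)))" by blast+
  then show ?thesis using assms j
    by (auto simp: slice_coord_def ev_bracket slice_def hp_def hq_def hs_def numeral_3_eq_3)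
next
  case False
  then obtain j where j: "k = 2 * j + 1" by (rule oddE)
  then have "j \<ge> Suc a" using assms by simp
  then show ?thesis using assms j
    by (auto simp: slice_coord_def ev_bracket slice_def hp_def hq_def hs_def numeral_3_eq_3)
qed

text \<open>When the bracket of the vectors \<open>a\<close> and \<open>Suc a\<close> is nonzero,
  some element of SL2 moves the point into the slice without changing the value of
  \<open>f\<close>.\<close>

lemma ev_slice_invariant:
  assumes "a \<le> 1" and inv: "SL2_invariant f" and vars: "cpoly_vars f \<subseteq> {2 * a..<2 * n + 2}"
    and nz: "ev w (slice_coord a (2 * a + 3)) \<noteq> 0"
  shows "ev (slice a (\<lambda>k. ev w (slice_coord a k))) f = ev w f"
proof -
  let ?b = "Suc a"
  define t where "t = ev w (bracket a ?b)"
  have t: "t = ev w (slice_coord a (2 * a + 3))"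
    by (simp add: t_def slice_coord_def)
  \<comment> \<open>The columns are chosen so that the new coordinates of vector \<open>i\<close>
    are \<open>bracket i (Suc a)\<close> divided by \<open>t\<close> and \<open>bracket a i\<close>;
    this sends \<open>a\<close> to (1, 0) and \<open>Suc a\<close> to (0, t).\<close>
  define \<alpha> \<beta> \<gamma> \<delta> where "\<alpha> = hs ?b * w (hq ?b) / t" and "\<beta> = - (hs a * w (hq a))"
    and "\<gamma> = - (w (hp ?b) / t)" and "\<delta> = w (hp a)"
  have tnz: "t \<noteq> 0" using nz t by simp
  have tv: "t = w (hp a) * (hs ?b * w (hq ?b)) - w (hp ?b) * (hs a * w (hq a))"
    by (simp add: t_def ev_bracket)
  have det: "\<alpha> * \<delta> - \<beta> * \<gamma> = 1"
  proof -
    have "\<alpha> * \<delta> - \<beta> * \<gamma> = (w (hp a) * (hs ?b * w (hq ?b)) - w (hp ?b) * (hs a * w (hq a))) / t"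
      by (simp add: \<alpha>_def \<beta>_def \<gamma>_def \<delta>_def diff_divide_distrib mult_ac)
    then show ?thesis unfolding tv[symmetric] using tnz by simp
  qed
  have hpv: "hact \<alpha> \<beta> \<gamma> \<delta> w (hp i) = ev w (bracket i ?b) / t" for i
    using tnz by (simp add: \<alpha>_def \<gamma>_def ev_bracket divide_simps)
  have hqv: "hact \<alpha> \<beta> \<gamma> \<delta> w (hq i) = hs i * ev w (bracket a i)" for i
    by (simp add: \<beta>_def \<delta>_def ev_bracket algebra_simps)
  have "ev (slice a (\<lambda>k. ev w (slice_coord a k))) f = ev (hact \<alpha> \<beta> \<gamma> \<delta> w) f"
  proof (rule ev_cong)
    fix k assume k: "k \<in> cpoly_vars f"
    define i where "i = k div 2"
    have "k \<ge> 2 * a" using k vars by auto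
    then have ia: "i \<ge> a" unfolding i_def by linarith
    have q: "hq ?b = 2 * a + 3" by (simp add: hq_def)
    consider "k = hp i" | "k = hq i" using hp_hq_cases i_def by blast
    then show "slice a (\<lambda>k. ev w (slice_coord a k)) k = hact \<alpha> \<beta> \<gamma> \<delta> w k"
    proof cases
      case 1
      consider "i = a" | "i = ?b" | "i > ?b" using ia by linarith
      then show ?thesis
      proof cases
        case 1
        then have "ev w (bracket i ?b) / t = 1" using tnz by (simp add: t_def)
        then show ?thesis unfolding \<open>k = hp i\<close> hpv using 1 by (simp add: slice_def)
      next
        case 2
        then have "ev w (bracket i ?b) / t = 0" by (simp add: ev_bracket)
        then show ?thesis unfolding \<open>k = hp i\<close> hpv using 2 by (simp add: slice_def)
      next
        case 3
        then have "even k" "k div 2 = i" using 1 by (auto simp: hp_def)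
        moreover have "hp i \<noteq> 2 * a + 3" using 3 by (simp add: hp_def)
        ultimately show ?thesis unfolding \<open>k = hp i\<close> hpv using 3 t 1 by (simp add: slice_def slice_coord_def q)
      qed
    next
      case 2
      show ?thesis
      proof (cases "i = a")
        case True
        then have "hs i * ev w (bracket a i) = 0" by (simp add: ev_bracket)
        then show ?thesis unfolding \<open>k = hq i\<close> hqv using True by (simp add: slice_def)
      next
        case False
        then have "odd k" "k div 2 = i" "hs i = 1" using ia 2 by (auto simp: hq_def hs_def)
        moreover have "slice a u k = u k" for u using \<open>odd k\<close> False 2 by (simp add: slice_def)
        moreover have "hact \<alpha> \<beta> \<gamma> \<delta> w k = hs i * ev w (bracket a i)" unfolding 2 by (rule hqv)
        ultimately show ?thesis by (simp add: slice_coord_def)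
      qed
    qed
  qed
  also have "\<dots> = ev w f" using inv det by (simp add: SL2_invariant_iff_hact)
  finally show ?thesis .
qed

text \<open>The only denominator on the slice is t, so multiplying by a power of t makes the
  restriction of \<open>f\<close> a polynomial in the parameters.\<close>

lemma slice_polynomial:
  assumes "a \<le> 1" "a < n" and vars: "cpoly_vars f \<subseteq> {2 * a..<2 * n + 2}"
  shows "\<exists>N F. cpoly_vars F \<subseteq> {2 * a + 3..2 * n + 1} \<and>
    (\<forall>u. u (2 * a + 3) \<noteq> 0 \<longrightarrow> ev u F = u (2 * a + 3) ^ N * ev (slice a u) f)"
  using vars
proof (induction rule: cpoly_induct)
  case (const c)
  show ?case by (rule exI[of _ 0], rule exI[of _ "cpoly_const c"]) simp
next
  case (var k g)
  let ?\<beta> = "2 * a + 3" and ?J = "{2 * a + 3..2 * n + 1}"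
  from var obtain N F where F: "cpoly_vars F \<subseteq> ?J"
    "\<And>u. u ?\<beta> \<noteq> 0 \<Longrightarrow> ev u F = u ?\<beta> ^ N * ev (slice a u) g" by blast
  have \<beta>: "?\<beta> \<in> ?J" using assms by simp
  have hq: "hq (Suc a) = ?\<beta>" by (simp add: hq_def)
  \<comment> \<open>A polynomial in the parameters for t times the slice coordinate number
    \<open>k\<close>: the constant 1 becomes t, and a first coordinate loses its
    denominator.\<close>
  define q where "q = (if k = hp a then cvar ?\<beta> else if k = hq a \<or> k = hp (Suc a) then 0 else
     if k \<noteq> ?\<beta> \<and> even k then cvar k else cvar ?\<beta> * cvar k)"
  have q: "ev u q = u ?\<beta> * slice a u k" if "u ?\<beta> \<noteq> 0" for u
    using that by (simp add: q_def slice_def hq)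
  have kJ: "k \<in> ?J" if "k \<noteq> hp a" "k \<noteq> hq a" "k \<noteq> hp (Suc a)"
    using that var(1) assms(1) by (auto simp: hp_def hq_def split: if_splits)
  have "cpoly_vars q \<subseteq> ?J"
    using kJ \<beta> cpoly_vars_mult[of "cvar ?\<beta>" "cvar k"] by (auto simp: q_def cpoly_vars_def[of 0])
  then have "cpoly_vars (q * F) \<subseteq> ?J" using cpoly_vars_mult[of q F] F(1) by blast
  moreover have "ev u (q * F) = u ?\<beta> ^ Suc N * ev (slice a u) (cvar k * g)" if "u ?\<beta> \<noteq> 0" for u
    using q[of u] F(2)[of u] that by simp
  ultimately show ?case by blast
next
  case (add f g)
  let ?\<beta> = "2 * a + 3" and ?J = "{2 * a + 3..2 * n + 1}"
  from add obtain N F M G where F: "cpoly_vars F \<subseteq> ?J"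
    "\<And>u. u ?\<beta> \<noteq> 0 \<Longrightarrow> ev u F = u ?\<beta> ^ N * ev (slice a u) f"
    and G: "cpoly_vars G \<subseteq> ?J"
    "\<And>u. u ?\<beta> \<noteq> 0 \<Longrightarrow> ev u G = u ?\<beta> ^ M * ev (slice a u) g" by metis
  have \<beta>: "?\<beta> \<in> ?J" using assms by simp
  \<comment> \<open>Each summand is multiplied by the power of t belonging to the other, to reach a
    common exponent.\<close>
  let ?H = "cvar ?\<beta> ^ M * F + cvar ?\<beta> ^ N * G"
  have "cpoly_vars ?H \<subseteq> ?J"
    using cpoly_vars_add[of "cvar ?\<beta> ^ M * F" "cvar ?\<beta> ^ N * G"] cpoly_vars_mult[of "cvar ?\<beta> ^ M" F]
      cpoly_vars_mult[of "cvar ?\<beta> ^ N" G] cpoly_vars_power[of "cvar ?\<beta>" N] cpoly_vars_power[of "cvar ?\<beta>" M]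
      F(1) G(1) \<beta> unfolding cpoly_vars_cvar by blast
  moreover have "ev u ?H = u ?\<beta> ^ (N + M) * ev (slice a u) (f + g)" if "u ?\<beta> \<noteq> 0" for u
    using F(2)[of u] G(2)[of u] that by (simp add: power_add algebra_simps)
  ultimately show ?case by blast
qed

lemma transcendence_degree_invariants:
  assumes "a \<le> 1" "a < n"
  shows "has_transcendence_degree (quotient_field {p. cpoly_vars p \<subseteq> {2 * a..<2 * n + 2} \<and> SL2_invariant p})
    (2 * n - 2 * a - 1)"
proof -
  let ?J = "{2 * a + 3..2 * n + 1}" and ?R = "{p. cpoly_vars p \<subseteq> {2 * a..<2 * n + 2} \<and> SL2_invariant p}"
  have "has_transcendence_degree (quotient_field ?R) (card ?J)"
  proof (rule has_transcendence_degreeI)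
    show "2 * a + 3 \<in> ?J" using assms by simp
    show "slice_coord a k \<in> ?R" if "k \<in> ?J" for k
    proof -
      have "hp i \<in> {2 * a..<2 * n + 2} \<and> hq i \<in> {2 * a..<2 * n + 2}" if "a \<le> i" "i \<le> n" for i
        using that assms(1) by (auto simp: hp_def hq_def)
      moreover have "a \<le> k div 2" "k div 2 \<le> n" "a \<le> Suc a" "Suc a \<le> n" "a \<le> n" using that assms by auto
      ultimately show ?thesis
        using cpoly_vars_bracket[of a "k div 2"] cpoly_vars_bracket[of "k div 2" "Suc a"]
        unfolding slice_coord_def by (auto simp: SL2_invariant_bracket simp del: atLeastLessThan_iff)
    qed
    show "1 \<in> ?R" by (simp add: SL2_invariant_iff_hact)
    show "\<exists>w. \<forall>k\<in>?J. ev w (slice_coord a k) = u k" if "u (2 * a + 3) \<noteq> 0" for u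
      using slice_coord_slice[OF assms(1)] that by (intro exI[of _ "slice a u"]) auto
    show "\<exists>N F. cpoly_vars F \<subseteq> ?J \<and> (\<forall>w. ev w (slice_coord a (2 * a + 3)) \<noteq> 0 \<longrightarrow>
        ev (\<lambda>k. ev w (slice_coord a k)) F = ev w (slice_coord a (2 * a + 3)) ^ N * ev w f)" if f: "f \<in> ?R" for f
    proof -
      obtain N F where F: "cpoly_vars F \<subseteq> ?J"
        "\<And>u. u (2 * a + 3) \<noteq> 0 \<Longrightarrow> ev u F = u (2 * a + 3) ^ N * ev (slice a u) f"
        using slice_polynomial[OF assms, of f] f by blast
      have "ev (\<lambda>k. ev w (slice_coord a k)) F = ev w (slice_coord a (2 * a + 3)) ^ N * ev w f"
        if "ev w (slice_coord a (2 * a + 3)) \<noteq> 0" for w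
        using F(2)[of "\<lambda>k. ev w (slice_coord a k)"] ev_slice_invariant[OF assms(1), of f n w] f that by simp
      with F(1) show ?thesis by blast
    qed
  qed simp
  moreover have "card ?J = 2 * n - 2 * a - 1" using assms by simp
  ultimately show ?thesis by (simp only:)
qed


section \<open>Degrees of the algebras\<close>


lemma rising_poly_mult:
  shows "degree (rising_poly a b * rising_poly c d) = (Suc b - a) + (Suc d - c)"
    and "coeff (rising_poly a b * rising_poly c d) ((Suc b - a) + (Suc d - c)) = 1"
proof -
  have nz: "rising_poly x y \<noteq> 0" for x y
    using rising_poly_lead[of x y] by auto
  show "degree (rising_poly a b * rising_poly c d) = (Suc b - a) + (Suc d - c)"
    using nz by (simp add: degree_mult_eq rising_poly_degree)
  show "coeff (rising_poly a b * rising_poly c d) ((Suc b - a) + (Suc d - c)) = 1"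
    using coeff_mult_degree_sum[of "rising_poly a b" "rising_poly c d"] rising_poly_lead[of a b] rising_poly_lead[of c d]
    unfolding rising_poly_degree by simp
qed

text \<open>Only even degrees contribute, with coefficient (n - 1) / ((n - 1)!)^2 in degree 2n - 4;
  multiplied by (2n - 4)! it becomes the central binomial coefficient divided by n - 1.\<close>

lemma has_algebra_degree_invariants:
  assumes "n \<ge> 3"
  shows "has_algebra_degree (joint_invariants n) (of_nat ((2 * n - 4) choose (n - 2)) / (of_nat (n - 1) * 2 ^ (2 * n - 3)))"
proof -
  define m where "m = n - 2"
  have n: "n - 2 = m" "n - 1 = Suc m" "2 * n - 4 = 2 * m" "2 * n - 3 = Suc (2 * m)" "2 * n - 2 * 1 - 1 = Suc (2 * m)"
    using assms by (simp_all add: m_def)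
  define f where "f = smult (of_nat (n - 1) / (fact (n - 1))\<^sup>2) (rising_poly 2 (n - 1) * rising_poly (Suc 0) (n - 2))"
  have deg: "degree f \<le> 2 * m"
    unfolding f_def by (rule order_trans[OF degree_smult_le]) (simp add: rising_poly_mult(1) m_def)
  have coeff: "coeff f (2 * m) = of_nat (Suc m) / (fact (Suc m))\<^sup>2"
    using rising_poly_mult(2)[of 2 "n - 1" "Suc 0" "n - 2"] unfolding f_def coeff_smult n
    by (simp add: mult_2 del: fact_Suc)
  have "has_algebra_degree (joint_invariants n) ((coeff f (2 * m) + coeff 0 (2 * m)) * fact (2 * m) / 2 ^ Suc (2 * m))"
  proof (rule has_algebra_degreeI)
    show "has_transcendence_degree (quotient_field (joint_invariants n)) (Suc (2 * m))"
      using transcendence_degree_invariants[of 1 n] assms unfolding n joint_invariants_def by simp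
    show "of_nat (cpoly_dim (graded_part (joint_invariants n) (2 * d))) = poly f (of_nat d)" for d
      unfolding f_def by (rule dim_graded_invariants_even[OF assms])
    show "of_nat (cpoly_dim (graded_part (joint_invariants n) (2 * d + 1))) = poly 0 (of_nat d :: complex)" for d
      unfolding dim_graded_invariants_odd by simp
  qed (use deg in simp_all)
  also have "(coeff f (2 * m) + coeff 0 (2 * m)) * fact (2 * m) / 2 ^ Suc (2 * m) =
      of_nat ((2 * m) choose m) / (of_nat (Suc m) * 2 ^ Suc (2 * m))"
  proof -
    have "of_nat ((2 * m) choose m) = fact (2 * m) / (fact m * fact m :: complex)"
      by (subst binomial_fact) simp_all
    moreover have "of_nat (Suc m) / (fact (Suc m))\<^sup>2 = 1 / (of_nat (Suc m) * (fact m * fact m) :: complex)"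
      by (simp add: power2_eq_square del: of_nat_Suc)
    ultimately show ?thesis unfolding coeff by (simp del: of_nat_Suc)
  qed
  finally show ?thesis unfolding n .
qed

text \<open>Both parity classes have leading coefficient 1 / ((n - 1)!)^2; their sum cancels one
  factor 2 of the denominator.\<close>

lemma has_algebra_degree_covariants:
  assumes "n \<ge> 1"
  shows "has_algebra_degree (joint_covariants n) (of_nat ((2 * n - 2) choose (n - 1)) / 2 ^ (2 * n - 2))"
proof -
  define m where "m = n - 1"
  have n: "n - 1 = m" "2 * n - 2 = 2 * m" "2 * n - 2 * 0 - 1 = Suc (2 * m)" "Suc n - 2 = m"
    using assms by (simp_all add: m_def)
  define f where "f = smult (1 / (fact (n - 1))\<^sup>2) (rising_poly (Suc 0) (n - 1) * rising_poly (Suc 0) (n - 1))"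
  define h where "h = smult (1 / (fact (n - 1))\<^sup>2) (rising_poly (Suc 0) (n - 1) * rising_poly 2 n)"
  have deg: "degree f \<le> 2 * m" "degree h \<le> 2 * m"
    unfolding f_def h_def
    by (rule order_trans[OF degree_smult_le], simp only: rising_poly_mult(1), simp add: m_def)+
  have coeff: "coeff f (2 * m) = 1 / (fact m)\<^sup>2" "coeff h (2 * m) = 1 / (fact m)\<^sup>2"
    using rising_poly_mult(2)[of "Suc 0" "n - 1" "Suc 0" "n - 1"] rising_poly_mult(2)[of "Suc 0" "n - 1" 2 n]
    unfolding f_def h_def coeff_smult n by (simp_all add: mult_2)
  have "has_algebra_degree (joint_covariants n) ((coeff f (2 * m) + coeff h (2 * m)) * fact (2 * m) / 2 ^ Suc (2 * m))"
  proof (rule has_algebra_degreeI)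
    show "has_transcendence_degree (quotient_field (joint_covariants n)) (Suc (2 * m))"
      using transcendence_degree_invariants[of 0 n] assms unfolding n joint_covariants_def by simp
    show "of_nat (cpoly_dim (graded_part (joint_covariants n) (2 * d))) = poly f (of_nat d)" for d
      unfolding f_def by (rule dim_graded_covariants_even[OF assms])
    show "of_nat (cpoly_dim (graded_part (joint_covariants n) (2 * d + 1))) = poly h (of_nat d)" for d
      unfolding h_def by (rule dim_graded_covariants_odd[OF assms])
  qed (use deg in simp_all)
  also have "(coeff f (2 * m) + coeff h (2 * m)) * fact (2 * m) / 2 ^ Suc (2 * m) = of_nat ((2 * m) choose m) / 2 ^ (2 * m)"
  proof -
    have "of_nat ((2 * m) choose m) = fact (2 * m) / (fact m * fact m :: complex)"
      by (subst binomial_fact) simp_all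
    then show ?thesis unfolding coeff by (simp add: power2_eq_square)
  qed
  finally show ?thesis unfolding n .
qed

lemma narayana_poly_at_1_degree:
  assumes "n \<ge> 3"
  shows "poly (narayana_poly (n - 2)) 1 / 2 ^ (2 * n - 3) =
    of_nat ((2 * n - 4) choose (n - 2)) / (of_nat (n - 1) * 2 ^ (2 * n - 3))"
proof -
  have "2 * (n - 2) = 2 * n - 4" "n - 2 + 1 = n - 1" using assms by simp_all
  then show ?thesis using narayana_at_1[of "n - 2"] assms by (simp only: divide_divide_eq_left)
qed


theorem theorem3:
  shows
    "(\<forall>n::nat. n \<ge> 3 \<longrightarrow>
        has_algebra_degree (joint_invariants n)
          (poly (narayana_poly (n - 2)) 1 / 2 ^ (2 * n - 3)) \<and>
        poly (narayana_poly (n - 2)) 1 / 2 ^ (2 * n - 3) =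
          of_nat ((2 * n - 4) choose (n - 2)) / (of_nat (n - 1) * 2 ^ (2 * n - 3))) \<and>
     (\<forall>n::nat. n \<ge> 1 \<longrightarrow>
        has_algebra_degree (joint_covariants n)
          (of_nat ((2 * n - 2) choose (n - 1)) / 2 ^ (2 * n - 2)))"
  using has_algebra_degree_invariants has_algebra_degree_covariants narayana_poly_at_1_degree by simp

end
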